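(* Let $\mathcal D=(\mathbf o_1,\dots,\mathbf o_m)^t$ be a D-optimal design with $m$ measurements for the problem without model error, i.e. $$\mathcal D=\operatorname*{arg\,max}_{\|\mathbf o_j\|=1,\ j=1,\dots,m}\Psi(\mathcal O),\qquad \Psi(\mathcal O)=\tfrac12\log\det\big(I+\sigma^{-2}\Gamma_{\mathrm{pr}}^{1/2}\mathcal F^*\mathcal O^*\mathcal O\mathcal F\Gamma_{\mathrm{pr}}^{1/2}\big).$$ Let $\{\lambda_i\}_{i=1}^\infty$ be the eigenvalues of $\mathcal F\Gamma_{\mathrm{pr}}\mathcal F^*$ in decreasing order, and let $\{\eta_i\}_{i=1}^\infty$ be the (corresponding) eigenvalues of $\mathcal D^*\mathcal D$. Then: (1) $\operatorname{tr}\{\mathcal D^*\mathcal D\}=m$. (2) $\mathcal D^*\mathcal D$ and $\mathcal F\Gamma_{\mathrm{pr}}\mathcal F^*$ are simultaneously diagonalizable. (3) $k:=\operatorname{rank}\mathcal D^*\mathcal D\le m$ and $\Psi(\mathcal D)=\frac12\sum_{i=1}^{k}\log(1+\sigma^{-2}\lambda_i\eta_i)$. (4) $$\eta_i=\begin{cases}\dfrac mk-\sigma^2\lambda_i^{-1}+\dfrac{\sigma^2}{k}\displaystyle\sum_{j=1}^k\lambda_j^{-1}, & 1\le i\le k,\\[2mm] 0,& i>k.\end{cases}$$ (5) The covariance of the pushforward $\mathcal F_*\mu_{\mathrm{post}}^{\mathbf d,\mathcal D}$ of the posterior is $\big((\mathcal F\Gamma_{\mathrm{pr}}\mathcal F^*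 )^{-1}+\sigma^{-2}\mathcal D^*\mathcal D\big)^{-1}$, and its eigenvalues are $$\theta_i=\begin{cases}\left(\dfrac{\sum_{j=1}^k\lambda_j^{-1}+\sigma^{-2}m}{k}\right)^{-1}, & i\le k,\\[3mm] \lambda_i,& i>k.\end{cases}$$
   Context: $\mathcal H_p$ (parameter space) and $\mathcal H_o$ (observation space) are separable real Hilbert spaces, $\mathcal F:\mathcal H_p\to\mathcal H_o$ is a (bounded) linear forward operator, and $\sigma^2>0$. A measurement operator with $m$ measurements is $\mathcal O=(\mathbf o_1,\dots,\mathbf o_m)^t\in(\mathcal H_o^* )^m$, acting by $\mathcal Ou=(\mathbf o_1(u),\dots,\mathbf o_m(u))^t\in\mathbb R^m$; each $\mathbf o_j$ is identified with its Riesz representative in $\mathcal H_o$, so $\mathcal O^*:\mathbb R^m\to\mathcal H_o$ satisfies $\mathcal O^*e_j=\mathbf o_j$. The norm $\|\mathbf o_j\|$ is the $\mathcal H_o^*$ norm. The prior on the parameter $\mathbf m\in\mathcal H_p$ is Gaussian, $\mathcal N(\mathbf m_{\mathrm{pr}},\Gamma_{\mathrm{pr}})$, with positive definite covariance operator $\Gamma_{\mathrm{pr}}$. Data are $\mathbf d=\mathcal O\mathcal F\mathbf m+\varepsilon$ with $\varepsilon\sim\mathcal N(0,\sigma^2I_m)$ independent of $\mathbf m$ (no model error). The posterior $\mu_{\mathrm{post}}^{\mathbf d,\mathcal O}$ of $\mathbf m$ given $\mathbf d$ under $\mathcal O$ is Gaussian with covariance $\Gamma_{\mathrm{post}}=(\Gamma_{\mathrm{pr}}^{-1}+\sigma^{-2}\mathcal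 F^*\mathcal O^*\mathcal O\mathcal F)^{-1}$. The operator $\mathcal F\Gamma_{\mathrm{pr}}\mathcal F^*$ (prior covariance in $\mathcal H_o$) is assumed invertible; in infinite dimensions inverses of covariance operators are understood as densely defined operators. $\Psi(\mathcal O)$ is the expected Kullback–Leibler divergence from posterior to prior. "Simultaneously diagonalizable" means having a common orthonormal eigenbasis; the eigenvalues $\eta_i$ and $\lambda_i$ (and $\theta_i$) with the same index $i$ belong to the same eigenvector of a (suitable) common eigenbasis. *)

theory Defs
  imports "HOL-Probability.Probability"
begin

section \<open>Operators on Hilbert spaces\<close>

definition self_adjoint :: "('a::real_inner \<Rightarrow> 'a) \<Rightarrow> bool" where
  "self_adjoint T \<longleftrightarrow> bounded_linear T \<and> (\<forall>x y. T x \<bullet> y = x \<bullet> T y)"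

definition positive_semidefinite :: "('a::real_inner \<Rightarrow> 'a) \<Rightarrow> bool" where
  "positive_semidefinite T \<longleftrightarrow> self_adjoint T \<and> (\<forall>x. 0 \<le> T x \<bullet> x)"

definition positive_definite :: "('a::real_inner \<Rightarrow> 'a) \<Rightarrow> bool" where
  "positive_definite T \<longleftrightarrow> self_adjoint T \<and> (\<forall>x. x \<noteq> 0 \<longrightarrow> 0 < T x \<bullet> x)"

definition op_sqrt :: "('a::real_inner \<Rightarrow> 'a) \<Rightarrow> 'a \<Rightarrow> 'a" where
  "op_sqrt T = (THE R. positive_semidefinite R \<and> R \<circ> R = T)"

text \<open>Orthonormal bases in the Hilbert space sense: the linear span is dense.\<close>

definition orthonormal_basis :: "'a::real_inner set \<Rightarrow> bool" where
  "orthonormal_basis B \<longleftrightarrow>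
     pairwise orthogonal B \<and> (\<forall>b\<in>B. norm b = 1) \<and> closure (span B) = UNIV"

definition has_trace :: "('a::real_inner \<Rightarrow> 'a) \<Rightarrow> real \<Rightarrow> bool" where
  "has_trace T t \<longleftrightarrow> (\<forall>B. orthonormal_basis B \<longrightarrow> ((\<lambda>b. T b \<bullet> b) has_sum t) B)"

definition eigenspace :: "('a::real_vector \<Rightarrow> 'a) \<Rightarrow> real \<Rightarrow> 'a set" where
  "eigenspace T \<mu> = {x. T x = \<mu> *\<^sub>R x}"

text \<open>Only used for operators of finite rank (\<open>dim\<close> is 0 on infinite-dimensional spaces).\<close>

definition op_rank :: "('a::real_vector \<Rightarrow> 'b::real_vector) \<Rightarrow> nat" where
  "op_rank T = dim (range T)"

text \<open>The determinant of \<open>I + T\<close> for a self-adjoint operator \<open>T\<close> of finite rank on a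
  possibly infinite-dimensional space: the product of the eigenvalues \<open>1 + \<mu>\<close> with
  multiplicity.  The kernel of \<open>T\<close> only contributes factors 1, and the remaining eigenvalues
  are finitely many with finite multiplicity.\<close>

definition det_one_plus :: "('a::real_vector \<Rightarrow> 'a) \<Rightarrow> real" where
  "det_one_plus T =
     (\<Prod>\<mu> \<in> {\<mu>. \<mu> \<noteq> 0 \<and> (\<exists>x. x \<noteq> 0 \<and> T x = \<mu> *\<^sub>R x)}. (1 + \<mu>) ^ dim (eigenspace T \<mu>))"

text \<open>\<open>lam\<close> lists the eigenvalues of \<open>T\<close> in decreasing order, each repeated according to its
  multiplicity.  The index set \<open>N\<close> is all of \<open>nat\<close> or, so that finite-dimensional spaces are
  covered, \<open>{..<n}\<close>; indices start at 0.  A (Hamel) basis of the eigenspace is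
  matched with the occurrences of \<open>\<mu>\<close> instead of comparing with \<open>dim\<close>, so that an
  infinite-dimensional eigenspace is not mistaken for a trivial one.\<close>

definition decreasing_eigenvalues ::
    "nat set \<Rightarrow> ('a::real_vector \<Rightarrow> 'a) \<Rightarrow> (nat \<Rightarrow> real) \<Rightarrow> bool" where
  "decreasing_eigenvalues N T lam \<longleftrightarrow>
     (N = UNIV \<or> (\<exists>n. N = {..<n})) \<and> antimono_on N lam \<and>
     (\<forall>\<mu>. \<exists>B f. independent B \<and> span B = eigenspace T \<mu> \<and> bij_betw f {i\<in>N. lam i = \<mu>} B)"

definition orthonormal_basis_on :: "nat set \<Rightarrow> (nat \<Rightarrow> 'a::real_inner) \<Rightarrow> bool" where
  "orthonormal_basis_on N e \<longleftrightarrow> inj_on e N \<and> orthonormal_basis (e ` N)"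

definition simultaneously_diagonalizable ::
    "('a::real_inner \<Rightarrow> 'a) \<Rightarrow> ('a \<Rightarrow> 'a) \<Rightarrow> bool" where
  "simultaneously_diagonalizable S T \<longleftrightarrow>
     (\<exists>B. orthonormal_basis B \<and> (\<forall>b\<in>B. (\<exists>\<mu>. S b = \<mu> *\<^sub>R b) \<and> (\<exists>\<nu>. T b = \<nu> *\<^sub>R b)))"

text \<open>Partially defined operators are represented by their graphs, so that inverses of covariance
  operators are densely defined operators: the inverse is the converse relation, and a sum is
  defined on the intersection of the domains.\<close>

definition graph_of :: "('a \<Rightarrow> 'b) \<Rightarrow> ('a \<times> 'b) set" where
  "graph_of T = {(x, T x) | x. True}"

definition graph_add :: "('a \<times> 'b::plus) set \<Rightarrow> ('a \<times> 'b) set \<Rightarrow> ('a \<times> 'b) set" where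
  "graph_add R S = {(x, y + z) | x y z. (x, y) \<in> R \<and> (x, z) \<in> S}"

definition densely_invertible :: "('a::real_normed_vector \<Rightarrow> 'a) \<Rightarrow> bool" where
  "densely_invertible T \<longleftrightarrow> inj T \<and> closure (range T) = UNIV"


section \<open>Gaussian measures and covariances\<close>

text \<open>\<open>N(a, \<Gamma>)\<close> via its characteristic functional, with a trace class covariance operator.\<close>

definition gaussian_measure ::
    "'a::{real_inner, polish_space} measure \<Rightarrow> 'a \<Rightarrow> ('a \<Rightarrow> 'a) \<Rightarrow> bool" where
  "gaussian_measure M a \<Gamma> \<longleftrightarrow>
     prob_space M \<and> sets M = sets borel \<and>
     positive_semidefinite \<Gamma> \<and> (\<exists>t. has_trace \<Gamma> t) \<and>
     (\<forall>h. (CLINT x|M. iexp (h \<bullet> x)) = iexp (h \<bullet> a) * of_real (exp (- (h \<bullet> \<Gamma> h) / 2)))"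

definition has_covariance ::
    "'a::{real_inner, polish_space} measure \<Rightarrow> ('a \<Rightarrow> 'a) \<Rightarrow> bool" where
  "has_covariance M S \<longleftrightarrow>
     prob_space M \<and> sets M = sets borel \<and> bounded_linear S \<and>
     (\<forall>h. integrable M (\<lambda>x. (h \<bullet> x)\<^sup>2)) \<and>
     (\<forall>h k. h \<bullet> S k =
        (LINT x|M. (h \<bullet> x - (LINT y|M. h \<bullet> y)) * (k \<bullet> x - (LINT y|M. k \<bullet> y))))"


section \<open>The Bayesian inverse problem\<close>

text \<open>A measurement operator is a vector of continuous linear functionals; the norm of a component
  is the dual norm.\<close>

definition measure_op :: "('o::real_inner \<Rightarrow>\<^sub>L real) ^ 'm::finite \<Rightarrow> 'o \<Rightarrow> real ^ 'm" where
  "measure_op obs u = (\<chi> j. blinfun_apply (obs $ j) u)"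

definition design_op :: "('o::real_inner \<Rightarrow>\<^sub>L real) ^ 'm::finite \<Rightarrow> 'o \<Rightarrow> 'o" where
  "design_op obs = adjoint (measure_op obs) \<circ> measure_op obs"

definition obs_prior_cov :: "('p::real_inner \<Rightarrow> 'o::real_inner) \<Rightarrow> ('p \<Rightarrow> 'p) \<Rightarrow> 'o \<Rightarrow> 'o" where
  "obs_prior_cov F \<Gamma> = F \<circ> \<Gamma> \<circ> adjoint F"

text \<open>The D-optimality criterion (the expected Kullback--Leibler divergence from posterior to prior,
  which for the linear Gaussian problem is the following expression).\<close>

definition design_criterion ::
    "real \<Rightarrow> ('p::real_inner \<Rightarrow> 'o::real_inner) \<Rightarrow> ('p \<Rightarrow> 'p)
      \<Rightarrow> ('o \<Rightarrow>\<^sub>L real) ^ 'm::finite \<Rightarrow> real" where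
  "design_criterion \<sigma> F \<Gamma> obs = 1/2 * ln (det_one_plus
     (\<lambda>x. (1 / \<sigma>\<^sup>2) *\<^sub>R op_sqrt \<Gamma> (adjoint F (design_op obs (F (op_sqrt \<Gamma> x))))))"

definition D_optimal ::
    "real \<Rightarrow> ('p::real_inner \<Rightarrow> 'o::real_inner) \<Rightarrow> ('p \<Rightarrow> 'p)
      \<Rightarrow> ('o \<Rightarrow>\<^sub>L real) ^ 'm::finite \<Rightarrow> bool" where
  "D_optimal \<sigma> F \<Gamma> = is_arg_max (design_criterion \<sigma> F \<Gamma>) (\<lambda>obs. \<forall>j. norm (obs $ j) = 1)"

text \<open>The density at \<open>d\<close> of the data \<open>obs (F x) + \<epsilon>\<close> with \<open>\<epsilon> \<sim> N(0, \<sigma>\<^sup>2 I)\<close>,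
  given the parameter \<open>x\<close>.\<close>

definition likelihood ::
    "real \<Rightarrow> ('p::real_inner \<Rightarrow> 'o::real_inner) \<Rightarrow> ('o \<Rightarrow>\<^sub>L real) ^ 'm::finite
      \<Rightarrow> real ^ 'm \<Rightarrow> 'p \<Rightarrow> real" where
  "likelihood \<sigma> F obs d x = (\<Prod>j\<in>UNIV. normal_density (measure_op obs (F x) $ j) \<sigma> (d $ j))"

text \<open>The posterior given the data \<open>d\<close>, by Bayes' formula for its density with respect to the
  prior.\<close>

definition posterior ::
    "'p::{real_inner, polish_space} measure \<Rightarrow> real \<Rightarrow> ('p \<Rightarrow> 'o::real_inner)
      \<Rightarrow> ('o \<Rightarrow>\<^sub>L real) ^ 'm::finite \<Rightarrow> real ^ 'm \<Rightarrow> 'p measure" where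
  "posterior prior \<sigma> F obs d =
     density prior (\<lambda>x. ennreal (likelihood \<sigma> F obs d x / (LINT y|prior. likelihood \<sigma> F obs d y)))"

end

theory Submission
  imports Defs
begin

text \<open>
  Let \<open>g j\<close> be the Riesz vectors of the measurements, \<open>v = \<sigma>\<^sup>2\<close>, \<open>C\<close> the prior covariance in the
  observation space, \<open>W x = (1/v) *\<^sub>R (\<Sum>j. (g j \<bullet> x) *\<^sub>R g j)\<close> the information operator of the
  design, and \<open>S = inverse (inverse C + W)\<close>, described without inverses by
  \<open>posterior_covariance\<close>.

  By Sylvester's identity the criterion is half the logarithm of the determinant of the matrix
  \<open>gram v C g\<close> with entries \<open>\<delta> a b + (C (g a) \<bullet> g b) / v\<close> (\<open>det_gram\<close>).  The structure of a maximiser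
  follows by comparing it with three kinds of competitors.

  \<^item> Changing a single measurement.  The determinant is a constant times
    \<open>1 + (T (g j) \<bullet> g j) / v\<close>, where \<open>T\<close> is the posterior covariance for the other
    measurements (\<open>det_gram_update\<close>).  So \<open>g j\<close> maximises the form of \<open>T\<close> on the unit sphere and is an
    eigenvector of \<open>T\<close>, hence also of \<open>S\<close>, which differs from \<open>T\<close> by a rank one operator along
    \<open>T (g j)\<close> (\<open>optimal_eigenvector\<close>).

  \<^item> Rotating two orthogonal measurements by 45 degrees.  This does not change \<open>W\<close>, so the new design is
    optimal, too, and its measurements are eigenvectors of the same \<open>S\<close>.  Hence all \<open>g j\<close> share one
    eigenvalue \<open>\<tau>\<close> of \<open>S\<close> (\<open>optimal_scalar\<close>).  It follows that \<open>C\<close> and \<open>W\<close> commute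
    (\<open>optimal_commute\<close>), and that on a common eigenvector in the range of \<open>W\<close> their eigenvalues
    \<open>l\<close> and \<open>w\<close> satisfy \<open>1 / \<tau> = 1 / l + w\<close>.  Since the eigenvalues \<open>w\<close> add up to \<open>m / v\<close>, by
    Parseval, this determines \<open>\<tau>\<close> and all the \<open>w\<close>.

  \<^item> Exchanging a measured with an unmeasured eigenvector.  This shows that the measured directions
    belong to the largest eigenvalues of \<open>C\<close> (\<open>optimal_eigenvalues_dominate\<close>), so that the common
    eigenbasis can be enumerated in the prescribed order with the measured directions first
    (\<open>eigenbasis_enumeration\<close>).

  Two analytic ingredients make this work in infinite dimension.  The prior covariance is trace class,
  hence compact (\<open>psd_trace_class_compact\<close>), which gives its square root and the common eigenbasis of
  \<open>C\<close> and \<open>W\<close>.  And the posterior is computed from characteristic functionals: the likelihood of one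
  measurement is itself an average of characters, so that by Fubini's theorem the product with a Gaussian
  measure is a Gaussian measure whose covariance is a rank one update of the old one
  (\<open>gaussian_cf_update\<close>).  The same rank one updates lead from \<open>C\<close> to \<open>S\<close>
  (\<open>posterior_covariance_update\<close>), so that \<open>S\<close> is the covariance of the pushforward of the posterior.
\<close>

section \<open>Orthonormal sets and Hilbert space duality\<close>

definition orthonormal :: "'a::real_inner set \<Rightarrow> bool" where
  "orthonormal B \<longleftrightarrow> pairwise orthogonal B \<and> (\<forall>b\<in>B. norm b = 1)"

lemma orthonormal_basis_iff:
  "orthonormal_basis B \<longleftrightarrow> orthonormal B \<and> closure (span B) = UNIV"
  by (auto simp: orthonormal_basis_def orthonormal_def)

lemma orthonormal_inner:
  "orthonormal B \<Longrightarrow> a \<in> B \<Longrightarrow> b \<in> B \<Longrightarrow> a \<bullet> b = (if a = b then 1 else 0)"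
  by (auto simp: orthonormal_def pairwise_def orthogonal_def norm_eq_1)

lemma orthonormal_subset: "orthonormal B \<Longrightarrow> A \<subseteq> B \<Longrightarrow> orthonormal A"
  by (auto simp: orthonormal_def pairwise_def)

lemma orthonormal_independent:
  fixes B :: "'a::real_inner set"
  assumes "orthonormal B" shows "independent B"
  by (rule pairwise_orthogonal_independent) (use assms in \<open>auto simp: orthonormal_def\<close>)

lemma inner_orthonormal_sum:
  assumes "orthonormal F" "finite F" "a \<in> F"
  shows "(\<Sum>b\<in>F. c b *\<^sub>R b) \<bullet> a = c a"
proof -
  have "(\<Sum>b\<in>F. c b *\<^sub>R b) \<bullet> a = (\<Sum>b\<in>F. if b = a then c a else 0)"
    unfolding inner_sum_left
    by (intro sum.cong) (use assms orthonormal_inner[OF assms(1)] in auto)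
  then show ?thesis using assms by simp
qed

lemma norm_orthonormal_sum:
  assumes "orthonormal F" "finite F"
  shows "(norm (\<Sum>b\<in>F. c b *\<^sub>R b))\<^sup>2 = (\<Sum>b\<in>F. (c b)\<^sup>2)"
proof -
  have "(norm (\<Sum>b\<in>F. c b *\<^sub>R b))\<^sup>2 = (\<Sum>a\<in>F. c a * ((\<Sum>b\<in>F. c b *\<^sub>R b) \<bullet> a))"
    by (simp add: power2_norm_eq_inner inner_sum_right)
  also have "\<dots> = (\<Sum>a\<in>F. c a * c a)"
    by (intro sum.cong) (simp_all add: inner_orthonormal_sum[OF assms])
  finally show ?thesis by (simp add: power2_eq_square)
qed

lemma orthonormal_residual:
  fixes x :: "'a::real_inner"
  assumes "orthonormal F" "finite F"
  shows "(norm (x - (\<Sum>b\<in>F. (x \<bullet> b) *\<^sub>R b)))\<^sup>2 = (norm x)\<^sup>2 - (\<Sum>b\<in>F. (x \<bullet> b)\<^sup>2)"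
proof -
  let ?s = "\<Sum>b\<in>F. (x \<bullet> b) *\<^sub>R b"
  have "(norm (x - ?s))\<^sup>2 = (norm x)\<^sup>2 + (norm ?s)\<^sup>2 - 2 * (x \<bullet> ?s)"
    unfolding power2_norm_eq_inner by (simp add: inner_diff inner_commute)
  moreover have "x \<bullet> ?s = (\<Sum>b\<in>F. (x \<bullet> b)\<^sup>2)"
    by (simp add: inner_sum_right power2_eq_square)
  ultimately show ?thesis by (simp add: norm_orthonormal_sum[OF assms])
qed

text \<open>Subtracting the Fourier sum over \<open>F\<close> is the orthogonal projection onto the complement of
  the span of \<open>F\<close>, which gives the best approximation property below.\<close>

lemma residual_orthogonal_span:
  assumes "orthonormal F" "finite F" "y \<in> span F"
  shows "(x - (\<Sum>b\<in>F. (x \<bullet> b) *\<^sub>R b)) \<bullet> y = 0"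
  using assms(3)
proof (induction rule: span_induct_alt)
  case base show ?case by simp
next
  case (step c a y)
  have "(\<Sum>b\<in>F. (x \<bullet> b) *\<^sub>R b) \<bullet> a = x \<bullet> a"
    using inner_orthonormal_sum[OF assms(1,2) step(1)] by simp
  then show ?case using step by (simp add: inner_add_right inner_diff_left)
qed

lemma orthonormal_best_approximation:
  fixes x :: "'a::real_inner"
  assumes "orthonormal F" "finite F" "y \<in> span F"
  shows "norm (x - (\<Sum>b\<in>F. (x \<bullet> b) *\<^sub>R b)) \<le> norm (x - y)"
proof -
  let ?s = "\<Sum>b\<in>F. (x \<bullet> b) *\<^sub>R b"
  have s: "?s \<in> span F" by (simp add: span_sum span_base span_scale)
  have "(x - ?s) \<bullet> (?s - y) = 0"
    by (rule residual_orthogonal_span[OF assms(1,2)]) (use s assms(3) span_diff in blast)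
  then have "(norm ((x - ?s) + (?s - y)))\<^sup>2 = (norm (x - ?s))\<^sup>2 + (norm (?s - y))\<^sup>2"
    by (intro norm_add_Pythagorean) (simp add: orthogonal_def)
  then have "(norm (x - ?s))\<^sup>2 \<le> (norm (x - y))\<^sup>2" by simp
  then show ?thesis by (rule power2_le_imp_le) simp
qed

text \<open>Some \<open>y\<close> in the span of a finite part of \<open>B\<close> is close to \<open>x\<close>, and by best approximation
  every Fourier sum over a larger finite part is at least as close.\<close>

lemma orthonormal_basis_expansion:
  fixes x :: "'a::real_inner"
  assumes "orthonormal_basis B"
  shows "((\<lambda>b. (x \<bullet> b) *\<^sub>R b) has_sum x) B"
  unfolding has_sum_def
proof (rule tendstoI)
  fix e :: real assume "e > 0"
  have B: "orthonormal B" "x \<in> closure (span B)" using assms by (auto simp: orthonormal_basis_iff)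
  obtain y where y: "y \<in> span B" "dist y x < e"
    using B(2) \<open>e > 0\<close> unfolding closure_approachable by blast
  obtain F0 where F0: "finite F0" "F0 \<subseteq> B" "y \<in> span F0"
    using y(1) unfolding span_explicit by (auto intro: span_sum span_base span_scale)
  show "\<forall>\<^sub>F F in finite_subsets_at_top B. dist (\<Sum>b\<in>F. (x \<bullet> b) *\<^sub>R b) x < e"
    unfolding eventually_finite_subsets_at_top
  proof (intro exI[of _ F0] conjI allI impI F0)
    fix F assume F: "finite F \<and> F0 \<subseteq> F \<and> F \<subseteq> B"
    have "norm (x - (\<Sum>b\<in>F. (x \<bullet> b) *\<^sub>R b)) \<le> norm (x - y)"
      using F F0 B by (intro orthonormal_best_approximation)
        (auto intro: orthonormal_subset simp: span_mono[THEN subsetD])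
    then show "dist (\<Sum>b\<in>F. (x \<bullet> b) *\<^sub>R b) x < e" using y(2) by (simp add: dist_norm norm_minus_commute)
  qed
qed

lemma orthonormal_basis_inner:
  assumes "orthonormal_basis B"
  shows "((\<lambda>b. (x \<bullet> b) * (y \<bullet> b)) has_sum (x \<bullet> y)) B"
  using has_sum_bounded_linear[OF bounded_linear_inner_right[of y] orthonormal_basis_expansion[OF assms, of x]]
  by (simp add: inner_commute)

lemma orthonormal_basis_Parseval:
  assumes "orthonormal_basis B"
  shows "((\<lambda>b. (x \<bullet> b)\<^sup>2) has_sum (norm x)\<^sup>2) B"
  using orthonormal_basis_inner[OF assms, of x x] by (simp only: power2_eq_square flip: power2_norm_eq_inner)

text \<open>By Pythagoras, a block of terms of the series has a squared norm equal to the same block of the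
  numerical series of squares, so that the Cauchy property carries over.\<close>

lemma orthonormal_series_summable:
  fixes B :: "'a::{real_inner, complete_space} set"
  assumes B: "orthonormal B" and c: "(\<lambda>b. (c b)\<^sup>2) summable_on B"
  shows "(\<lambda>b. c b *\<^sub>R b) summable_on B"
proof -
  let ?f = "\<lambda>b. c b *\<^sub>R b" and ?q = "\<lambda>b. (c b)\<^sup>2"
  obtain L where L: "(?q has_sum L) B" using c by (auto simp: summable_on_def)
  have "\<exists>P. eventually P (finite_subsets_at_top B) \<and>
              (\<forall>F F'. P F \<and> P F' \<longrightarrow> dist (sum ?f F) (sum ?f F') < e)" if "e > 0" for e
  proof -
    have "\<forall>\<^sub>F F in finite_subsets_at_top B. dist (sum ?q F) L < (e/3)\<^sup>2"
      using L \<open>e > 0\<close> unfolding has_sum_def tendsto_iff by simp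
    then obtain F0 where F0: "finite F0" "F0 \<subseteq> B" "dist (sum ?q F0) L < (e/3)\<^sup>2"
      unfolding eventually_finite_subsets_at_top by blast
    define P where "P F \<longleftrightarrow> finite F \<and> F0 \<subseteq> F \<and> F \<subseteq> B" for F
    have close: "dist (sum ?f F) (sum ?f F0) \<le> e/3" if "P F" for F
    proof -
      have F: "finite F" "F0 \<subseteq> F" "F \<subseteq> B" using that by (auto simp: P_def)
      have "sum ?q F \<le> L"
        by (rule finite_sum_le_has_sum[OF L]) (use F in auto)
      moreover have "sum ?q (F - F0) = sum ?q F - sum ?q F0"
        using F by (simp add: sum_diff)
      ultimately have q: "sum ?q (F - F0) < (e/3)\<^sup>2"
        using F0(3) by (simp add: dist_real_def abs_less_iff)
      have "sum ?f F - sum ?f F0 = sum ?f (F - F0)"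
        using F by (simp add: sum_diff)
      then have "(norm (sum ?f F - sum ?f F0))\<^sup>2 = sum ?q (F - F0)"
        using norm_orthonormal_sum[OF orthonormal_subset[OF B], of "F - F0" c] F
        by (metis Diff_subset finite_Diff order_trans)
      then have "(norm (sum ?f F - sum ?f F0))\<^sup>2 \<le> (e/3)\<^sup>2" using q by linarith
      then have "norm (sum ?f F - sum ?f F0) \<le> e/3"
        by (rule power2_le_imp_le) (use \<open>e > 0\<close> in simp)
      then show ?thesis by (simp add: dist_norm)
    qed
    show ?thesis
    proof (intro exI[of _ P] conjI allI impI)
      show "eventually P (finite_subsets_at_top B)"
        unfolding eventually_finite_subsets_at_top P_def using F0 by blast
      fix F F' assume PP: "P F \<and> P F'"
      have "dist (sum ?f F) (sum ?f F') \<le> dist (sum ?f F) (sum ?f F0) + dist (sum ?f F') (sum ?f F0)"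
        by (rule dist_triangle2)
      also have "\<dots> \<le> e/3 + e/3" using close PP by (intro add_mono) auto
      also have "\<dots> < e" using \<open>e > 0\<close> by simp
      finally show "dist (sum ?f F) (sum ?f F') < e" .
    qed
  qed
  then have "cauchy_filter (filtermap (sum ?f) (finite_subsets_at_top B))"
    by (simp add: cauchy_filter_metric_filtermap)
  then obtain L' where "(sum ?f \<longlongrightarrow> L') (finite_subsets_at_top B)"
    using complete_uniform[where S="UNIV :: 'a set"] complete_UNIV[where 'a='a] by (force simp add: filterlim_def)
  then show ?thesis using summable_on_def has_sum_def by blast
qed

text \<open>This lemma and the next one transfer statements about a basis to the whole space by continuity.\<close>

lemma orthogonal_closure_span:
  fixes z :: "'a::real_inner"
  assumes "\<And>b. b \<in> B \<Longrightarrow> z \<bullet> b = 0" "x \<in> closure (span B)"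
  shows "z \<bullet> x = 0"
proof -
  have "closed {x. z \<bullet> x = 0}" by (intro closed_Collect_eq continuous_intros)
  moreover have "span B \<subseteq> {x. z \<bullet> x = 0}"
    by (rule span_minimal) (auto simp: assms(1) subspace_def inner_add_right)
  ultimately have "closure (span B) \<subseteq> {x. z \<bullet> x = 0}" by (rule closure_minimal[rotated])
  then show ?thesis using assms(2) by auto
qed

lemma closure_span_eqI:
  fixes f g :: "'a::real_normed_vector \<Rightarrow> 'b::real_normed_vector"
  assumes "bounded_linear f" "bounded_linear g" "closure (span B) = UNIV"
    and "\<And>b. b \<in> B \<Longrightarrow> f b = g b"
  shows "f = g"
proof -
  interpret f: bounded_linear f by fact
  interpret g: bounded_linear g by fact
  have "closed {x. f x = g x}"
    by (intro closed_Collect_eq f.continuous_on g.continuous_on continuous_intros)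
  moreover have "span B \<subseteq> {x. f x = g x}"
    by (rule span_minimal) (auto simp: assms(4) subspace_def f.add g.add f.scaleR g.scaleR f.zero g.zero)
  ultimately have "closure (span B) \<subseteq> {x. f x = g x}" by (rule closure_minimal[rotated])
  then show ?thesis using assms(3) by auto
qed

text \<open>The projection theorem in the form in which it is used: the foot of the perpendicular from a point
  outside \<open>M\<close> is the limit of a sequence of points of \<open>M\<close> whose distances approach the
  minimum.\<close>

lemma exists_orthogonal_vector:
  fixes M :: "'a::{real_inner, complete_space} set"
  assumes M: "subspace M" "closed M" and "M \<noteq> UNIV"
  shows "\<exists>z. z \<noteq> 0 \<and> (\<forall>y\<in>M. z \<bullet> y = 0)"
proof -
  obtain x where x: "x \<notin> M" using assms(3) by auto
  have ne: "M \<noteq> {}" using subspace_0[OF M(1)] by auto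
  define d where "d = infdist x M"
  have dle: "d \<le> norm (x - y)" if "y \<in> M" for y
    using infdist_le[OF that, of x] by (simp add: d_def dist_norm)
  have d0: "d \<ge> 0" by (simp add: d_def infdist_nonneg)
  have "\<exists>y\<in>M. (norm (x - y))\<^sup>2 < d\<^sup>2 + 1 / real (Suc n)" for n
  proof (rule ccontr)
    assume "\<not> ?thesis"
    then have *: "\<And>y. y \<in> M \<Longrightarrow> sqrt (d\<^sup>2 + 1 / real (Suc n)) \<le> norm (x - y)"
      by (auto simp: real_le_lsqrt not_less)
    have "sqrt (d\<^sup>2 + 1 / real (Suc n)) \<le> d"
      unfolding d_def infdist_notempty[OF ne]
      by (rule cINF_greatest[OF ne]) (use * in \<open>auto simp: dist_norm d_def infdist_notempty[OF ne]\<close>)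
    then have "d\<^sup>2 + 1 / real (Suc n) \<le> d\<^sup>2" using d0
      by (metis real_sqrt_le_iff real_sqrt_unique)
    then show False by simp
  qed
  then obtain y where y: "\<And>n. y n \<in> M" "\<And>n. (norm (x - y n))\<^sup>2 < d\<^sup>2 + 1 / real (Suc n)" by metis
  \<comment> \<open>The midpoint of two points of \<open>M\<close> is no closer than \<open>d\<close>, so by the parallelogram law the sequence is Cauchy.\<close>
  have par: "(norm (y m - y n))\<^sup>2 \<le> 2 * (1 / real (Suc m)) + 2 * (1 / real (Suc n))" for m n
  proof -
    have "(1/2) *\<^sub>R (y m + y n) \<in> M" using y(1) M(1) by (simp add: subspace_add subspace_scale)
    from dle[OF this] have "d\<^sup>2 \<le> (norm (x - (1/2) *\<^sub>R (y m + y n)))\<^sup>2"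
      using d0 by (simp add: power_mono)
    moreover have "(norm (y m - y n))\<^sup>2 = 2 * (norm (x - y m))\<^sup>2 + 2 * (norm (x - y n))\<^sup>2
        - 4 * (norm (x - (1/2) *\<^sub>R (y m + y n)))\<^sup>2"
      unfolding power2_norm_eq_inner
      by (simp add: inner_diff inner_add inner_commute algebra_simps)
    ultimately show ?thesis using y(2)[of m] y(2)[of n] by linarith
  qed
  have "Cauchy y"
  proof (rule metric_CauchyI)
    fix e :: real assume "e > 0"
    then obtain k where k: "1 / real (Suc k) < e\<^sup>2 / 4"
      by (metis nat_approx_posE zero_less_divide_iff zero_less_numeral zero_less_power)
    show "\<exists>M. \<forall>m\<ge>M. \<forall>n\<ge>M. dist (y m) (y n) < e"
    proof (intro exI[of _ k] allI impI)
      fix m n assume mn: "m \<ge> k" "n \<ge> k"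
      have "1 / real (Suc m) \<le> 1 / real (Suc k)" "1 / real (Suc n) \<le> 1 / real (Suc k)"
        using mn by (auto simp: frac_le)
      then have "(norm (y m - y n))\<^sup>2 < e\<^sup>2" using par[of m n] k by linarith
      then have "norm (y m - y n) < e" by (rule power2_less_imp_less) (use \<open>e > 0\<close> in simp)
      then show "dist (y m) (y n) < e" by (simp add: dist_norm)
    qed
  qed
  then obtain p where p: "y \<longlonglongrightarrow> p" using Cauchy_convergent convergent_def by blast
  have pM: "p \<in> M" using closed_sequentially[OF M(2)] y(1) p by blast
  have "(\<lambda>n. (norm (x - y n))\<^sup>2) \<longlonglongrightarrow> (norm (x - p))\<^sup>2" by (intro tendsto_intros p)
  moreover have "(\<lambda>n. d\<^sup>2 + 1 / real (Suc n)) \<longlonglongrightarrow> d\<^sup>2 + 0"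
    by (intro tendsto_add tendsto_const LIMSEQ_Suc[OF lim_1_over_n])
  ultimately have pd: "(norm (x - p))\<^sup>2 \<le> d\<^sup>2"
    using y(2) by (intro LIMSEQ_le[where X="\<lambda>n. (norm (x - y n))\<^sup>2" and Y="\<lambda>n. d\<^sup>2 + 1 / real (Suc n)"])
      (auto intro: less_imp_le)
  \<comment> \<open>Otherwise moving from \<open>p\<close> by \<open>t *\<^sub>R w\<close>, with the \<open>t\<close> that minimises the distance, would come closer to \<open>x\<close>.\<close>
  have "(x - p) \<bullet> w = 0" if w: "w \<in> M" for w
  proof (rule ccontr)
    assume ne0: "(x - p) \<bullet> w \<noteq> 0"
    then have w0: "w \<bullet> w > 0" by auto
    define t where "t = ((x - p) \<bullet> w) / (w \<bullet> w)"
    have "p + t *\<^sub>R w \<in> M" using pM w M(1) by (simp add: subspace_add subspace_scale)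
    from dle[OF this] have "d\<^sup>2 \<le> (norm (x - (p + t *\<^sub>R w)))\<^sup>2" using d0 by (simp add: power_mono)
    also have "\<dots> = (norm ((x - p) - t *\<^sub>R w))\<^sup>2" by (simp add: algebra_simps)
    also have "\<dots> = (norm (x - p))\<^sup>2 - 2 * t * ((x - p) \<bullet> w) + t\<^sup>2 * (w \<bullet> w)"
      unfolding power2_norm_eq_inner
      by (simp add: inner_diff_left inner_diff_right inner_commute power2_eq_square algebra_simps)
    also have "\<dots> = (norm (x - p))\<^sup>2 - ((x - p) \<bullet> w)\<^sup>2 / (w \<bullet> w)"
      using w0 unfolding t_def by (simp add: power2_eq_square field_simps)
    also have "\<dots> < (norm (x - p))\<^sup>2" using w0 ne0 by simp
    finally show False using pd by simp
  qed
  moreover have "x - p \<noteq> 0" using x pM by auto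
  ultimately show ?thesis by blast
qed

text \<open>A vector orthogonal to the kernel of \<open>f\<close> represents \<open>f\<close> after rescaling.\<close>

lemma riesz_representation:
  fixes f :: "'a::{real_inner, complete_space} \<Rightarrow> real"
  assumes "bounded_linear f"
  shows "\<exists>g. \<forall>x. f x = g \<bullet> x"
proof (cases "\<forall>x. f x = 0")
  case True then show ?thesis by (intro exI[of _ 0]) simp
next
  case False
  interpret bounded_linear f by fact
  let ?M = "{x. f x = 0}"
  have "subspace ?M" by (auto simp: subspace_def add scaleR zero)
  moreover have "closed ?M" by (intro closed_Collect_eq continuous_on continuous_intros)
  ultimately obtain z where z: "z \<noteq> 0" "\<And>y. f y = 0 \<Longrightarrow> z \<bullet> y = 0"
    using exists_orthogonal_vector[of ?M] False by auto
  have fz: "f z \<noteq> 0" using z by (metis inner_eq_zero_iff)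
  have "f x = ((f z / (z \<bullet> z)) *\<^sub>R z) \<bullet> x" for x
  proof -
    have "f (x - (f x / f z) *\<^sub>R z) = 0" using fz by (simp add: diff scaleR)
    from z(2)[OF this] have "z \<bullet> x = (f x / f z) * (z \<bullet> z)" by (simp add: inner_diff_right)
    then show ?thesis using fz z(1) by (simp add: field_simps)
  qed
  then show ?thesis by blast
qed

text \<open>The adjoint is defined by choice, so that its defining property needs an existence proof; the Riesz
  theorem provides one for bounded operators on a complete space.\<close>

lemma adjoint_inner:
  fixes f :: "'a::{real_inner, complete_space} \<Rightarrow> 'b::real_inner"
  assumes "bounded_linear f"
  shows "f x \<bullet> y = x \<bullet> adjoint f y"
proof -
  have "\<exists>g. \<forall>x. f x \<bullet> y = g \<bullet> x" for y
    using riesz_representation[OF bounded_linear_compose[OF bounded_linear_inner_left[of y] assms]]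
    by simp
  then obtain f' where "\<And>y x. f x \<bullet> y = f' y \<bullet> x" by metis
  then have "\<forall>x y. f x \<bullet> y = x \<bullet> f' y" by (simp add: inner_commute)
  then have "\<forall>x y. f x \<bullet> y = x \<bullet> adjoint f y" unfolding adjoint_def by (rule someI[where P="\<lambda>f'. \<forall>x y. f x \<bullet> y = x \<bullet> f' y"])
  then show ?thesis by blast
qed

lemma bounded_linear_adjoint:
  fixes f :: "'a::{real_inner, complete_space} \<Rightarrow> 'b::real_inner"
  assumes "bounded_linear f"
  shows "bounded_linear (adjoint f)"
proof -
  interpret bounded_linear f by fact
  obtain K where K: "\<And>x. norm (f x) \<le> norm x * K" "K > 0" using pos_bounded by blast
  note adj = adjoint_inner[OF assms, symmetric]
  show ?thesis
  proof (rule bounded_linear_intro[where K=K])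
    fix x y and r :: real
    show "adjoint f (x + y) = adjoint f x + adjoint f y"
      by (subst vector_eq_ldot[symmetric]) (simp add: adj inner_add_right)
    show "adjoint f (r *\<^sub>R x) = r *\<^sub>R adjoint f x"
      by (subst vector_eq_ldot[symmetric]) (simp add: adj)
    have "(norm (adjoint f x))\<^sup>2 = f (adjoint f x) \<bullet> x"
      by (simp add: power2_norm_eq_inner adj)
    also have "\<dots> \<le> norm (f (adjoint f x)) * norm x" by (rule norm_cauchy_schwarz)
    also have "\<dots> \<le> (norm (adjoint f x) * K) * norm x" by (intro mult_right_mono K) simp
    finally show "norm (adjoint f x) \<le> norm x * K"
      by (cases "adjoint f x = 0") (use K in \<open>auto simp: power2_eq_square mult_ac\<close>)
  qed
qed

text \<open>Zorn's lemma for orthonormal subsets of a prescribed set \<open>X\<close>.  With \<open>X\<close> the whole space this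
  extends orthonormal sets to bases; with \<open>X\<close> the set of common eigenvectors of two operators it
  gives eigenbases.\<close>

lemma maximal_orthonormal_subset:
  fixes X :: "'a::real_inner set"
  assumes "orthonormal S" "S \<subseteq> X"
  obtains B where "orthonormal B" "S \<subseteq> B" "B \<subseteq> X"
    "\<And>x. x \<in> X \<Longrightarrow> norm x = 1 \<Longrightarrow> (\<And>b. b \<in> B \<Longrightarrow> x \<bullet> b = 0) \<Longrightarrow> False"
proof -
  let ?A = "{B. orthonormal B \<and> S \<subseteq> B \<and> B \<subseteq> X}"
  have "\<exists>M\<in>?A. \<forall>X\<in>?A. M \<subseteq> X \<longrightarrow> X = M"
  proof (rule subset_Zorn_nonempty)
    show "?A \<noteq> {}" using assms by auto
    fix \<C> assume C: "\<C> \<noteq> {}" "subset.chain ?A \<C>"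
    then have el: "\<And>B. B \<in> \<C> \<Longrightarrow> orthonormal B \<and> S \<subseteq> B \<and> B \<subseteq> X"
      by (auto simp: subset.chain_def)
    have "pairwise orthogonal (\<Union>\<C>)"
    proof (rule pairwise_chain_Union)
      show "\<And>B. B \<in> \<C> \<Longrightarrow> pairwise orthogonal B" using el by (auto simp: orthonormal_def)
      show "chain\<^sub>\<subseteq> \<C>" using C(2) unfolding chain_subset_def subset.chain_def by blast
    qed
    then have "orthonormal (\<Union>\<C>)" using el by (auto simp: orthonormal_def)
    then show "\<Union>\<C> \<in> ?A" using el C(1) by auto
  qed
  then obtain B where "B \<in> ?A" and max0: "\<forall>B'\<in>?A. B \<subseteq> B' \<longrightarrow> B' = B" by (rule bexE)
  then have B: "orthonormal B" "S \<subseteq> B" "B \<subseteq> X" by simp_all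
  have max: "B' = B" if "orthonormal B'" "S \<subseteq> B'" "B' \<subseteq> X" "B \<subseteq> B'" for B'
    using max0 that by simp
  show thesis
  proof (rule that[OF B])
    fix x assume x: "x \<in> X" "norm x = 1" "\<And>b. b \<in> B \<Longrightarrow> x \<bullet> b = 0"
    have "orthonormal (insert x B)" using B x
      by (auto simp: orthonormal_def pairwise_insert orthogonal_def inner_commute)
    then have "insert x B = B" using B x(1) by (intro max) auto
    then have "x \<in> B" by auto
    then show False using x by (metis inner_eq_zero_iff norm_zero zero_neq_one)
  qed
qed

lemma closure_subspace:
  fixes M :: "'a::real_normed_vector set"
  assumes "subspace M" shows "subspace (closure M)"
proof -
  have "x + y \<in> closure M" if xM: "x \<in> closure M" and yM: "y \<in> closure M" for x y
  proof -
    obtain u where "\<forall>n. u n \<in> M" "u \<longlonglongrightarrow> x" using xM unfolding closure_sequential by auto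
    moreover obtain v where "\<forall>n. v n \<in> M" "v \<longlonglongrightarrow> y" using yM unfolding closure_sequential by auto
    ultimately show ?thesis unfolding closure_sequential
      by (intro exI[of _ "\<lambda>n. u n + v n"]) (auto intro: tendsto_add subspace_add[OF assms])
  qed
  moreover have "c *\<^sub>R x \<in> closure M" if xM: "x \<in> closure M" for x c
  proof -
    obtain u where "\<forall>n. u n \<in> M" "u \<longlonglongrightarrow> x"
      using xM unfolding closure_sequential by blast
    then show ?thesis unfolding closure_sequential
      by (intro exI[of _ "\<lambda>n. c *\<^sub>R u n"]) (auto intro: tendsto_scaleR subspace_scale[OF assms])
  qed
  moreover have "0 \<in> closure M" using subspace_0[OF assms] closure_subset by blast
  ultimately show ?thesis by (auto simp: subspace_def)
qed

lemma extend_orthonormal_basis: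
  fixes S :: "'a::{real_inner, complete_space} set"
  assumes "orthonormal S"
  obtains B where "orthonormal_basis B" "S \<subseteq> B"
proof -
  obtain B where B: "orthonormal B" "S \<subseteq> B"
    "\<And>x. norm x = 1 \<Longrightarrow> (\<And>b. b \<in> B \<Longrightarrow> x \<bullet> b = 0) \<Longrightarrow> False"
    by (rule maximal_orthonormal_subset[OF assms, of UNIV]) auto
  have "closure (span B) = UNIV"
  proof (rule ccontr)
    assume "closure (span B) \<noteq> UNIV"
    then obtain z where z: "z \<noteq> 0" "\<forall>y\<in>closure (span B). z \<bullet> y = 0"
      using exists_orthogonal_vector[of "closure (span B)"] by (auto simp: closure_subspace)
    have "b \<in> B \<Longrightarrow> b \<in> closure (span B)" for b
      using closure_subset span_base by blast
    then show False using z by (intro B(3)[of "(1 / norm z) *\<^sub>R z"]) auto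
  qed
  then show thesis using that B by (simp add: orthonormal_basis_iff)
qed

section \<open>Compact positive semidefinite operators\<close>

lemma positive_semidefiniteD:
  assumes "positive_semidefinite T"
  shows "bounded_linear T" "T x \<bullet> y = x \<bullet> T y" "0 \<le> T x \<bullet> x"
  using assms by (auto simp: positive_semidefinite_def self_adjoint_def)

text \<open>Cauchy--Schwarz for the form \<open>Q x \<bullet> y\<close>.  It is relativised to a subspace \<open>M\<close> because the
  operator \<open>s - T\<close> in the proof of the spectral theorem is nonnegative on an invariant subspace
  only.\<close>

lemma psd_cauchy_schwarz_on:
  fixes Q :: "'a::real_inner \<Rightarrow> 'a"
  assumes Q: "linear Q" and M: "subspace M"
    and sym: "\<And>x y. x \<in> M \<Longrightarrow> y \<in> M \<Longrightarrow> Q x \<bullet> y = x \<bullet> Q y"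
    and nonneg: "\<And>x. x \<in> M \<Longrightarrow> 0 \<le> Q x \<bullet> x" and x: "x \<in> M" and y: "y \<in> M"
  shows "(Q x \<bullet> y)\<^sup>2 \<le> (Q x \<bullet> x) * (Q y \<bullet> y)"
proof -
  have p: "0 \<le> Q x \<bullet> x + 2 * t * (Q x \<bullet> y) + t\<^sup>2 * (Q y \<bullet> y)" for t
  proof -
    have "x + t *\<^sub>R y \<in> M" using x y M by (simp add: subspace_add subspace_scale)
    from nonneg[OF this]
    have "0 \<le> (Q x + t *\<^sub>R Q y) \<bullet> (x + t *\<^sub>R y)"
      using Q by (simp add: linear_add linear_scale)
    also have "\<dots> = Q x \<bullet> x + 2 * t * (Q x \<bullet> y) + t\<^sup>2 * (Q y \<bullet> y)"
      using sym[OF x y] by (simp add: inner_add inner_commute power2_eq_square algebra_simps)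
    finally show ?thesis .
  qed
  show ?thesis
  proof (cases "Q y \<bullet> y = 0")
    case True
    have "Q x \<bullet> y = 0"
    proof (rule ccontr)
      assume ne: "Q x \<bullet> y \<noteq> 0"
      have "Q x \<bullet> x + 2 * (- (Q x \<bullet> x + 1) / (2 * (Q x \<bullet> y))) * (Q x \<bullet> y) = -1"
        using ne by (simp add: field_simps)
      with p[of "- (Q x \<bullet> x + 1) / (2 * (Q x \<bullet> y))"] True show False by simp
    qed
    then show ?thesis using True by simp
  next
    case False
    then have pos: "Q y \<bullet> y > 0" using nonneg[OF y] by simp
    have "Q x \<bullet> x + 2 * (- (Q x \<bullet> y) / (Q y \<bullet> y)) * (Q x \<bullet> y) + (- (Q x \<bullet> y) / (Q y \<bullet> y))\<^sup>2 * (Q y \<bullet> y)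
       = Q x \<bullet> x - (Q x \<bullet> y)\<^sup>2 / (Q y \<bullet> y)"
      using pos by (simp add: power2_eq_square field_simps)
    with p[of "- (Q x \<bullet> y) / (Q y \<bullet> y)"] have "(Q x \<bullet> y)\<^sup>2 / (Q y \<bullet> y) \<le> Q x \<bullet> x" by simp
    then show ?thesis using pos by (simp add: field_simps)
  qed
qed

text \<open>Cauchy--Schwarz with \<open>y = Q x\<close>: where the quadratic form of \<open>Q\<close> is small, \<open>Q\<close> itself is
  small.\<close>

lemma psd_norm_bound_on:
  fixes Q :: "'a::real_inner \<Rightarrow> 'a"
  assumes Q: "linear Q" and M: "subspace M" and inv: "\<And>x. x \<in> M \<Longrightarrow> Q x \<in> M"
    and sym: "\<And>x y. x \<in> M \<Longrightarrow> y \<in> M \<Longrightarrow> Q x \<bullet> y = x \<bullet> Q y"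
    and nonneg: "\<And>x. x \<in> M \<Longrightarrow> 0 \<le> Q x \<bullet> x" and x: "x \<in> M"
    and K: "\<And>x. norm (Q x) \<le> K * norm x"
  shows "(norm (Q x))\<^sup>2 \<le> K * (Q x \<bullet> x)"
proof (cases "Q x = 0")
  case True then show ?thesis by simp
next
  case False
  have "(Q x \<bullet> Q x)\<^sup>2 \<le> (Q x \<bullet> x) * (Q (Q x) \<bullet> Q x)"
    by (rule psd_cauchy_schwarz_on[OF Q M sym nonneg x inv[OF x]])
  also have "Q (Q x) \<bullet> Q x \<le> K * norm (Q x) * norm (Q x)"
    by (rule order_trans[OF norm_cauchy_schwarz]) (intro mult_right_mono K, simp)
  then have "(Q x \<bullet> x) * (Q (Q x) \<bullet> Q x) \<le> (Q x \<bullet> x) * (K * norm (Q x) * norm (Q x))"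
    by (intro mult_left_mono nonneg x)
  finally have "(norm (Q x))\<^sup>2 * (norm (Q x))\<^sup>2 \<le> (K * (Q x \<bullet> x)) * (norm (Q x))\<^sup>2"
    by (simp add: power2_norm_eq_inner[symmetric] power2_eq_square mult_ac)
  then show ?thesis by (rule mult_right_le_imp_le) (use False in simp)
qed

lemma psd_norm_bound:
  assumes "positive_semidefinite T"
  obtains K where "K > 0" "\<And>x. (norm (T x))\<^sup>2 \<le> K * (T x \<bullet> x)" "\<And>x. norm (T x) \<le> K * norm x"
proof -
  note D = positive_semidefiniteD[OF assms]
  obtain K where K: "K > 0" "\<And>x. norm (T x) \<le> norm x * K"
    using bounded_linear.pos_bounded[OF D(1)] by blast
  show thesis
  proof (rule that[OF K(1)])
    show K': "norm (T x) \<le> K * norm x" for x using K(2)[of x] by (simp add: mult.commute)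
    show "(norm (T x))\<^sup>2 \<le> K * (T x \<bullet> x)" for x
      by (rule psd_norm_bound_on[where M=UNIV])
        (use D K' in \<open>auto simp: bounded_linear.linear\<close>)
  qed
qed

lemma psd_kernel:
  assumes "positive_semidefinite T" "T x \<bullet> x = 0"
  shows "T x = 0"
proof -
  obtain K where "K > 0" "\<And>x. (norm (T x))\<^sup>2 \<le> K * (T x \<bullet> x)" using psd_norm_bound[OF assms(1)] by metis
  then have "(norm (T x))\<^sup>2 \<le> 0" using assms(2) by (metis mult_zero_right)
  then show ?thesis by simp
qed

definition compact_operator :: "('a::real_normed_vector \<Rightarrow> 'b::real_normed_vector) \<Rightarrow> bool" where
  "compact_operator T \<longleftrightarrow> (\<exists>K. compact K \<and> T ` cball 0 1 \<subseteq> K)"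

lemma compact_operator_compose:
  assumes T: "compact_operator T" "linear T" and A: "bounded_linear A" and B: "bounded_linear B"
  shows "compact_operator (\<lambda>x. A (T (B x)))"
proof -
  interpret A: bounded_linear A by fact
  interpret B: bounded_linear B by fact
  obtain K where K: "compact K" "T ` cball 0 1 \<subseteq> K" using T by (auto simp: compact_operator_def)
  obtain r where r: "r > 0" "\<And>x. norm (B x) \<le> norm x * r" using B.pos_bounded by blast
  have "compact ((\<lambda>y. r *\<^sub>R A y) ` K)"
    by (intro compact_continuous_image continuous_intros A.continuous_on K)
  moreover have "A (T (B x)) \<in> (\<lambda>y. r *\<^sub>R A y) ` K" if "norm x \<le> 1" for x
  proof (rule image_eqI)
    have "norm x * r \<le> 1 * r" using that r(1) by (intro mult_right_mono) auto
    then have "norm (B x) \<le> r" using r(2)[of x] by linarith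
    then have "(1/r) *\<^sub>R B x \<in> cball 0 1" using r(1) by (simp add: field_simps)
    then show "T ((1/r) *\<^sub>R B x) \<in> K" using K(2) by blast
    show "A (T (B x)) = r *\<^sub>R A (T ((1/r) *\<^sub>R B x))"
      using r(1) by (simp add: linear_scale[OF T(2)] A.scaleR)
  qed
  ultimately show ?thesis unfolding compact_operator_def by (auto simp: image_subset_iff)
qed

text \<open>Orthonormal eigenvectors for \<open>\<mu>\<close> are mapped to points of mutual distance \<open>\<bar>\<mu>\<bar> * sqrt 2\<close>,
  and a compact set contains only finitely many such points.\<close>

lemma compact_operator_finite_eigenspace:
  fixes T :: "'a::real_inner \<Rightarrow> 'a"
  assumes T: "compact_operator T" and A: "orthonormal A" "\<And>a. a \<in> A \<Longrightarrow> T a = \<mu> *\<^sub>R a" and "\<mu> \<noteq> 0"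
  shows "finite A"
proof (rule ccontr)
  assume inf: "infinite A"
  obtain K where K: "compact K" "T ` cball 0 1 \<subseteq> K" using T by (auto simp: compact_operator_def)
  have sub: "(\<lambda>a. \<mu> *\<^sub>R a) ` A \<subseteq> K"
  proof safe
    fix a assume a: "a \<in> A"
    then have "a \<in> cball 0 1" using A(1) by (auto simp: orthonormal_def)
    then show "\<mu> *\<^sub>R a \<in> K" using K(2) A(2)[OF a] by force
  qed
  have "inj_on (\<lambda>a. \<mu> *\<^sub>R a) A" using \<open>\<mu> \<noteq> 0\<close> by (auto simp: inj_on_def)
  then have "infinite ((\<lambda>a. \<mu> *\<^sub>R a) ` A)" using inf finite_imageD by blast
  then obtain l where l: "l islimpt ((\<lambda>a. \<mu> *\<^sub>R a) ` A)"
    using K(1) sub unfolding compact_eq_Bolzano_Weierstrass by blast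
  let ?U = "(\<lambda>a. \<mu> *\<^sub>R a) ` A \<inter> ball l (\<bar>\<mu>\<bar> / 2)"
  have U: "infinite ?U"
    using l \<open>\<mu> \<noteq> 0\<close> unfolding islimpt_eq_infinite_ball by simp
  then obtain u where u: "u \<in> ?U" by (metis ex_in_conv infinite_imp_nonempty)
  have "infinite (?U - {u})" using U by simp
  then obtain v where v: "v \<in> ?U - {u}" by (metis ex_in_conv infinite_imp_nonempty)
  have uv: "u \<in> ?U" "v \<in> ?U" "u \<noteq> v" using u v by blast+
  then obtain a b where ab: "a \<in> A" "b \<in> A" "u = \<mu> *\<^sub>R a" "v = \<mu> *\<^sub>R b" by blast
  have "a \<noteq> b" using ab uv(3) by blast
  have "dist u v < \<bar>\<mu>\<bar>"
    by (rule dist_triangle_half_r[of l]) (use uv in \<open>simp_all add: dist_commute\<close>)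
  moreover have "(dist a b)\<^sup>2 = 2"
    using orthonormal_inner[OF A(1) ab(1) ab(2)] orthonormal_inner[OF A(1) ab(1) ab(1)]
      orthonormal_inner[OF A(1) ab(2) ab(2)] \<open>a \<noteq> b\<close>
    by (simp add: dist_norm power2_norm_eq_inner inner_diff inner_commute)
  then have "dist a b \<ge> 1" 
    by (metis abs_square_less_1 abs_of_nonneg le_less_linear not_less one_le_numeral zero_le_dist)
  then have "\<bar>\<mu>\<bar> \<le> dist u v" using ab \<open>\<mu> \<noteq> 0\<close>
    by (simp add: dist_norm scaleR_diff_right[symmetric] del: scaleR_diff_right)
  ultimately show False by simp
qed

text \<open>Let \<open>s\<close> be the supremum of the Rayleigh quotient of \<open>T\<close> on \<open>M\<close>.  Then \<open>s - T\<close> is positive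
  semidefinite on \<open>M\<close>, so that a maximising sequence \<open>x n\<close> of unit vectors satisfies
  \<open>s *\<^sub>R x n - T (x n) \<longlonglongrightarrow> 0\<close>; compactness makes \<open>T (x n)\<close>, hence \<open>x n\<close>, converge along a
  subsequence, and the limit is an eigenvector.\<close>

lemma compact_psd_eigenvector:
  fixes T :: "'a::{real_inner, complete_space} \<Rightarrow> 'a"
  assumes T: "positive_semidefinite T" "compact_operator T"
    and M: "subspace M" "closed M" "M \<noteq> {0}" and inv: "\<And>x. x \<in> M \<Longrightarrow> T x \<in> M"
  shows "\<exists>x\<in>M. norm x = 1 \<and> (\<exists>s. T x = s *\<^sub>R x)"
proof -
  note D = positive_semidefiniteD[OF T(1)]
  interpret bounded_linear T by (rule D)
  obtain K where K: "K > 0" "\<And>x. norm (T x) \<le> K * norm x" using psd_norm_bound[OF T(1)] by metis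
  obtain z where z: "z \<in> M" "z \<noteq> 0" using M subspace_0 by blast
  let ?S = "{x \<in> M. norm x = 1}"
  have zS: "(1 / norm z) *\<^sub>R z \<in> ?S" using z M(1) by (simp add: subspace_scale)
  define s where "s = (SUP x\<in>?S. T x \<bullet> x)"
  have "T x \<bullet> x \<le> K" if "norm x = 1" for x
    using norm_cauchy_schwarz[of "T x" x] K(2)[of x] that by simp
  then have bdd: "bdd_above ((\<lambda>x. T x \<bullet> x) ` ?S)" by (auto intro!: bdd_aboveI2)
  have le_s: "T x \<bullet> x \<le> s" if "x \<in> ?S" for x
    unfolding s_def by (rule cSUP_upper[OF that bdd])
  have s0: "s \<ge> 0" using le_s[OF zS] D(3) order_trans by blast
  show ?thesis
  proof (cases "s = 0")
    case True
    have "T ((1 / norm z) *\<^sub>R z) = 0"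
      by (rule psd_kernel[OF T(1)]) (use le_s[OF zS] D(3)[of "(1 / norm z) *\<^sub>R z"] True in linarith)
    then show ?thesis using zS
      by (intro bexI[of _ "(1 / norm z) *\<^sub>R z"] conjI exI[of _ 0]) simp_all
  next
    case False
    then have s: "s > 0" using s0 by simp
    let ?Q = "\<lambda>x. s *\<^sub>R x - T x"
    have Qlin: "linear ?Q"
      by (rule linearI) (simp_all add: add scaleR algebra_simps)
    have Qnn: "0 \<le> ?Q x \<bullet> x" if "x \<in> M" for x
    proof (cases "x = 0")
      case True then show ?thesis by simp
    next
      case False
      have "(1 / norm x) *\<^sub>R x \<in> ?S" using that False M(1) by (simp add: subspace_scale)
      from le_s[OF this] have "(T x \<bullet> x) / (norm x * norm x) \<le> s" by (simp add: scaleR)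
      then have "T x \<bullet> x \<le> s * (x \<bullet> x)"
        using False by (simp add: field_simps norm_eq_sqrt_inner)
      then show ?thesis by (simp add: inner_diff_left)
    qed
    have Qb: "norm (?Q x) \<le> (s + K) * norm x" for x
      using norm_triangle_ineq4[of "s *\<^sub>R x" "T x"] K(2)[of x] s by (simp add: algebra_simps)
    have Qbound: "(norm (?Q x))\<^sup>2 \<le> (s + K) * (?Q x \<bullet> x)" if "x \<in> M" for x
      by (rule psd_norm_bound_on[OF Qlin M(1) _ _ Qnn that Qb])
         (use inv M(1) D(2) in \<open>auto simp: subspace_diff subspace_scale inner_diff\<close>)
    have "\<exists>x\<in>?S. s - 1 / real (Suc n) < T x \<bullet> x" for n
    proof -
      have "s - 1 / real (Suc n) < s" by simp
      then show ?thesis unfolding s_def using less_cSUP_iff[OF _ bdd] zS by blast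
    qed
    then obtain x where x: "\<And>n. x n \<in> ?S" "\<And>n. s - 1 / real (Suc n) < T (x n) \<bullet> x n" by metis
    have Qx: "(norm (?Q (x n)))\<^sup>2 \<le> (s + K) * (1 / real (Suc n))" for n
    proof -
      have "?Q (x n) \<bullet> x n = s - T (x n) \<bullet> x n"
        using x(1)[of n] by (simp add: inner_diff_left norm_eq_1)
      then have "?Q (x n) \<bullet> x n \<le> 1 / real (Suc n)" using x(2)[of n] by linarith
      then have "(s + K) * (?Q (x n) \<bullet> x n) \<le> (s + K) * (1 / real (Suc n))"
        using s K by (intro mult_left_mono) auto
      then show ?thesis using Qbound[of "x n"] x(1)[of n] by simp
    qed
    have "(\<lambda>n. (s + K) * (1 / real (Suc n))) \<longlonglongrightarrow> (s + K) * 0"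
      by (intro tendsto_mult tendsto_const LIMSEQ_Suc[OF lim_1_over_n])
    then have "(\<lambda>n. (s + K) * (1 / real (Suc n))) \<longlonglongrightarrow> 0" by simp
    then have "(\<lambda>n. (norm (?Q (x n)))\<^sup>2) \<longlonglongrightarrow> 0"
      by (rule Lim_null_comparison[rotated]) (use Qx in \<open>auto intro!: always_eventually\<close>)
    then have "(\<lambda>n. sqrt ((norm (?Q (x n)))\<^sup>2)) \<longlonglongrightarrow> sqrt 0" by (rule tendsto_real_sqrt)
    then have Q0: "(\<lambda>n. ?Q (x n)) \<longlonglongrightarrow> 0" by (simp add: tendsto_norm_zero_iff)
    obtain KK where KK: "compact KK" "T ` cball 0 1 \<subseteq> KK" using T(2) by (auto simp: compact_operator_def)
    have "\<forall>n. T (x n) \<in> KK"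
    proof
      fix n
      have "x n \<in> cball 0 1" using x(1)[of n] by simp
      then show "T (x n) \<in> KK" using KK(2) by blast
    qed
    then obtain l r where r: "strict_mono (r :: nat \<Rightarrow> nat)" "((\<lambda>n. T (x n)) \<circ> r) \<longlonglongrightarrow> l"
      using KK(1) unfolding compact_def by meson
    have "(\<lambda>n. ?Q (x (r n)) + T (x (r n))) \<longlonglongrightarrow> 0 + l"
      by (intro tendsto_add) (use LIMSEQ_subseq_LIMSEQ[OF Q0 r(1)] r(2) in \<open>simp_all add: o_def\<close>)
    then have "(\<lambda>n. (1/s) *\<^sub>R (s *\<^sub>R x (r n))) \<longlonglongrightarrow> (1/s) *\<^sub>R l"
      by (intro tendsto_scaleR tendsto_const) simp
    then have xl: "(\<lambda>n. x (r n)) \<longlonglongrightarrow> (1/s) *\<^sub>R l" using s by simp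
    have lM: "(1/s) *\<^sub>R l \<in> M" by (rule closed_sequentially[OF M(2) _ xl]) (use x(1) in auto)
    have "(\<lambda>n. norm (x (r n))) \<longlonglongrightarrow> norm ((1/s) *\<^sub>R l)" by (intro tendsto_norm xl)
    moreover have "(\<lambda>n. norm (x (r n))) \<longlonglongrightarrow> 1" using x(1) by simp
    ultimately have n1: "norm ((1/s) *\<^sub>R l) = 1" by (rule LIMSEQ_unique)
    have "(\<lambda>n. T (x (r n))) \<longlonglongrightarrow> T ((1/s) *\<^sub>R l)" by (rule tendsto[OF xl])
    then have "T ((1/s) *\<^sub>R l) = l" using r(2) LIMSEQ_unique unfolding o_def by blast
    then have "T ((1/s) *\<^sub>R l) = s *\<^sub>R ((1/s) *\<^sub>R l)" using s by simp
    then show ?thesis using lM n1 by blast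
  qed
qed

text \<open>The spectral theorem for two commuting operators.  A maximal orthonormal set of common eigenvectors
  has an orthogonal complement that is invariant under both operators.  If it were nontrivial, it
  would contain an eigenvector of \<open>C\<close>; the corresponding eigenspace of \<open>C\<close> inside the complement
  is invariant under \<open>W\<close>, hence contains a common eigenvector, against maximality.\<close>

theorem commuting_compact_psd_eigenbasis:
  fixes C W :: "'a::{real_inner, complete_space} \<Rightarrow> 'a"
  assumes C: "positive_semidefinite C" "compact_operator C"
    and W: "positive_semidefinite W" "compact_operator W"
    and comm: "\<And>x. C (W x) = W (C x)"
  obtains B where "orthonormal_basis B"
    "\<And>b. b \<in> B \<Longrightarrow> C b = (C b \<bullet> b) *\<^sub>R b" "\<And>b. b \<in> B \<Longrightarrow> W b = (W b \<bullet> b) *\<^sub>R b"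
proof -
  note DC = positive_semidefiniteD[OF C(1)] and DW = positive_semidefiniteD[OF W(1)]
  interpret C: bounded_linear C by (rule DC)
  interpret W: bounded_linear W by (rule DW)
  let ?X = "{x. (\<exists>\<mu>. C x = \<mu> *\<^sub>R x) \<and> (\<exists>\<nu>. W x = \<nu> *\<^sub>R x)}"
  have "orthonormal ({}::'a set)" by (simp add: orthonormal_def)
  then obtain B where B: "orthonormal B" "B \<subseteq> ?X"
    and max: "\<And>x. x \<in> ?X \<Longrightarrow> norm x = 1 \<Longrightarrow> (\<And>b. b \<in> B \<Longrightarrow> x \<bullet> b = 0) \<Longrightarrow> False"
    by (rule maximal_orthonormal_subset[of "{}" ?X]) auto
  have "closure (span B) = UNIV"
  proof (rule ccontr)
    assume "closure (span B) \<noteq> UNIV"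
    then obtain z where z: "z \<noteq> 0" "\<forall>y\<in>closure (span B). z \<bullet> y = 0"
      using exists_orthogonal_vector[of "closure (span B)"] by (auto simp: closure_subspace)
    define M where "M = {x. \<forall>b\<in>B. x \<bullet> b = 0}"
    have M: "subspace M" by (auto simp: M_def subspace_def inner_add_left)
    have "M = (\<Inter>b\<in>B. {x. x \<bullet> b = 0})" by (auto simp: M_def)
    then have Mc: "closed M" by (auto intro!: closed_INT closed_Collect_eq continuous_intros)
    have zM: "z \<in> M" using z(2) closure_subset span_base by (fastforce simp: M_def)
    have CM: "C x \<in> M" if "x \<in> M" for x
    proof -
      have "C x \<bullet> b = 0" if b: "b \<in> B" for b
      proof -
        obtain \<mu> where "C b = \<mu> *\<^sub>R b" using B(2) b by auto
        then show ?thesis using DC(2)[of x b] \<open>x \<in> M\<close> b by (simp add: M_def)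
      qed
      then show ?thesis by (simp add: M_def)
    qed
    have WM: "W x \<in> M" if "x \<in> M" for x
    proof -
      have "W x \<bullet> b = 0" if b: "b \<in> B" for b
      proof -
        obtain \<mu> where "W b = \<mu> *\<^sub>R b" using B(2) b by auto
        then show ?thesis using DW(2)[of x b] \<open>x \<in> M\<close> b by (simp add: M_def)
      qed
      then show ?thesis by (simp add: M_def)
    qed
    have Mne: "M \<noteq> {0}" using z zM by auto
    obtain x s where x: "x \<in> M" "norm x = 1" "C x = s *\<^sub>R x"
      using compact_psd_eigenvector[OF C M Mc Mne CM] by blast
    define E where "E = {y \<in> M. C y = s *\<^sub>R y}"
    have E: "subspace E" using M by (auto simp: E_def subspace_def C.add C.scaleR algebra_simps)
    have "E = M \<inter> {y. C y = s *\<^sub>R y}" by (auto simp: E_def)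
    moreover have "closed {y. C y = s *\<^sub>R y}"
      by (intro closed_Collect_eq C.continuous_on continuous_intros)
    ultimately have Ec: "closed E" using Mc by (simp only: closed_Int)
    have "x \<in> E" using x by (simp add: E_def)
    moreover have "x \<noteq> 0" using x(2) by auto
    ultimately have Ene: "E \<noteq> {0}" by blast
    have WE: "W y \<in> E" if "y \<in> E" for y
      using that WM by (auto simp: E_def comm W.scaleR)
    obtain y t where "y \<in> E" "norm y = 1" "W y = t *\<^sub>R y"
      using compact_psd_eigenvector[OF W E Ec Ene WE] by blast
    then show False using max[of y] by (auto simp: E_def M_def)
  qed
  then have "orthonormal_basis B" using B(1) by (simp add: orthonormal_basis_iff)
  moreover have "C b = (C b \<bullet> b) *\<^sub>R b" "W b = (W b \<bullet> b) *\<^sub>R b" if b: "b \<in> B" for b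
  proof -
    have "b \<in> ?X" using B(2) b by (rule subsetD)
    then obtain \<mu> \<nu> where *: "C b = \<mu> *\<^sub>R b" "W b = \<nu> *\<^sub>R b" by auto
    moreover have "b \<bullet> b = 1" using B(1) b orthonormal_inner by fastforce
    ultimately show "C b = (C b \<bullet> b) *\<^sub>R b" "W b = (W b \<bullet> b) *\<^sub>R b" by simp_all
  qed
  ultimately show thesis using that by blast
qed

section \<open>Trace class operators and their square roots\<close>

text \<open>The trace is a sum of nonnegative terms over any orthonormal basis, in particular over one that
  extends \<open>S\<close>.\<close>

lemma trace_bounds_orthonormal:
  fixes T :: "'a::{real_inner, complete_space} \<Rightarrow> 'a"
  assumes "positive_semidefinite T" "has_trace T t" "orthonormal S" "finite S"
  shows "(\<Sum>b\<in>S. T b \<bullet> b) \<le> t"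
proof -
  obtain B where B: "orthonormal_basis B" "S \<subseteq> B" using extend_orthonormal_basis[OF assms(3)] by metis
  then have "((\<lambda>b. T b \<bullet> b) has_sum t) B" using assms(2) by (auto simp: has_trace_def)
  then show ?thesis
    by (rule finite_sum_le_has_sum) (use assms B positive_semidefiniteD[OF assms(1)] in auto)
qed

lemma compact_set_of_combinations:
  fixes u :: "'i \<Rightarrow> 'a::real_normed_vector"
  assumes "finite I"
  shows "\<exists>K. compact K \<and> (\<forall>c. (\<forall>i\<in>I. \<bar>c i\<bar> \<le> r) \<longrightarrow> (\<Sum>i\<in>I. c i *\<^sub>R u i) \<in> K)"
  using assms
proof (induction I)
  case empty
  then show ?case by (intro exI[of _ "{0}"]) auto
next
  case (insert a I)
  then obtain K where K: "compact K" "\<And>c. (\<forall>i\<in>I. \<bar>c i\<bar> \<le> r) \<Longrightarrow> (\<Sum>i\<in>I. c i *\<^sub>R u i) \<in> K" by blast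
  let ?K = "{x + y | x y. x \<in> (\<lambda>t. t *\<^sub>R u a) ` {-r..r} \<and> y \<in> K}"
  have "compact ?K"
    by (intro compact_sums K compact_continuous_image continuous_intros) auto
  moreover have "(\<Sum>i\<in>insert a I. c i *\<^sub>R u i) \<in> ?K" if c: "\<forall>i\<in>insert a I. \<bar>c i\<bar> \<le> r" for c
  proof -
    have "c a *\<^sub>R u a \<in> (\<lambda>t. t *\<^sub>R u a) ` {-r..r}" using c by (intro imageI) (auto simp: abs_le_iff)
    moreover have "(\<Sum>i\<in>I. c i *\<^sub>R u i) \<in> K" using c by (intro K) auto
    ultimately show ?thesis unfolding sum.insert[OF insert.hyps] by blast
  qed
  ultimately show ?case by blast
qed

text \<open>Finitely many orthonormal vectors \<open>S\<close> use up the trace except for an arbitrarily small rest, so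
  that the quadratic form of \<open>T\<close>, and therefore \<open>T\<close>, is small on the unit vectors orthogonal to
  \<open>S\<close>.  Up to a small error the image of the unit ball is thus the image of a compact subset of the
  span of \<open>S\<close>, that is, it is totally bounded.\<close>

theorem psd_trace_class_compact:
  fixes T :: "'a::{real_inner, complete_space} \<Rightarrow> 'a"
  assumes T: "positive_semidefinite T" and t: "has_trace T t"
  shows "compact_operator T"
proof -
  note D = positive_semidefiniteD[OF T]
  interpret bounded_linear T by (rule D)
  obtain K where K: "K > 0" "\<And>x. (norm (T x))\<^sup>2 \<le> K * (T x \<bullet> x)" using psd_norm_bound[OF T] by metis
  have "orthonormal ({} :: 'a set)" by (simp add: orthonormal_def)
  then obtain B :: "'a set" where B: "orthonormal_basis B" by (rule extend_orthonormal_basis)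
  have sB: "((\<lambda>b. T b \<bullet> b) has_sum t) B" using t B by (auto simp: has_trace_def)
  let ?A = "T ` cball 0 1"
  have tb: "\<exists>k. finite k \<and> closure ?A \<subseteq> (\<Union>x\<in>k. ball x e)" if e: "e > 0" for e
  proof -
    define \<epsilon> where "\<epsilon> = (e/4)\<^sup>2 / K"
    have "\<epsilon> > 0" using e K by (simp add: \<epsilon>_def)
    then have "\<forall>\<^sub>F F in finite_subsets_at_top B. dist (\<Sum>b\<in>F. T b \<bullet> b) t < \<epsilon>"
      using sB unfolding has_sum_def tendsto_iff by blast
    then obtain S where S: "finite S" "S \<subseteq> B" "dist (\<Sum>b\<in>S. T b \<bullet> b) t < \<epsilon>"
      unfolding eventually_finite_subsets_at_top by blast
    have oS: "orthonormal S" using B S orthonormal_subset by (auto simp: orthonormal_basis_iff)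
    have small1: "T x \<bullet> x \<le> \<epsilon>" if x: "norm x = 1" "\<And>b. b \<in> S \<Longrightarrow> x \<bullet> b = 0" for x
    proof -
      have "x \<notin> S" using x by (metis inner_eq_zero_iff norm_zero zero_neq_one)
      moreover have "orthonormal (insert x S)" using oS x
        by (auto simp: orthonormal_def pairwise_insert orthogonal_def inner_commute)
      ultimately have "T x \<bullet> x + (\<Sum>b\<in>S. T b \<bullet> b) \<le> t"
        using trace_bounds_orthonormal[OF T t, of "insert x S"] S(1) by simp
      then show ?thesis using S(3) by (simp add: dist_real_def abs_less_iff)
    qed
    have small: "norm (T x) \<le> e/4" if x: "norm x \<le> 1" "\<And>b. b \<in> S \<Longrightarrow> x \<bullet> b = 0" for x
    proof (cases "x = 0")
      case True then show ?thesis using e by (simp add: zero)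
    next
      case False
      have "T ((1 / norm x) *\<^sub>R x) \<bullet> ((1 / norm x) *\<^sub>R x) \<le> \<epsilon>"
        by (rule small1) (use x False in auto)
      then have "T x \<bullet> x \<le> \<epsilon> * (norm x)\<^sup>2"
        using False by (simp add: scaleR field_simps power2_eq_square)
      also have "\<dots> \<le> \<epsilon> * 1"
        using x(1) \<open>\<epsilon> > 0\<close> by (intro mult_left_mono) (auto simp: power_le_one)
      finally have "K * (T x \<bullet> x) \<le> K * \<epsilon>" using K(1) by simp
      also have "\<dots> = (e/4)\<^sup>2" using K(1) by (simp add: \<epsilon>_def)
      finally have "(norm (T x))\<^sup>2 \<le> (e/4)\<^sup>2" using K(2)[of x] by linarith
      then show ?thesis by (rule power2_le_imp_le) (use e in simp)
    qed
    obtain KK where KK: "compact KK" "\<And>c. (\<forall>b\<in>S. \<bar>c b\<bar> \<le> 1) \<Longrightarrow> (\<Sum>b\<in>S. c b *\<^sub>R b) \<in> KK"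
      using compact_set_of_combinations[OF S(1), of 1 "\<lambda>b. b"] by blast
    have "compact (T ` KK)" by (intro compact_continuous_image continuous_on KK continuous_on_id)
    then obtain k where k: "finite k" "T ` KK \<subseteq> (\<Union>x\<in>k. ball x (e/4))"
      unfolding compact_eq_totally_bounded using e by (meson divide_pos_pos zero_less_numeral)
    have "closure ?A \<subseteq> (\<Union>x\<in>k. ball x e)"
    proof
      fix z assume "z \<in> closure ?A"
      then obtain x where x: "norm x \<le> 1" "dist (T x) z < e/4"
        unfolding closure_approachable using e
        by (metis (no_types, lifting) divide_pos_pos image_iff mem_cball_0 zero_less_numeral)
      let ?p = "\<Sum>b\<in>S. (x \<bullet> b) *\<^sub>R b"
      have "\<bar>x \<bullet> b\<bar> \<le> 1" if "b \<in> S" for b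
        using Cauchy_Schwarz_ineq2[of x b] oS that x(1) by (auto simp: orthonormal_def)
      then have "T ?p \<in> T ` KK" by (intro imageI KK(2)) simp
      then obtain y where y: "y \<in> k" "dist y (T ?p) < e/4" using k(2) by (auto simp: mem_ball)
      have "norm (T (x - ?p)) \<le> e/4"
      proof (rule small)
        have "(norm (x - ?p))\<^sup>2 \<le> (norm x)\<^sup>2"
          unfolding orthonormal_residual[OF oS S(1)] by (simp add: sum_nonneg)
        then have "norm (x - ?p) \<le> norm x" by (rule power2_le_imp_le) simp
        then show "norm (x - ?p) \<le> 1" using x(1) by simp
        show "(x - ?p) \<bullet> b = 0" if "b \<in> S" for b
          by (rule residual_orthogonal_span[OF oS S(1) span_base[OF that]])
      qed
      then have "dist (T ?p) (T x) \<le> e/4" by (simp add: dist_norm diff norm_minus_commute)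
      then have "dist y z < e"
        using y(2) x(2) dist_triangle[of y "T x" "T ?p"] dist_triangle[of y z "T x"] e by linarith
      then show "z \<in> (\<Union>x\<in>k. ball x e)" using y(1) by (auto simp: mem_ball)
    qed
    then show ?thesis using k(1) by blast
  qed
  have "compact (closure ?A)"
    unfolding compact_eq_totally_bounded using tb by (simp add: complete_eq_closed)
  then show ?thesis unfolding compact_operator_def
    by (intro exI[of _ "closure ?A"] conjI closure_subset)
qed

lemma eigenbasis_action:
  assumes "orthonormal_basis B" "positive_semidefinite T" "\<And>b. b \<in> B \<Longrightarrow> T b = g b *\<^sub>R b"
  shows "((\<lambda>b. g b * (x \<bullet> b) * (y \<bullet> b)) has_sum (T x \<bullet> y)) B"
proof -
  have "(T x \<bullet> b) * (y \<bullet> b) = g b * (x \<bullet> b) * (y \<bullet> b)" if "b \<in> B" for b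
    using positive_semidefiniteD(2)[OF assms(2), of x b] assms(3)[OF that] by simp
  then show ?thesis
    using orthonormal_basis_inner[OF assms(1), of "T x" y] by (rule has_sum_cong[THEN iffD1])
qed

text \<open>The square root acts on the eigenbasis by the square roots of the eigenvalues.  Boundedness of
  \<open>T\<close> bounds the eigenvalues, which makes the defining series converge.\<close>

lemma psd_sqrt_exists:
  fixes T :: "'a::{real_inner, complete_space} \<Rightarrow> 'a"
  assumes T: "positive_semidefinite T" and B: "orthonormal_basis B"
    and eig: "\<And>b. b \<in> B \<Longrightarrow> T b = g b *\<^sub>R b"
  shows "\<exists>R. positive_semidefinite R \<and> R \<circ> R = T"
proof -
  note D = positive_semidefiniteD[OF T]
  obtain K where K: "K > 0" "\<And>x. norm (T x) \<le> K * norm x" using psd_norm_bound[OF T] by metis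
  have nB: "b \<bullet> b = 1" "norm b = 1" if "b \<in> B" for b
    using B that by (auto simp: orthonormal_basis_def norm_eq_1)
  have g: "0 \<le> g b" "g b \<le> K" if "b \<in> B" for b
    using D(3)[of b] K(2)[of b] eig[OF that] nB[OF that] by auto
  have sm: "(\<lambda>b. (sqrt (g b) * (x \<bullet> b))\<^sup>2) summable_on B" for x
  proof (rule summable_on_comparison_test)
    show "(\<lambda>b. K * (x \<bullet> b)\<^sup>2) summable_on B"
      using orthonormal_basis_Parseval[OF B] has_sum_imp_summable summable_on_cmult_right by blast
    show "(sqrt (g b) * (x \<bullet> b))\<^sup>2 \<le> K * (x \<bullet> b)\<^sup>2" if "b \<in> B" for b
      using g[OF that] by (auto simp: power_mult_distrib intro: mult_right_mono)
  qed simp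
  define R where "R x = (\<Sum>\<^sub>\<infinity>b\<in>B. (sqrt (g b) * (x \<bullet> b)) *\<^sub>R b)" for x
  have R: "((\<lambda>b. (sqrt (g b) * (x \<bullet> b)) *\<^sub>R b) has_sum R x) B" for x
    unfolding R_def using orthonormal_series_summable[OF _ sm] B
    by (intro has_sum_infsum) (auto simp: orthonormal_basis_iff)
  have Rin: "((\<lambda>b. sqrt (g b) * (x \<bullet> b) * (y \<bullet> b)) has_sum (R x \<bullet> y)) B" for x y
    using has_sum_bounded_linear[OF bounded_linear_inner_left[of y] R[of x]]
    by (simp add: inner_commute)
  have Rb: "R x \<bullet> b = sqrt (g b) * (x \<bullet> b)" if "b \<in> B" for x b
  proof -
    have "((\<lambda>c. sqrt (g c) * (x \<bullet> c) * (b \<bullet> c)) has_sum (\<Sum>c\<in>{b}. sqrt (g c) * (x \<bullet> c) * (b \<bullet> c))) B"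
    proof (rule has_sum_finite_neutralI)
      show "sqrt (g c) * (x \<bullet> c) * (b \<bullet> c) = 0" if "c \<in> B - {b}" for c
        using orthonormal_inner[of B b c] B that \<open>b \<in> B\<close> by (auto simp: orthonormal_basis_iff)
    qed (use that in auto)
    then show ?thesis using has_sum_unique[OF Rin[of x b]] nB[OF that] by simp
  qed
  have sym: "R x \<bullet> y = x \<bullet> R y" for x y
  proof -
    have "((\<lambda>b. sqrt (g b) * (x \<bullet> b) * (y \<bullet> b)) has_sum (R y \<bullet> x)) B"
      using Rin[of y x] by (simp add: mult_ac)
    then show ?thesis using has_sum_unique[OF Rin[of x y]] by (simp add: inner_commute)
  qed
  have "bounded_linear R"
  proof (rule bounded_linear_intro[where K="sqrt K"])
    fix x y and r :: real
    show "R (x + y) = R x + R y"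
      by (subst vector_eq_rdot[symmetric]) (simp add: inner_add_left sym)
    show "R (r *\<^sub>R x) = r *\<^sub>R R x"
      by (subst vector_eq_rdot[symmetric]) (simp add: sym)
    have "((\<lambda>b. (R x \<bullet> b)\<^sup>2) has_sum (norm (R x))\<^sup>2) B" by (rule orthonormal_basis_Parseval[OF B])
    moreover have "((\<lambda>b. K * (x \<bullet> b)\<^sup>2) has_sum (K * (norm x)\<^sup>2)) B"
      by (intro has_sum_cmult_right orthonormal_basis_Parseval[OF B])
    ultimately have "(norm (R x))\<^sup>2 \<le> K * (norm x)\<^sup>2"
      by (rule has_sum_mono) (use g in \<open>auto simp: Rb power_mult_distrib intro: mult_right_mono\<close>)
    also have "\<dots> = (norm x * sqrt K)\<^sup>2" using K(1) by (simp add: power_mult_distrib)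
    finally show "norm (R x) \<le> norm x * sqrt K" by (rule power2_le_imp_le) (use K(1) in simp)
  qed
  moreover have "0 \<le> R x \<bullet> x" for x
    by (rule has_sum_nonneg[OF Rin]) (use g in \<open>simp add: mult.assoc\<close>)
  moreover have "R (R x) = T x" for x
  proof (subst vector_eq_rdot[symmetric], rule allI)
    fix y
    have "((\<lambda>b. sqrt (g b) * (R x \<bullet> b) * (y \<bullet> b)) has_sum (R (R x) \<bullet> y)) B" by (rule Rin)
    moreover have "sqrt (g b) * (R x \<bullet> b) * (y \<bullet> b) = g b * (x \<bullet> b) * (y \<bullet> b)" if "b \<in> B" for b
      using g(1)[OF that] by (simp add: Rb[OF that] mult.assoc[symmetric])
    then have "((\<lambda>b. sqrt (g b) * (R x \<bullet> b) * (y \<bullet> b)) has_sum (T x \<bullet> y)) B"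
      using eigenbasis_action[OF B T eig, of x y] by (rule has_sum_cong[THEN iffD2])
    ultimately show "R (R x) \<bullet> y = T x \<bullet> y" using has_sum_unique by blast
  qed
  ultimately show ?thesis using sym
    by (auto simp: positive_semidefinite_def self_adjoint_def fun_eq_iff)
qed

text \<open>If \<open>R\<^sup>2 b = g b\<close>, then \<open>y = R b - sqrt g b\<close> satisfies \<open>R y = - sqrt g y\<close>, which is compatible
  with \<open>R\<close> being nonnegative only for \<open>y = 0\<close>.  This determines any square root of an operator
  on an eigenbasis with positive eigenvalues.\<close>

lemma psd_sqrt_eigenvector:
  assumes R: "positive_semidefinite R" and eig: "R (R b) = g *\<^sub>R b" and "g > 0"
  shows "R b = sqrt g *\<^sub>R b"
proof -
  note D = positive_semidefiniteD[OF R]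
  interpret bounded_linear R by (rule D)
  define y where "y = R b - sqrt g *\<^sub>R b"
  have "g *\<^sub>R b = sqrt g *\<^sub>R sqrt g *\<^sub>R b" using \<open>g > 0\<close> by simp
  then have "R y = - (sqrt g *\<^sub>R y)"
    by (simp add: y_def diff scaleR eig scaleR_diff_right)
  then have "sqrt g * (y \<bullet> y) \<le> 0" using D(3)[of y] by simp
  then have "y \<bullet> y \<le> 0" using \<open>g > 0\<close> by (simp add: mult_le_0_iff)
  then have "y = 0" using inner_gt_zero_iff[of y] by linarith
  then show ?thesis by (simp add: y_def)
qed

text \<open>The square root is defined by a definite description, so that both existence and uniqueness are
  needed before anything can be said about it.\<close>

theorem op_sqrt_trace_class:
  fixes T :: "'a::{real_inner, complete_space} \<Rightarrow> 'a"
  assumes T: "positive_definite T" and t: "has_trace T t"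
  shows "positive_semidefinite (op_sqrt T)" "op_sqrt T \<circ> op_sqrt T = T"
proof -
  have psd: "positive_semidefinite T"
    using T unfolding positive_definite_def positive_semidefinite_def
    by (metis inner_zero_right less_eq_real_def)
  have comp: "compact_operator T" by (rule psd_trace_class_compact[OF psd t])
  obtain B where B: "orthonormal_basis B" "\<And>b. b \<in> B \<Longrightarrow> T b = (T b \<bullet> b) *\<^sub>R b"
    using commuting_compact_psd_eigenbasis[OF psd comp psd comp] by metis
  have nB: "b \<noteq> 0" if "b \<in> B" for b using B(1) that by (auto simp: orthonormal_basis_def)
  obtain R where R: "positive_semidefinite R" "R \<circ> R = T"
    using psd_sqrt_exists[OF psd B] by metis
  have onB: "Q b = sqrt (T b \<bullet> b) *\<^sub>R b" if "positive_semidefinite Q" "Q \<circ> Q = T" "b \<in> B" for Q b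
  proof (rule psd_sqrt_eigenvector)
    show "Q (Q b) = (T b \<bullet> b) *\<^sub>R b" using that B(2)[OF that(3)] by (metis comp_apply)
    show "T b \<bullet> b > 0" using T nB[OF that(3)] by (auto simp: positive_definite_def)
  qed (fact that)
  have "op_sqrt T = R" unfolding op_sqrt_def
  proof (rule the_equality)
    fix Q assume Q: "positive_semidefinite Q \<and> Q \<circ> Q = T"
    have "Q b = R b" if "b \<in> B" for b
      using onB[of Q b] onB[of R b] Q R that by metis
    then show "Q = R"
      using Q R(1) B(1) by (intro closure_span_eqI[of _ _ B] positive_semidefiniteD(1))
        (auto simp: orthonormal_basis_def)
  qed (use R in blast)
  then show "positive_semidefinite (op_sqrt T)" "op_sqrt T \<circ> op_sqrt T = T" using R by auto
qed

section \<open>Posterior covariance operators\<close>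

text \<open>For measurement vectors \<open>g j\<close> and noise variance \<open>v\<close> this is \<open>O\<^sup>* O / v\<close>, the information
  that the measurements in \<open>J\<close> add to the precision of the prior.\<close>

definition information :: "real \<Rightarrow> ('m \<Rightarrow> 'a::real_inner) \<Rightarrow> 'm set \<Rightarrow> 'a \<Rightarrow> 'a" where
  "information v g J x = (1/v) *\<^sub>R (\<Sum>j\<in>J. (g j \<bullet> x) *\<^sub>R g j)"

text \<open>This says \<open>S = inverse (inverse C + W)\<close> in a form without unbounded
  operators: the two equations are \<open>S (I + W C) = C\<close> and \<open>(I + C W) S = C\<close>.\<close>

definition posterior_covariance :: "('a::real_inner \<Rightarrow> 'a) \<Rightarrow> ('a \<Rightarrow> 'a) \<Rightarrow> ('a \<Rightarrow> 'a) \<Rightarrow> bool" where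
  "posterior_covariance C W S \<longleftrightarrow> positive_semidefinite S \<and>
     (\<forall>x. S x + S (W (C x)) = C x) \<and> (\<forall>x. S x + C (W (S x)) = C x)"

lemma information_inner_self:
  "information v g J x \<bullet> x = (1/v) * (\<Sum>j\<in>J. (g j \<bullet> x)\<^sup>2)"
  by (simp add: information_def inner_sum_left power2_eq_square)

lemma information_psd:
  assumes "v > 0"
  shows "positive_semidefinite (information v g J)"
proof -
  have "bounded_linear (information v g J)" unfolding information_def
    by (intro bounded_linear_const_scaleR bounded_linear_sum bounded_linear_scaleR_const bounded_linear_inner_right)
  moreover have "information v g J x \<bullet> y = x \<bullet> information v g J y" for x y
    by (simp add: information_def inner_sum_left inner_sum_right inner_commute mult_ac)
  moreover have "0 \<le> information v g J x \<bullet> x" for x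
    unfolding information_inner_self using assms by (intro mult_nonneg_nonneg sum_nonneg) auto
  ultimately show ?thesis by (auto simp: positive_semidefinite_def self_adjoint_def)
qed

lemma information_compact:
  assumes "finite J"
  shows "compact_operator (information v g J)"
proof -
  obtain K where K: "compact K"
    "\<forall>c. (\<forall>j\<in>J. \<bar>c j\<bar> \<le> (\<Sum>i\<in>J. norm (g i))) \<longrightarrow> (\<Sum>j\<in>J. c j *\<^sub>R ((1/v) *\<^sub>R g j)) \<in> K"
    using compact_set_of_combinations[OF assms, of "\<Sum>i\<in>J. norm (g i)" "\<lambda>j. (1/v) *\<^sub>R g j"] by blast
  have "information v g J x \<in> K" if x: "norm x \<le> 1" for x
  proof -
    have "\<bar>g j \<bullet> x\<bar> \<le> (\<Sum>i\<in>J. norm (g i))" if "j \<in> J" for j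
    proof -
      have "\<bar>g j \<bullet> x\<bar> \<le> norm (g j) * norm x" by (rule Cauchy_Schwarz_ineq2)
      also have "\<dots> \<le> norm (g j) * 1" using x by (intro mult_left_mono) auto
      also have "\<dots> \<le> (\<Sum>i\<in>J. norm (g i))"
        using member_le_sum[OF that, of "\<lambda>i. norm (g i)"] assms by simp
      finally show ?thesis .
    qed
    then have "(\<Sum>j\<in>J. (g j \<bullet> x) *\<^sub>R ((1/v) *\<^sub>R g j)) \<in> K" using K(2) by simp
    then show ?thesis by (simp add: information_def scaleR_sum_right mult.commute)
  qed
  then show ?thesis unfolding compact_operator_def using K(1)
    by (intro exI[of _ K]) (auto simp: image_subset_iff)
qed

text \<open>The equations determine \<open>S\<close> because \<open>I + C W\<close> is injective: if \<open>y + C W y = 0\<close>, the inner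
  product with \<open>W y\<close> is a sum of two nonnegative terms.\<close>

lemma posterior_covariance_unique:
  fixes C W :: "'a::real_inner \<Rightarrow> 'a"
  assumes C: "positive_semidefinite C" and W: "positive_semidefinite W"
    and S: "posterior_covariance C W S" and S': "posterior_covariance C W S'"
  shows "S = S'"
proof
  fix x
  note DC = positive_semidefiniteD[OF C] and DW = positive_semidefiniteD[OF W]
  interpret C: bounded_linear C by (rule DC)
  interpret W: bounded_linear W by (rule DW)
  define y where "y = S x - S' x"
  have "S x + C (W (S x)) = S' x + C (W (S' x))" using S S' by (simp add: posterior_covariance_def)
  then have y: "y + C (W y) = 0" by (simp add: y_def C.diff W.diff algebra_simps)
  then have "y \<bullet> W y + C (W y) \<bullet> W y = 0" by (metis inner_add_left inner_zero_left)
  moreover have "y \<bullet> W y \<ge> 0" "C (W y) \<bullet> W y \<ge> 0" using DC(3) DW(3)[of y] by (auto simp: inner_commute)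
  ultimately have "W y \<bullet> y = 0" by (simp add: inner_commute)
  then have "W y = 0" by (rule psd_kernel[OF W])
  then have "y = 0" using y by (simp add: C.zero)
  then show "S x = S' x" by (simp add: y_def)
qed

lemma posterior_covariance_prior:
  assumes "positive_semidefinite C"
  shows "posterior_covariance C (information v g {}) C"
  using assms bounded_linear.linear[OF positive_semidefiniteD(1)[OF assms]]
  by (simp add: posterior_covariance_def information_def linear_0)

text \<open>One more measurement along \<open>p\<close> changes the posterior covariance by a rank one term: the
  Sherman--Morrison formula, or the covariance part of a Kalman update.  It is nonnegative by
  Cauchy--Schwarz for the form of \<open>S\<close>.\<close>

lemma posterior_covariance_update:
  fixes C W :: "'a::real_inner \<Rightarrow> 'a"
  assumes C: "positive_semidefinite C" and S: "posterior_covariance C W S" and v: "v > 0"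
    and W': "\<And>x. W' x = W x + (1/v) *\<^sub>R ((p \<bullet> x) *\<^sub>R p)"
  shows "posterior_covariance C W' (\<lambda>x. S x - ((S p \<bullet> x) / (v + S p \<bullet> p)) *\<^sub>R S p)"
    (is "posterior_covariance C W' ?S")
proof -
  have Spsd: "positive_semidefinite S" and S1: "\<And>x. S x + S (W (C x)) = C x"
    and S2: "\<And>x. S x + C (W (S x)) = C x" using S by (auto simp: posterior_covariance_def)
  note DC = positive_semidefiniteD[OF C] and DS = positive_semidefiniteD[OF Spsd]
  interpret C: bounded_linear C by (rule DC)
  interpret S: bounded_linear S by (rule DS)
  define s where "s = S p \<bullet> p"
  have s: "s \<ge> 0" "v + s > 0" using DS(3)[of p] v by (auto simp: s_def)
  have bl: "bounded_linear ?S"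
    by (intro bounded_linear_sub DS(1) bounded_linear_scaleR_const)
      (simp add: divide_inverse bounded_linear_mult_const bounded_linear_inner_right)
  have sym: "?S x \<bullet> y = x \<bullet> ?S y" for x y
    by (simp add: inner_diff DS(2)[of x y] inner_commute[of "S p" x] inner_commute[of "S p" y] mult.commute
        del: DS)
  have "0 \<le> ?S x \<bullet> x" for x
  proof -
    have "(S p \<bullet> x)\<^sup>2 \<le> (S p \<bullet> p) * (S x \<bullet> x)"
      by (rule psd_cauchy_schwarz_on[where M=UNIV]) (use DS in \<open>auto simp: bounded_linear.linear\<close>)
    also have "\<dots> \<le> (v + s) * (S x \<bullet> x)" using v DS(3)[of x] by (auto simp: s_def intro: mult_right_mono)
    finally have "(S p \<bullet> x)\<^sup>2 / (v + s) \<le> S x \<bullet> x" using s(2) by (simp add: field_simps)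
    then show ?thesis by (simp add: inner_diff_left s_def power2_eq_square)
  qed
  then have psd: "positive_semidefinite ?S" using bl sym by (auto simp: positive_semidefinite_def self_adjoint_def)
  have Sp: "?S p = (v / (v + s)) *\<^sub>R S p"
  proof -
    have "1 - s / (v + s) = v / (v + s)" using s(2) by (simp add: field_simps)
    then show ?thesis by (simp add: s_def flip: scaleR_left_diff_distrib[of 1, simplified])
  qed
  have e1: "?S x + ?S (W' (C x)) = C x" for x
  proof -
    interpret S': bounded_linear ?S by (rule bl)
    have "?S (W' (C x)) = ?S (W (C x)) + ((p \<bullet> C x) / (v + s)) *\<^sub>R S p"
      unfolding W' S'.add S'.scaleR Sp using v by simp
    also have "?S (W (C x)) = S (W (C x)) - ((S p \<bullet> W (C x)) / (v + s)) *\<^sub>R S p" by (simp add: s_def)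
    finally have *: "?S x + ?S (W' (C x)) = (S x + S (W (C x)))
        + (((p \<bullet> C x) - (S p \<bullet> W (C x)) - (S p \<bullet> x)) / (v + s)) *\<^sub>R S p"
      by (simp add: s_def diff_divide_distrib scaleR_left_diff_distrib)
    have "p \<bullet> C x = p \<bullet> S x + p \<bullet> S (W (C x))" by (metis S1 inner_add_right)
    then have "p \<bullet> C x = S p \<bullet> x + S p \<bullet> W (C x)" by (simp add: DS(2))
    then show ?thesis using * S1[of x] by simp
  qed
  have e2: "?S x + C (W' (?S x)) = C x" for x
  proof -
    let ?c = "(S p \<bullet> x) / (v + s)"
    have Wl: "C (W (?S x)) = C (W (S x)) - ?c *\<^sub>R C (W (S p))"
    proof -
      have "S x - ?c *\<^sub>R S p = S (x - ?c *\<^sub>R p)" by (simp add: S.diff S.scaleR)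
      then have "C (W (?S x)) = C (x - ?c *\<^sub>R p) - S (x - ?c *\<^sub>R p)"
        using S2[of "x - ?c *\<^sub>R p"] by (simp add: s_def algebra_simps)
      also have "\<dots> = (C x - S x) - ?c *\<^sub>R (C p - S p)"
        by (simp add: S.diff S.scaleR C.diff C.scaleR algebra_simps)
      also have "C x - S x = C (W (S x))" using S2[of x] by (simp add: algebra_simps)
      also have "C p - S p = C (W (S p))" using S2[of p] by (simp add: algebra_simps)
      finally show ?thesis .
    qed
    have pS: "p \<bullet> ?S x = (v / (v + s)) * (S p \<bullet> x)"
      using sym[of p x] Sp by simp
    have "C (W' (?S x)) = C (W (?S x)) + ?c *\<^sub>R C p"
      unfolding W' C.add C.scaleR pS using v by simp
    also have "\<dots> = C (W (S x)) + ?c *\<^sub>R (C p - C (W (S p)))"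
      unfolding Wl by (simp add: algebra_simps)
    also have "C p - C (W (S p)) = S p" using S2[of p] by (simp add: algebra_simps)
    finally show ?thesis using S2[of x] by (simp add: s_def algebra_simps)
  qed
  show ?thesis using psd e1 e2 by (simp add: posterior_covariance_def)
qed

lemma information_insert:
  assumes "finite J" "j \<notin> J"
  shows "information v g (insert j J) x = information v g J x + (1/v) *\<^sub>R ((g j \<bullet> x) *\<^sub>R g j)"
  using assms by (simp add: information_def scaleR_right_distrib)

lemma posterior_covariance_exists:
  fixes C :: "'a::real_inner \<Rightarrow> 'a"
  assumes C: "positive_semidefinite C" and v: "v > 0" and "finite J"
  shows "\<exists>S. posterior_covariance C (information v g J) S"
  using \<open>finite J\<close>
proof (induction J)
  case empty show ?case using posterior_covariance_prior[OF C] by blast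
next
  case (insert j J)
  then obtain S where "posterior_covariance C (information v g J) S" by blast
  from posterior_covariance_update[OF C this v information_insert[OF insert.hyps]]
  show ?case by blast
qed

section \<open>Determinants\<close>

text \<open>The determinant is defined through eigenspaces; here it is evaluated on any finite orthogonal family
  of eigenvectors whose span contains the range.  The eigenspace of \<open>\<mu> \<noteq> 0\<close> lies in the range and
  is therefore spanned by the members of the family with eigenvalue \<open>\<mu>\<close>, whose number is its
  dimension.\<close>

lemma det_one_plus_orthogonal_eigenvectors:
  fixes T :: "'a::real_inner \<Rightarrow> 'a" and u :: "'i \<Rightarrow> 'a"
  assumes T: "linear T" and I: "finite I"
    and u0: "\<And>i. i \<in> I \<Longrightarrow> u i \<noteq> 0"
    and orth: "\<And>i l. i \<in> I \<Longrightarrow> l \<in> I \<Longrightarrow> i \<noteq> l \<Longrightarrow> u i \<bullet> u l = 0"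
    and eig: "\<And>i. i \<in> I \<Longrightarrow> T (u i) = g i *\<^sub>R u i" and g0: "\<And>i. i \<in> I \<Longrightarrow> g i \<noteq> 0"
    and range: "range T \<subseteq> span (u ` I)"
  shows "det_one_plus T = (\<Prod>i\<in>I. 1 + g i)"
proof -
  have inj: "inj_on u I"
  proof (rule inj_onI, rule ccontr)
    fix i l assume "i \<in> I" "l \<in> I" "u i = u l" "i \<noteq> l"
    then have "u i \<bullet> u i = 0" using orth by metis
    then show False using u0[OF \<open>i \<in> I\<close>] by simp
  qed
  have E: "eigenspace T \<mu> = span (u ` {i\<in>I. g i = \<mu>})" if "\<mu> \<noteq> 0" for \<mu>
  proof
    have "subspace (eigenspace T \<mu>)"
      using T by (auto simp: eigenspace_def subspace_def linear_0 linear_add linear_scale scaleR_right_distrib)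
    then show "span (u ` {i\<in>I. g i = \<mu>}) \<subseteq> eigenspace T \<mu>"
      by (intro span_minimal) (auto simp: eigenspace_def eig)
    show "eigenspace T \<mu> \<subseteq> span (u ` {i\<in>I. g i = \<mu>})"
    proof
      fix x assume "x \<in> eigenspace T \<mu>"
      then have Tx: "T x = \<mu> *\<^sub>R x" by (simp add: eigenspace_def)
      then have "x = T ((1/\<mu>) *\<^sub>R x)" using \<open>\<mu> \<noteq> 0\<close> T by (simp add: linear_scale)
      then have "x \<in> span (u ` I)" using range by (metis rangeI subsetD)
      then obtain d where d: "x = (\<Sum>b\<in>u ` I. d b *\<^sub>R b)"
        using span_finite[of "u ` I"] I by auto
      define c where "c i = d (u i)" for i
      have c: "x = (\<Sum>i\<in>I. c i *\<^sub>R u i)" unfolding d c_def by (subst sum.reindex[OF inj]) simp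
      have ip: "(\<Sum>i\<in>I. e i *\<^sub>R u i) \<bullet> u l = e l * (u l \<bullet> u l)" if "l \<in> I" for e l
      proof -
        have "(\<Sum>i\<in>I. e i *\<^sub>R u i) \<bullet> u l = (\<Sum>i\<in>I. if i = l then e l * (u l \<bullet> u l) else 0)"
          unfolding inner_sum_left by (intro sum.cong) (use orth that in auto)
        then show ?thesis using I that by simp
      qed
      \<comment> \<open>Comparing the coefficients of \<open>T x = \<mu> *\<^sub>R x\<close> leaves only the terms with \<open>g i = \<mu>\<close>.\<close>
      have Tx2: "T x = (\<Sum>i\<in>I. (c i * g i) *\<^sub>R u i)"
        unfolding c using T by (simp add: linear_sum linear_scale eig)
      have "c l = 0" if "l \<in> I" "g l \<noteq> \<mu>" for l
      proof -
        have "T x \<bullet> u l = c l * g l * (u l \<bullet> u l)" unfolding Tx2 by (rule ip[OF that(1)])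
        moreover have "x \<bullet> u l = c l * (u l \<bullet> u l)" unfolding c by (rule ip[OF that(1)])
        ultimately have "c l * g l * (u l \<bullet> u l) = \<mu> * (c l * (u l \<bullet> u l))"
          unfolding Tx by (metis inner_scaleR_left)
        then have "c l * (g l - \<mu>) * (u l \<bullet> u l) = 0" by (auto simp: algebra_simps)
        then have "c l = 0 \<or> g l - \<mu> = 0" using u0[OF that(1)] by simp
        then show ?thesis using that(2) by linarith
      qed
      then have "x = (\<Sum>i\<in>{i\<in>I. g i = \<mu>}. c i *\<^sub>R u i)"
        unfolding c using I by (intro sum.mono_neutral_right) auto
      also have "\<dots> \<in> span (u ` {i\<in>I. g i = \<mu>})"
        by (intro span_sum span_scale span_base) auto
      finally show "x \<in> span (u ` {i\<in>I. g i = \<mu>})" .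
    qed
  qed
  have dim: "dim (eigenspace T \<mu>) = card {i\<in>I. g i = \<mu>}" if "\<mu> \<noteq> 0" for \<mu>
  proof -
    have "independent (u ` {i\<in>I. g i = \<mu>})"
      by (rule pairwise_orthogonal_independent)
        (use orth u0 in \<open>auto simp: pairwise_def orthogonal_def\<close>)
    then have "dim (span (u ` {i\<in>I. g i = \<mu>})) = card (u ` {i\<in>I. g i = \<mu>})"
      by (simp add: dim_eq_card_independent)
    also have "\<dots> = card {i\<in>I. g i = \<mu>}"
      by (rule card_image) (use inj in \<open>auto simp: inj_on_def\<close>)
    finally show ?thesis using E[OF that] by simp
  qed
  have ev: "{\<mu>. \<mu> \<noteq> 0 \<and> (\<exists>x. x \<noteq> 0 \<and> T x = \<mu> *\<^sub>R x)} = g ` I"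
  proof safe
    fix \<mu> :: real and x assume *: "\<mu> \<noteq> 0" "x \<noteq> 0" "T x = \<mu> *\<^sub>R x"
    have "{i\<in>I. g i = \<mu>} \<noteq> {}"
    proof
      assume em: "{i\<in>I. g i = \<mu>} = {}"
      have "x \<in> span (u ` {i\<in>I. g i = \<mu>})" using * E[OF *(1)] by (auto simp: eigenspace_def)
      then show False using * unfolding em by simp
    qed
    then show "\<mu> \<in> g ` I" by blast
  qed (use g0 eig u0 in auto)
  have "det_one_plus T = (\<Prod>\<mu>\<in>g ` I. (1 + \<mu>) ^ dim (eigenspace T \<mu>))"
    unfolding det_one_plus_def ev ..
  also have "\<dots> = (\<Prod>\<mu>\<in>g ` I. \<Prod>i\<in>{i\<in>I. g i = \<mu>}. 1 + g i)"
  proof (rule prod.cong[OF refl])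
    fix \<mu> assume "\<mu> \<in> g ` I"
    then have "\<mu> \<noteq> 0" using g0 by auto
    have "(\<Prod>i\<in>{i\<in>I. g i = \<mu>}. 1 + g i) = (\<Prod>i\<in>{i\<in>I. g i = \<mu>}. 1 + \<mu>)" by (rule prod.cong) auto
    then show "(1 + \<mu>) ^ dim (eigenspace T \<mu>) = (\<Prod>i\<in>{i\<in>I. g i = \<mu>}. 1 + g i)"
      by (simp add: dim[OF \<open>\<mu> \<noteq> 0\<close>])
  qed
  also have "\<dots> = (\<Prod>i\<in>I. 1 + g i)" by (rule prod.image_gen[symmetric, OF I])
  finally show ?thesis .
qed

lemma det_orthonormal_eigenvectors:
  fixes A :: "real^'n^'n" and w :: "'n \<Rightarrow> real^'n"
  assumes w: "\<And>i j. w i \<bullet> w j = (if i = j then 1 else 0)" and eig: "\<And>i. A *v w i = \<gamma> i *\<^sub>R w i"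
  shows "det A = (\<Prod>i\<in>UNIV. \<gamma> i)"
proof -
  define P where "P = (\<chi> i. w i)"
  have PP: "P ** transpose P = mat 1"
    by (simp add: P_def matrix_matrix_mult_def transpose_def mat_def vec_eq_iff w[unfolded inner_vec_def, simplified])
  have "(P ** A ** transpose P) $ i $ j = (if i = j then \<gamma> i else 0)" for i j
  proof -
    have "A ** transpose P = (\<chi> a b. (A *v w b) $ a)"
      by (simp add: P_def matrix_matrix_mult_def transpose_def matrix_vector_mult_def vec_eq_iff)
    then have "(P ** (A ** transpose P)) $ i $ j = w i \<bullet> (A *v w j)"
      by (simp add: matrix_matrix_mult_def P_def inner_vec_def)
    then show ?thesis by (simp add: matrix_mul_assoc eig w)
  qed
  then have "det (P ** A ** transpose P) = (\<Prod>i\<in>UNIV. \<gamma> i)"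
    by (subst det_diagonal) auto
  moreover have "det P * det P = 1" using arg_cong[OF PP, of det] by (simp add: det_mul)
  ultimately show ?thesis by (simp add: det_mul mult_ac)
qed

text \<open>Sylvester's identity \<open>det (I + Y X) = det (I + X Y)\<close> reduces the determinant of an operator on a
  Hilbert space to a matrix of the size of the number of measurements.  For an orthonormal eigenbasis
  \<open>w\<close> of \<open>X Y\<close>, the vectors \<open>Y (w i)\<close> with nonzero eigenvalue are orthogonal eigenvectors of
  \<open>Y X\<close> with the same eigenvalues.\<close>

lemma det_one_plus_compose:
  fixes X :: "'a::real_inner \<Rightarrow> real^'m" and Y :: "real^'m \<Rightarrow> 'a"
  assumes X: "linear X" and Y: "linear Y" and adj: "\<And>x y. X x \<bullet> y = x \<bullet> Y y"
  shows "det_one_plus (\<lambda>x. Y (X x)) = det (matrix (\<lambda>y. y + X (Y y)))"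
    and "det (matrix (\<lambda>y. y + X (Y y))) \<ge> 1"
proof -
  let ?G = "\<lambda>y. X (Y y)"
  have lG: "linear ?G" using linear_compose[OF Y X] by (simp add: o_def)
  have G: "positive_semidefinite ?G"
    using lG by (auto simp: positive_semidefinite_def self_adjoint_def adj linear_conv_bounded_linear)
      (metis adj inner_commute)
  have "compact (?G ` cball 0 1)"
    using lG by (intro compact_continuous_image linear_continuous_on) (auto simp: linear_conv_bounded_linear)
  then have cG: "compact_operator ?G" by (auto simp: compact_operator_def)
  obtain B where B: "orthonormal_basis B" "\<And>b. b \<in> B \<Longrightarrow> ?G b = (?G b \<bullet> b) *\<^sub>R b"
    using commuting_compact_psd_eigenbasis[OF G cG G cG] by metis
  have oB: "orthonormal B" using B(1) by (simp add: orthonormal_basis_iff)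
  have indep: "independent B" by (rule orthonormal_independent[OF oB])
  have "span B = UNIV"
    using B(1) closed_span[of B] by (simp add: orthonormal_basis_iff)
  then have "card B = CARD('m)" using dim_eq_card_independent[OF indep] dim_span[of B] by simp
  moreover have "finite B" using indep by (rule independent_imp_finite)
  ultimately obtain w where w: "bij_betw w (UNIV :: 'm set) B"
    using finite_same_card_bij[of "UNIV :: 'm set" B] by auto
  then have wB: "w i \<in> B" for i by (auto simp: bij_betw_def)
  have ww: "w i \<bullet> w j = (if i = j then 1 else 0)" for i j
    using orthonormal_inner[OF oB wB wB, of i j] w by (auto simp: bij_betw_def inj_on_def)
  define \<gamma> where "\<gamma> i = ?G (w i) \<bullet> w i" for i
  have eig: "?G (w i) = \<gamma> i *\<^sub>R w i" for i using B(2)[OF wB] by (simp add: \<gamma>_def)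
  have \<gamma>: "\<gamma> i \<ge> 0" for i using positive_semidefiniteD(3)[OF G] by (simp add: \<gamma>_def)
  have lin1: "linear (\<lambda>y. y + ?G y)" by (intro linear_compose_add linear_id[unfolded id_def] lG)
  have d1: "det (matrix (\<lambda>y. y + ?G y)) = (\<Prod>i\<in>UNIV. 1 + \<gamma> i)"
    by (rule det_orthonormal_eigenvectors[OF ww])
      (simp add: matrix_vector_mul(2)[symmetric] matrix_works lin1 eig scaleR_left_distrib)
  show "det (matrix (\<lambda>y. y + X (Y y))) \<ge> 1"
    unfolding d1 by (rule prod_ge_1) (simp add: \<gamma>)
  let ?I = "{i. \<gamma> i \<noteq> 0}"
  have YY: "Y (w i) \<bullet> Y (w l) = (if i = l then \<gamma> i else 0)" for i l
    using adj[of "Y (w i)" "w l"] by (cases "i = l") (auto simp: eig ww)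
  have Y0: "Y (w i) = 0" if "\<gamma> i = 0" for i using YY[of i i] that by simp
  have "det_one_plus (\<lambda>x. Y (X x)) = (\<Prod>i\<in>?I. 1 + \<gamma> i)"
  proof (rule det_one_plus_orthogonal_eigenvectors)
    show "linear (\<lambda>x. Y (X x))" using linear_compose[OF X Y] by (simp add: o_def)
    show "Y (w i) \<noteq> 0" if "i \<in> ?I" for i using YY[of i i] that by auto
    show "Y (X (Y (w i))) = \<gamma> i *\<^sub>R Y (w i)" for i using Y by (simp add: eig linear_scale)
    show "range (\<lambda>x. Y (X x)) \<subseteq> span ((\<lambda>i. Y (w i)) ` ?I)"
    proof safe
      fix x
      have "X x \<in> span (range w)" using \<open>span B = UNIV\<close> w by (simp add: bij_betw_def)
      then show "Y (X x) \<in> span ((\<lambda>i. Y (w i)) ` ?I)"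
      proof (induction rule: span_induct_alt)
        case base show ?case using Y by (simp add: linear_0 span_zero)
      next
        case (step c z y)
        then obtain i where i: "z = w i" by auto
        have "Y z \<in> span ((\<lambda>i. Y (w i)) ` ?I)"
          by (cases "\<gamma> i = 0") (auto simp: i Y0 span_zero intro: span_base)
        then show ?case using step Y by (simp add: linear_add linear_scale span_add span_scale)
      qed
    qed
  qed (use YY in auto)
  also have "\<dots> = (\<Prod>i\<in>UNIV. 1 + \<gamma> i)" by (rule prod.mono_neutral_left) auto
  finally show "det_one_plus (\<lambda>x. Y (X x)) = det (matrix (\<lambda>y. y + X (Y y)))" using d1 by simp
qed

text \<open>In the Leibniz expansion along a unit row \<open>j\<close> only permutations that fix \<open>j\<close> contribute, and
  these do not see the other entries of column \<open>j\<close>.\<close>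

lemma det_unit_row:
  fixes A B :: "real^'n^'n"
  assumes "A $ j = axis j 1" "B $ j = axis j 1" and eq: "\<And>a b. b \<noteq> j \<Longrightarrow> A $ a $ b = B $ a $ b"
  shows "det A = det B"
  unfolding det_def
proof (rule sum.cong[OF refl])
  fix p :: "'n \<Rightarrow> 'n" assume "p \<in> {p. p permutes UNIV}"
  then have p: "p permutes UNIV" by simp
  have "(\<Prod>i\<in>UNIV. A $ i $ p i) = (\<Prod>i\<in>UNIV. B $ i $ p i)"
  proof (cases "p j = j")
    case True
    show ?thesis
    proof (rule prod.cong[OF refl])
      fix i show "A $ i $ p i = B $ i $ p i"
      proof (cases "i = j")
        case True then show ?thesis using assms by simp
      next
        case False
        then have "p i \<noteq> j" using True p by (metis permutes_inverses(2))
        then show ?thesis by (rule eq)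
      qed
    qed
  next
    case False
    then have "A $ j $ p j = 0" "B $ j $ p j = 0" using assms by (auto simp: axis_def)
    then have "(\<Prod>i\<in>UNIV. A $ i $ p i) = 0" "(\<Prod>i\<in>UNIV. B $ i $ p i) = 0"
      by (auto intro!: prod_zero simp del: prod_zero_iff)
    then show ?thesis by (simp only:)
  qed
  then show "of_int (sign p) * (\<Prod>i\<in>UNIV. A $ i $ p i) = of_int (sign p) * (\<Prod>i\<in>UNIV. B $ i $ p i)" by simp
qed

text \<open>Up to the factor \<open>v\<close> this is the covariance matrix of the data under the prior predictive
  distribution.\<close>

definition gram :: "real \<Rightarrow> ('a::real_inner \<Rightarrow> 'a) \<Rightarrow> ('m::finite \<Rightarrow> 'a) \<Rightarrow> real^'m^'m" where
  "gram v C g = (\<chi> a b. (if a = b then 1 else 0) + (1/v) * (C (g a) \<bullet> g b))"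

text \<open>With the other measurements fixed, the determinant is an affine function of the posterior variance
  \<open>S p \<bullet> p\<close> that these leave in the direction \<open>p\<close> of measurement \<open>j\<close>.  Setting \<open>g j\<close> to \<open>0\<close>
  removes measurement \<open>j\<close>, so that the factor on the right depends on the others only.\<close>

lemma det_gram_update:
  fixes C :: "'a::real_inner \<Rightarrow> 'a" and g :: "'m::finite \<Rightarrow> 'a"
  assumes C: "positive_semidefinite C" and v: "v > 0"
    and S: "posterior_covariance C (information v g (UNIV - {j})) S"
  shows "det (gram v C (g(j := p))) = (1 + (1/v) * (S p \<bullet> p)) * det (gram v C (g(j := 0)))"
proof -
  note DC = positive_semidefiniteD[OF C]
  interpret C: bounded_linear C by (rule DC)
  let ?A = "gram v C (g(j := p))"
  \<comment> \<open>The equation \<open>C p = S p + C W (S p)\<close> says that subtracting these multiples of the other rows turns row \<open>j\<close> into a multiple of a unit row.\<close>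
  define c where "c a = g a \<bullet> S p" for a
  define x where "x = (\<Sum>a\<in>UNIV - {j}. (- (c a / v)) *s row a ?A)"
  have "x \<in> vec.span {row a ?A | a. a \<noteq> j}"
    unfolding x_def by (intro vec.span_sum vec.span_scale vec.span_base) auto
  from det_row_span[OF this]
  have d: "det ?A = det (\<chi> k. if k = j then row j ?A + x else row k ?A)" by simp
  have "C p = S p + C (information v g (UNIV - {j}) (S p))" using S by (simp add: posterior_covariance_def)
  then have Cp: "C p = S p + (\<Sum>a\<in>UNIV - {j}. (c a / v) *\<^sub>R C (g a))"
    by (simp add: information_def C.scaleR C.sum c_def scaleR_sum_right)
  have r: "row j ?A + x = (1 + (1/v) * (S p \<bullet> p)) *s axis j 1"
  proof (rule vec_eq_iff[THEN iffD2], rule allI)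
    fix b
    let ?q = "(g(j := p)) b"
    have "x $ b = - (\<Sum>a\<in>UNIV - {j}. (c a / v) * ((if a = b then 1 else 0) + (1/v) * (C (g a) \<bullet> ?q)))"
      by (simp add: x_def row_def gram_def sum_negf)
    also have "(\<Sum>a\<in>UNIV - {j}. (c a / v) * ((if a = b then 1 else 0) + (1/v) * (C (g a) \<bullet> ?q))) =
       (\<Sum>a\<in>UNIV - {j}. if a = b then c b / v else 0) + (1/v) * (\<Sum>a\<in>UNIV - {j}. (c a / v) * (C (g a) \<bullet> ?q))"
      unfolding sum_distrib_left sum.distrib[symmetric] by (intro sum.cong) (auto simp: algebra_simps)
    also have "(\<Sum>a\<in>UNIV - {j}. (c a / v) * (C (g a) \<bullet> ?q)) = C p \<bullet> ?q - S p \<bullet> ?q"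
      unfolding Cp by (simp add: inner_add_left inner_sum_left)
    finally have xb: "x $ b = - ((if b = j then 0 else c b / v) + (1/v) * (C p \<bullet> ?q - S p \<bullet> ?q))"
      by (simp add: sum.delta)
    show "(row j ?A + x) $ b = ((1 + (1/v) * (S p \<bullet> p)) *s axis j 1) $ b"
      unfolding vector_add_component xb
      by (auto simp: row_def gram_def axis_def c_def inner_commute algebra_simps)
  qed
  have "det ?A = (1 + (1/v) * (S p \<bullet> p)) * det (\<chi> k. if k = j then axis j 1 else row k ?A)"
    unfolding d r by (rule det_row_mul)
  also have "det (\<chi> k. if k = j then axis j 1 else row k ?A) = det (gram v C (g(j := 0)))"
    by (rule det_unit_row[of _ j])
      (auto simp: vec_eq_iff gram_def axis_def row_def C.zero)
  finally show ?thesis .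
qed

section \<open>Bayes updates of Gaussian measures\<close>

text \<open>A Gaussian measure of total mass \<open>c\<close>, given by its characteristic functional.  The mass is left
  open because multiplying by a likelihood yields an unnormalised measure.\<close>

definition gaussian_cf ::
    "'a::{real_inner, polish_space} measure \<Rightarrow> real \<Rightarrow> 'a \<Rightarrow> ('a \<Rightarrow> 'a) \<Rightarrow> bool" where
  "gaussian_cf M c a S \<longleftrightarrow> finite_measure M \<and> sets M = sets borel \<and> c > 0 \<and>
     (\<forall>h. (CLINT x|M. iexp (h \<bullet> x)) = of_real c * iexp (h \<bullet> a) * of_real (exp (- (h \<bullet> S h) / 2)))"

lemma cf_normal_density:
  assumes "s > 0"
  shows "(CLINT z|lborel. normal_density \<mu> s z *\<^sub>R iexp (z * q)) = iexp (\<mu> * q) * of_real (exp (- (s * q)\<^sup>2 / 2))"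
proof -
  have *: "normal_density \<mu> s (\<mu> + s * y) *\<^sub>R iexp ((\<mu> + s * y) * q)
      = (1 / s) *\<^sub>R (iexp (\<mu> * q) * (std_normal_density y *\<^sub>R iexp (s * q * y)))" for y
    using assms by (simp add: normal_density_def real_sqrt_mult power_mult_distrib exp_add[symmetric]
        scaleR_conv_of_real algebra_simps)
  have "(CLINT z|lborel. normal_density \<mu> s z *\<^sub>R iexp (z * q))
      = \<bar>s\<bar> *\<^sub>R (CLINT y|lborel. normal_density \<mu> s (\<mu> + s * y) *\<^sub>R iexp ((\<mu> + s * y) * q))"
    by (rule lborel_integral_real_affine) (use assms in simp)
  also have "\<dots> = iexp (\<mu> * q) * (CLINT y|lborel. std_normal_density y *\<^sub>R iexp (s * q * y))"
    unfolding * integral_scaleR_right integral_mult_right_zero using assms by simp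
  also have "(CLINT y|lborel. std_normal_density y *\<^sub>R iexp (s * q * y)) = char std_normal_distribution (s * q)"
    unfolding char_def by (rule integral_density[symmetric]) auto
  finally show ?thesis by (simp add: char_std_normal_distribution)
qed

text \<open>Completing the square turns the integrand into a multiple of a normal density with mean \<open>V * p\<close>
  and variance \<open>V\<close>.\<close>

lemma std_normal_exponential_quadratic:
  assumes w: "w \<ge> 0" and V: "V = 1 / (1 + w)"
  shows "(CLINT z|std_normal_distribution. of_real (exp (z * p - z\<^sup>2 * w / 2)) * iexp (z * q))
    = of_real (sqrt V * exp (V * p\<^sup>2 / 2)) * iexp (V * p * q) * of_real (exp (- V * q\<^sup>2 / 2))"
proof -
  have V0: "V > 0" using w V by simp
  have w': "w = 1 / V - 1" using w V by simp
  have *: "std_normal_density z * exp (z * p - z\<^sup>2 * w / 2) =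
      (sqrt V * exp (V * p\<^sup>2 / 2)) * normal_density (V * p) (sqrt V) z" for z
  proof -
    have "- z\<^sup>2 / 2 + (z * p - z\<^sup>2 * w / 2) = V * p\<^sup>2 / 2 + - (z - V * p)\<^sup>2 / (2 * V)"
      unfolding w' using V0 by (simp add: power2_eq_square field_simps)
    then have "exp (- z\<^sup>2 / 2) * exp (z * p - z\<^sup>2 * w / 2) = exp (V * p\<^sup>2 / 2) * exp (- (z - V * p)\<^sup>2 / (2 * V))"
      unfolding exp_add[symmetric] by (rule arg_cong)
    then show ?thesis using V0
      by (simp add: normal_density_def real_sqrt_mult field_simps)
  qed
  have "(CLINT z|std_normal_distribution. of_real (exp (z * p - z\<^sup>2 * w / 2)) * iexp (z * q))
     = (CLINT z|lborel. std_normal_density z *\<^sub>R (of_real (exp (z * p - z\<^sup>2 * w / 2)) * iexp (z * q)))"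
    by (rule integral_density) auto
  also have "\<dots> = (CLINT z|lborel. of_real (sqrt V * exp (V * p\<^sup>2 / 2)) * (normal_density (V * p) (sqrt V) z *\<^sub>R iexp (z * q)))"
  proof (rule Bochner_Integration.integral_cong[OF refl])
    fix z
    have "std_normal_density z *\<^sub>R (complex_of_real (exp (z * p - z\<^sup>2 * w / 2)) * iexp (z * q))
       = of_real (std_normal_density z * exp (z * p - z\<^sup>2 * w / 2)) * iexp (z * q)"
      by (simp add: scaleR_conv_of_real mult.assoc)
    also have "\<dots> = of_real (sqrt V * exp (V * p\<^sup>2 / 2)) * (normal_density (V * p) (sqrt V) z *\<^sub>R iexp (z * q))"
      unfolding * by (simp add: scaleR_conv_of_real mult.assoc)
    finally show "std_normal_density z *\<^sub>R (complex_of_real (exp (z * p - z\<^sup>2 * w / 2)) * iexp (z * q)) = \<dots>" .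
  qed
  also have "\<dots> = of_real (sqrt V * exp (V * p\<^sup>2 / 2)) *
      (CLINT z|lborel. normal_density (V * p) (sqrt V) z *\<^sub>R iexp (z * q))"
    by (rule integral_mult_right_zero)
  also have "\<dots> = of_real (sqrt V * exp (V * p\<^sup>2 / 2)) * iexp (V * p * q) * of_real (exp (- V * q\<^sup>2 / 2))"
    using V0 cf_normal_density[of "sqrt V" "V * p" q] by (simp add: power_mult_distrib)
  finally show ?thesis .
qed

text \<open>The likelihood factor of one measurement is itself a characteristic function.  This is what
  makes a Bayes update computable from the characteristic functional alone.\<close>

lemma exp_square_as_cf:
  assumes "v > 0"
  shows "complex_of_real (exp (- (y\<^sup>2 / (2 * v)))) = (CLINT z|std_normal_distribution. iexp (z * y / sqrt v))"
proof -
  have "(CLINT z|std_normal_distribution. iexp (z * y / sqrt v)) = char std_normal_distribution (y / sqrt v)"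
    by (simp add: char_def mult_ac)
  then show ?thesis using assms by (simp add: char_std_normal_distribution power_divide)
qed

text \<open>Writing the likelihood factor as an average of \<open>iexp (z * (d - g \<bullet> x) / sqrt v)\<close> over a standard
  normal \<open>z\<close>, Fubini's theorem reduces the characteristic functional of the updated measure to the
  old one at the points \<open>h - (z / sqrt v) *\<^sub>R g\<close>, followed by a one-dimensional Gaussian integral
  over \<open>z\<close>.  The covariance that comes out is the one of \<open>posterior_covariance_update\<close>.\<close>

theorem gaussian_cf_update:
  fixes M :: "'a::{real_inner, polish_space} measure"
  assumes G: "gaussian_cf M c a S" and S: "positive_semidefinite S" and v: "v > 0"
  shows "\<exists>c' a'. gaussian_cf (density M (\<lambda>x. ennreal (exp (- ((d - g \<bullet> x)\<^sup>2 / (2 * v)))))) c' a'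
     (\<lambda>x. S x - ((S g \<bullet> x) / (v + S g \<bullet> g)) *\<^sub>R S g)"
proof -
  let ?E = "\<lambda>x. exp (- ((d - g \<bullet> x)\<^sup>2 / (2 * v)))"
  let ?N = std_normal_distribution
  note DS = positive_semidefiniteD[OF S]
  interpret S: bounded_linear S by (rule DS)
  have fM: "finite_measure M" and [measurable_cong]: "sets M = sets borel" and c: "c > 0"
    and cf: "\<And>h. (CLINT x|M. iexp (h \<bullet> x)) = of_real c * iexp (h \<bullet> a) * of_real (exp (- (h \<bullet> S h) / 2))"
    using G by (auto simp: gaussian_cf_def)
  interpret M: finite_measure M by (rule fM)
  interpret N: prob_space ?N by (rule prob_space_normal_density) simp
  interpret P: pair_sigma_finite ?N M ..
  define s where "s = S g \<bullet> g"
  have s: "s \<ge> 0" using DS(3) by (simp add: s_def)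
  define V where "V = 1 / (1 + s / v)"
  have V: "V = v / (v + s)" "V > 0" using v s by (auto simp: V_def field_simps)
  define q where "q = (d - g \<bullet> a) / sqrt v"
  let ?S = "\<lambda>x. S x - ((S g \<bullet> x) / (v + S g \<bullet> g)) *\<^sub>R S g"
  let ?a = "a + ((d - g \<bullet> a) / (v + s)) *\<^sub>R S g"
  let ?c = "c * sqrt V * exp (- V * q\<^sup>2 / 2)"
  have "(CLINT x|density M (\<lambda>x. ennreal (?E x)). iexp (h \<bullet> x))
      = of_real ?c * iexp (h \<bullet> ?a) * of_real (exp (- (h \<bullet> ?S h) / 2))" for h
  proof -
    define p where "p = (S g \<bullet> h) / sqrt v"
    have "(CLINT x|density M (\<lambda>x. ennreal (?E x)). iexp (h \<bullet> x)) = (CLINT x|M. ?E x *\<^sub>R iexp (h \<bullet> x))"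
      by (rule integral_density) auto
    also have "\<dots> = (CLINT x|M. (CLINT z|?N. iexp (h \<bullet> x) * iexp (z * (d - g \<bullet> x) / sqrt v)))"
      unfolding scaleR_conv_of_real exp_square_as_cf[OF v] integral_mult_right_zero
      by (simp only: mult.commute)
    also have "\<dots> = (CLINT z|?N. (CLINT x|M. iexp (h \<bullet> x) * iexp (z * (d - g \<bullet> x) / sqrt v)))"
    proof (rule P.Fubini_integral)
      interpret NM: finite_measure "?N \<Otimes>\<^sub>M M"
        by (rule finite_measure_pair_measure) (use fM N.finite_measure_axioms in auto)
      show "integrable (?N \<Otimes>\<^sub>M M) (\<lambda>(z, x). iexp (h \<bullet> x) * iexp (z * (d - g \<bullet> x) / sqrt v))"
        by (rule NM.integrable_const_bound[where B=1]) (auto simp: norm_mult)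
    qed
    also have "\<dots> = (CLINT z|?N. (of_real c * iexp (h \<bullet> a) * of_real (exp (- (h \<bullet> S h) / 2))) *
        (of_real (exp (z * p - z\<^sup>2 * (s / v) / 2)) * iexp (z * q)))"
    proof (rule Bochner_Integration.integral_cong[OF refl])
      fix z :: real
      let ?h = "h - (z / sqrt v) *\<^sub>R g"
      have e: "iexp (h \<bullet> x) * iexp (z * (d - g \<bullet> x) / sqrt v) = iexp (z * d / sqrt v) * iexp (?h \<bullet> x)" for x
        by (simp add: exp_add[symmetric] inner_diff_left algebra_simps diff_divide_distrib)
      have "(CLINT x|M. iexp (h \<bullet> x) * iexp (z * (d - g \<bullet> x) / sqrt v))
         = iexp (z * d / sqrt v) * (of_real c * iexp (?h \<bullet> a) * of_real (exp (- (?h \<bullet> S ?h) / 2)))"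
        unfolding e by (simp only: integral_mult_right_zero cf)
      also have "iexp (?h \<bullet> a) = iexp (h \<bullet> a) * iexp (- (z * (g \<bullet> a) / sqrt v))"
        by (simp add: exp_add[symmetric] inner_diff_left algebra_simps)
      also have "- (?h \<bullet> S ?h) / 2 = - (h \<bullet> S h) / 2 + (z * p - z\<^sup>2 * (s / v) / 2)"
      proof -
        have "?h \<bullet> S ?h = h \<bullet> S h - 2 * (z / sqrt v) * (S g \<bullet> h) + (z / sqrt v)\<^sup>2 * s"
          by (simp add: S.diff S.scaleR inner_diff s_def power2_eq_square DS(2)[of g h] inner_commute[of h "S g"] algebra_simps)
            (simp add: inner_commute)
        then show ?thesis using v by (simp add: p_def power_divide field_simps)
      qed
      also have "exp (- (h \<bullet> S h) / 2 + (z * p - z\<^sup>2 * (s / v) / 2)) =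
         exp (- (h \<bullet> S h) / 2) * exp (z * p - z\<^sup>2 * (s / v) / 2)" by (rule exp_add)
      finally have 1: "(CLINT x|M. iexp (h \<bullet> x) * iexp (z * (d - g \<bullet> x) / sqrt v)) =
        iexp (z * d / sqrt v) * (of_real c * (iexp (h \<bullet> a) * iexp (- (z * (g \<bullet> a) / sqrt v))) *
          of_real (exp (- (h \<bullet> S h) / 2) * exp (z * p - z\<^sup>2 * (s / v) / 2)))" .
      have 2: "iexp (z * q) = iexp (z * d / sqrt v) * iexp (- (z * (g \<bullet> a) / sqrt v))"
        by (simp add: q_def exp_add[symmetric] algebra_simps diff_divide_distrib)
      show "(CLINT x|M. iexp (h \<bullet> x) * iexp (z * (d - g \<bullet> x) / sqrt v)) =
        (of_real c * iexp (h \<bullet> a) * of_real (exp (- (h \<bullet> S h) / 2))) *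
        (of_real (exp (z * p - z\<^sup>2 * (s / v) / 2)) * iexp (z * q))"
        unfolding 1 2 by (simp only: of_real_mult mult_ac)
    qed
    also have "\<dots> = (of_real c * iexp (h \<bullet> a) * of_real (exp (- (h \<bullet> S h) / 2))) *
        (CLINT z|?N. of_real (exp (z * p - z\<^sup>2 * (s / v) / 2)) * iexp (z * q))"
      by (rule integral_mult_right_zero)
    also have "\<dots> = (of_real c * iexp (h \<bullet> a) * of_real (exp (- (h \<bullet> S h) / 2))) *
        (of_real (sqrt V * exp (V * p\<^sup>2 / 2)) * iexp (V * p * q) * of_real (exp (- V * q\<^sup>2 / 2)))"
      by (subst std_normal_exponential_quadratic[where V=V]) (use s v in \<open>simp_all add: V_def\<close>)
    also have "\<dots> = of_real (c * sqrt V * exp (- V * q\<^sup>2 / 2)) * (iexp (h \<bullet> a) * iexp (V * p * q)) *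
        of_real (exp (- (h \<bullet> S h) / 2) * exp (V * p\<^sup>2 / 2))"
      unfolding of_real_mult by (simp only: mult_ac)
    also have "iexp (h \<bullet> a) * iexp (V * p * q) = iexp (h \<bullet> ?a)"
    proof -
      have "V * p * q = (v / (v + s)) * ((S g \<bullet> h) * (d - g \<bullet> a)) / (sqrt v * sqrt v)"
        unfolding V(1) p_def q_def times_divide_times_eq times_divide_eq_right times_divide_eq_left divide_divide_eq_left
        by (simp only: mult_ac)
      also have "\<dots> = ((d - g \<bullet> a) / (v + s)) * (h \<bullet> S g)"
        using v by (simp add: inner_commute)
      finally have "h \<bullet> ?a = h \<bullet> a + V * p * q" by (simp add: inner_add_right)
      then show ?thesis by (simp only: of_real_add distrib_left exp_add)
    qed
    also have "exp (- (h \<bullet> S h) / 2) * exp (V * p\<^sup>2 / 2) = exp (- (h \<bullet> ?S h) / 2)"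
    proof -
      have "V * p\<^sup>2 = (S g \<bullet> h)\<^sup>2 / (v + s)" using v by (simp add: V p_def power_divide)
      then have "h \<bullet> ?S h = h \<bullet> S h - V * p\<^sup>2"
        by (simp add: inner_diff_right s_def power2_eq_square inner_commute)
      then show ?thesis by (simp add: exp_add[symmetric] diff_divide_distrib add_divide_distrib[symmetric])
    qed
    finally show ?thesis .
  qed
  moreover have "finite_measure (density M (\<lambda>x. ennreal (?E x)))"
  proof (rule finite_measureI)
    have "emeasure (density M (\<lambda>x. ennreal (?E x))) (space M) = (\<integral>\<^sup>+x. ennreal (?E x) \<partial>M)"
      by (subst emeasure_density) (auto cong: nn_integral_cong)
    also have "\<dots> \<le> (\<integral>\<^sup>+x. 1 \<partial>M)" using v by (intro nn_integral_mono) (simp add: ennreal_le_1)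
    also have "\<dots> < \<infinity>" by (simp add: M.emeasure_finite less_top[symmetric])
    finally show "emeasure (density M (\<lambda>x. ennreal (?E x))) (space (density M (\<lambda>x. ennreal (?E x)))) \<noteq> \<infinity>"
      by simp
  qed
  moreover have "?c > 0" using c V by simp
  ultimately have "gaussian_cf (density M (\<lambda>x. ennreal (?E x))) ?c ?a ?S"
    by (simp add: gaussian_cf_def \<open>sets M = sets borel\<close>)
  then show ?thesis by blast
qed

text \<open>Measurement by measurement, the update of the measure and the update of the operator run in
  parallel, which identifies the covariance of the posterior.\<close>

lemma gaussian_cf_measurements:
  fixes M :: "'a::{real_inner, polish_space} measure" and g :: "'m \<Rightarrow> 'a"
  assumes G: "gaussian_cf M c a C" and C: "positive_semidefinite C" and v: "v > 0" and "finite J"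
  shows "\<exists>c' a' S. posterior_covariance C (information v g J) S \<and>
    gaussian_cf (density M (\<lambda>x. ennreal (\<Prod>j\<in>J. exp (- ((d j - g j \<bullet> x)\<^sup>2 / (2 * v)))))) c' a' S"
  using \<open>finite J\<close>
proof (induction J)
  case empty
  have "density M (\<lambda>x. ennreal (\<Prod>j\<in>{}. exp (- ((d j - g j \<bullet> x)\<^sup>2 / (2 * v))))) = M"
    by (simp add: density_1)
  then show ?case using posterior_covariance_prior[OF C] G by metis
next
  case (insert j J)
  let ?f = "\<lambda>x. (\<Prod>j\<in>J. exp (- ((d j - g j \<bullet> x)\<^sup>2 / (2 * v))))"
  let ?e = "\<lambda>x. exp (- ((d j - g j \<bullet> x)\<^sup>2 / (2 * v)))"
  obtain c' a' S where S: "posterior_covariance C (information v g J) S"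
    and G': "gaussian_cf (density M (\<lambda>x. ennreal (?f x))) c' a' S"
    using insert.IH by blast
  have [measurable_cong]: "sets M = sets borel" using G by (simp add: gaussian_cf_def)
  have "density (density M (\<lambda>x. ennreal (?f x))) (\<lambda>x. ennreal (?e x)) =
      density M (\<lambda>x. ennreal (?f x) * ennreal (?e x))"
    by (rule density_density_eq) measurable
  also have "\<dots> = density M (\<lambda>x. ennreal (\<Prod>j\<in>insert j J. exp (- ((d j - g j \<bullet> x)\<^sup>2 / (2 * v)))))"
    using insert.hyps by (intro arg_cong[where f="density M"] ext) (simp add: ennreal_mult[symmetric] prod_nonneg mult.commute)
  finally have D: "density (density M (\<lambda>x. ennreal (?f x))) (\<lambda>x. ennreal (?e x)) = \<dots>" .
  have "positive_semidefinite S" using S by (simp add: posterior_covariance_def)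
  from gaussian_cf_update[OF G' this v, of "d j" "g j"]
    posterior_covariance_update[OF C S v information_insert[OF insert.hyps]]
  show ?case unfolding D by blast
qed

text \<open>By Levy's uniqueness theorem \<open>h \<bullet> x\<close> has the law of \<open>h \<bullet> a + sqrt s * z\<close> with a standard normal
  \<open>z\<close>, which also covers the degenerate case \<open>s = 0\<close>; its moments are those of \<open>z\<close>.\<close>

lemma gaussian_cf_projection:
  fixes M :: "'a::{real_inner, polish_space} measure"
  assumes G: "gaussian_cf M 1 a S" and S: "positive_semidefinite S"
  shows "prob_space M"
    and "integrable M (\<lambda>x. h \<bullet> x)" "(LINT x|M. h \<bullet> x) = h \<bullet> a"
    and "integrable M (\<lambda>x. (h \<bullet> x - h \<bullet> a)\<^sup>2)" "(LINT x|M. (h \<bullet> x - h \<bullet> a)\<^sup>2) = h \<bullet> S h"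
proof -
  let ?N = std_normal_distribution
  have fM: "finite_measure M" and [measurable_cong]: "sets M = sets borel"
    and cf: "\<And>h. (CLINT x|M. iexp (h \<bullet> x)) = iexp (h \<bullet> a) * of_real (exp (- (h \<bullet> S h) / 2))"
    using G by (auto simp: gaussian_cf_def)
  interpret M: finite_measure M by (rule fM)
  interpret N: prob_space ?N by (rule prob_space_normal_density) simp
  have "measure M (space M) = 1" using cf[of 0] by (simp add: scaleR_conv_of_real)
  then show pM: "prob_space M" by (intro prob_spaceI) (simp add: M.emeasure_eq_measure)
  interpret P: prob_space M by (rule pM)
  interpret S: bounded_linear S by (rule positive_semidefiniteD(1)[OF S])
  define s where "s = h \<bullet> S h"
  have s: "s \<ge> 0" using positive_semidefiniteD(3)[OF S, of h] by (simp add: s_def inner_commute)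
  let ?A = "\<lambda>x. h \<bullet> x" and ?B = "\<lambda>z. h \<bullet> a + sqrt s * z"
  have eq: "distr M borel ?A = distr ?N borel ?B"
  proof (rule Levy_uniqueness)
    show "real_distribution (distr M borel ?A)" "real_distribution (distr ?N borel ?B)"
      by (auto intro!: P.real_distribution_distr N.real_distribution_distr)
    show "char (distr M borel ?A) = char (distr ?N borel ?B)"
    proof
      fix t
      have "char (distr M borel ?A) t = (CLINT x|M. iexp ((t *\<^sub>R h) \<bullet> x))"
        unfolding char_def by (subst integral_distr) auto
      also have "\<dots> = iexp (t * (h \<bullet> a)) * of_real (exp (- (t\<^sup>2 * s) / 2))"
        unfolding cf by (simp add: S.scaleR s_def power2_eq_square mult_ac)
      finally have 1: "char (distr M borel ?A) t = \<dots>" .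
      have "char (distr ?N borel ?B) t = (CLINT z|?N. iexp (t * ?B z))"
        unfolding char_def by (subst integral_distr) auto
      also have "\<dots> = (CLINT z|?N. iexp (t * (h \<bullet> a)) * iexp (t * sqrt s * z))"
        by (simp add: exp_add[symmetric] algebra_simps)
      also have "\<dots> = iexp (t * (h \<bullet> a)) * char ?N (t * sqrt s)"
        unfolding char_def by (rule integral_mult_right_zero)
      also have "\<dots> = iexp (t * (h \<bullet> a)) * of_real (exp (- (t\<^sup>2 * s) / 2))"
        using s by (simp add: char_std_normal_distribution power_mult_distrib)
      finally show "char (distr M borel ?A) t = char (distr ?N borel ?B) t" using 1 by simp
    qed
  qed
  have I: "integrable M (\<lambda>x. f (h \<bullet> x)) \<longleftrightarrow> integrable ?N (\<lambda>z. f (?B z))"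
     and E: "(LINT x|M. f (h \<bullet> x)) = (LINT z|?N. f (?B z))"
    if [measurable]: "f \<in> borel_measurable borel" for f :: "real \<Rightarrow> real"
  proof -
    show "integrable M (\<lambda>x. f (h \<bullet> x)) \<longleftrightarrow> integrable ?N (\<lambda>z. f (?B z))"
      using integrable_distr_eq[of ?A M borel f] integrable_distr_eq[of ?B ?N borel f] eq by simp
    show "(LINT x|M. f (h \<bullet> x)) = (LINT z|?N. f (?B z))"
      using integral_distr[of ?A M borel f] integral_distr[of ?B ?N borel f] eq by simp
  qed
  have m1: "integrable ?N (\<lambda>z. z)" using integrable_std_normal_distribution_moment[of 1] by simp
  have m1': "(LINT z|?N. z) = 0" using integral_std_normal_distribution_moment_odd[of 1] by simp
  have m2: "integrable ?N (\<lambda>z. z\<^sup>2)" by (rule integrable_std_normal_distribution_moment)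
  have m2': "(LINT z|?N. z\<^sup>2) = 1" using std_normal_distribution_even_moments(1)[of 1] by simp
  have mid: "(\<lambda>y::real. y) \<in> borel_measurable borel" by measurable
  show "integrable M (\<lambda>x. h \<bullet> x)"
    unfolding I[OF mid] by (intro Bochner_Integration.integrable_add integrable_mult_right m1) simp
  show "(LINT x|M. h \<bullet> x) = h \<bullet> a"
    unfolding E[OF mid] using m1 by (subst Bochner_Integration.integral_add) (auto simp: m1' N.prob_space[simplified])
  have B2: "(\<lambda>z. (?B z - h \<bullet> a)\<^sup>2) = (\<lambda>z. s * z\<^sup>2)"
    using s by (simp add: power_mult_distrib fun_eq_iff)
  have meas: "(\<lambda>y::real. (y - h \<bullet> a)\<^sup>2) \<in> borel_measurable borel" by measurable
  show "integrable M (\<lambda>x. (h \<bullet> x - h \<bullet> a)\<^sup>2)"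
    unfolding I[OF meas] B2 by (intro integrable_mult_right m2)
  show "(LINT x|M. (h \<bullet> x - h \<bullet> a)\<^sup>2) = h \<bullet> S h"
    unfolding E[OF meas] B2 by (simp add: m2' s_def)
qed

text \<open>Variances in all directions determine the covariances by polarisation.\<close>

theorem gaussian_cf_has_covariance:
  fixes M :: "'a::{real_inner, polish_space} measure"
  assumes G: "gaussian_cf M 1 a S" and S: "positive_semidefinite S"
  shows "has_covariance M S"
proof -
  note P = gaussian_cf_projection[OF G S]
  note DS = positive_semidefiniteD[OF S]
  interpret S: bounded_linear S by (rule DS)
  have [measurable_cong]: "sets M = sets borel" using G by (simp add: gaussian_cf_def)
  interpret prob_space M by (rule P)
  have sq: "integrable M (\<lambda>x. (h \<bullet> x)\<^sup>2)" for h
  proof -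
    have "integrable M (\<lambda>x. (h \<bullet> x - h \<bullet> a)\<^sup>2 + 2 * (h \<bullet> a) * (h \<bullet> x) - (h \<bullet> a)\<^sup>2)"
      by (intro Bochner_Integration.integrable_add Bochner_Integration.integrable_diff P integrable_mult_right) auto
    then show ?thesis by (simp add: power2_diff)
  qed
  have cov: "(LINT x|M. (h \<bullet> x - h \<bullet> a) * (k \<bullet> x - k \<bullet> a)) = h \<bullet> S k" for h k
  proof -
    have "(LINT x|M. (h \<bullet> x - h \<bullet> a) * (k \<bullet> x - k \<bullet> a)) =
       (LINT x|M. (1/4) * ((((h + k) \<bullet> x - (h + k) \<bullet> a)\<^sup>2) - (((h - k) \<bullet> x - (h - k) \<bullet> a)\<^sup>2)))"
      by (intro Bochner_Integration.integral_cong refl)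
        (simp add: power2_eq_square inner_add_left inner_diff_left algebra_simps)
    also have "\<dots> = (1/4) * ((h + k) \<bullet> S (h + k) - (h - k) \<bullet> S (h - k))"
      using P(4,5) by simp
    also have "\<dots> = h \<bullet> S k"
      using DS(2)[of k h] by (simp add: S.add S.diff inner_add inner_diff inner_commute)
    finally show ?thesis .
  qed
  show ?thesis unfolding has_covariance_def P(3) cov
    using P(1) sq DS(1) \<open>sets M = sets borel\<close> by simp
qed

section \<open>Optimal designs\<close>

lemma orthonormal_basis_zero:
  assumes "orthonormal_basis B" "\<And>b. b \<in> B \<Longrightarrow> x \<bullet> b = 0"
  shows "x = 0"
proof -
  have "x \<bullet> x = 0" using orthogonal_closure_span[of B x x] assms by (auto simp: orthonormal_basis_iff)
  then show ?thesis by simp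
qed

lemma information_in_span: "information v g J x \<in> span (g ` J)"
  unfolding information_def by (intro span_scale span_sum span_base) auto

text \<open>The eigenvectors with nonzero eigenvalue lie in the span of the \<open>CARD('m)\<close> measurement vectors,
  and together they span the range: a vector \<open>W x\<close> is orthogonal to the kernel, hence equal to its
  Fourier sum over them.\<close>

lemma information_eigenbasis:
  fixes g :: "'m::finite \<Rightarrow> 'a::real_inner"
  assumes v: "v > 0" and B: "orthonormal_basis B"
    and eig: "\<And>b. b \<in> B \<Longrightarrow> information v g UNIV b = w b *\<^sub>R b"
  shows "finite {b\<in>B. w b \<noteq> 0}" "card {b\<in>B. w b \<noteq> 0} \<le> CARD('m)"
    "range (information v g UNIV) = span {b\<in>B. w b \<noteq> 0}"
proof -
  let ?W = "information v g UNIV" and ?I = "{b\<in>B. w b \<noteq> 0}"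
  note W = positive_semidefiniteD[OF information_psd[OF v, of g UNIV]]
  interpret W: bounded_linear ?W by (rule W)
  have oI: "orthonormal ?I" using B by (auto simp: orthonormal_basis_iff intro: orthonormal_subset)
  have bW: "b \<in> range ?W" if "b \<in> ?I" for b
  proof (rule range_eqI)
    show "b = ?W ((1 / w b) *\<^sub>R b)" using that eig[of b] by (simp add: W.scaleR)
  qed
  then have "?I \<subseteq> span (range g)" using information_in_span[of v g UNIV] by auto
  from independent_span_bound[OF _ orthonormal_independent[OF oI] this]
  have fc: "finite ?I" "card ?I \<le> card (range g)" by auto
  then show "finite ?I" "card ?I \<le> CARD('m)" using card_image_le[of UNIV g] by auto
  show "range ?W = span ?I"
  proof
    show "span ?I \<subseteq> range ?W"
      using bW by (intro span_minimal linear_subspace_image) (auto simp: W.linear_axioms)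
    show "range ?W \<subseteq> span ?I"
    proof safe
      fix x
      let ?y = "?W x" and ?s = "\<Sum>b\<in>?I. (?W x \<bullet> b) *\<^sub>R b"
      have "(?y - ?s) \<bullet> b = 0" if b: "b \<in> B" for b
      proof (cases "w b = 0")
        case False
        then show ?thesis using b by (intro residual_orthogonal_span[OF oI fc(1)] span_base) auto
      next
        case True
        then have "?W b = 0" using eig[OF b] by simp
        then have "?y \<bullet> b = 0" using W(2)[of x b] by simp
        moreover have "?s \<bullet> b = 0" unfolding inner_sum_left
        proof (rule sum.neutral, rule ballI)
          fix c assume c: "c \<in> ?I"
          then have "c \<noteq> b" using True by auto
          then show "(?W x \<bullet> c) *\<^sub>R c \<bullet> b = 0"
            using c b B orthonormal_inner[of B c b] by (auto simp: orthonormal_basis_iff)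
        qed
        ultimately show ?thesis by (simp add: inner_diff_left)
      qed
      then have "?y - ?s = 0" by (rule orthonormal_basis_zero[OF B])
      then have "?y = ?s" by simp
      also have "?s \<in> span ?I" by (intro span_sum span_scale span_base)
      finally show "?y \<in> span ?I" .
    qed
  qed
qed

text \<open>Parseval's identity for each of the measurement vectors.\<close>

lemma information_trace:
  fixes g :: "'m::finite \<Rightarrow> 'a::real_inner"
  assumes "orthonormal_basis B" "\<And>j. norm (g j) = 1"
  shows "((\<lambda>b. information v g UNIV b \<bullet> b) has_sum (CARD('m) / v)) B"
proof -
  have "((\<lambda>b. \<Sum>j\<in>UNIV. (g j \<bullet> b)\<^sup>2) has_sum (\<Sum>j\<in>UNIV. (norm (g j))\<^sup>2)) B"
  proof -
    have "((\<lambda>b. \<Sum>j\<in>J. (g j \<bullet> b)\<^sup>2) has_sum (\<Sum>j\<in>J. (norm (g j))\<^sup>2)) B" if "finite J" for J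
      using that by induction (auto intro!: has_sum_add orthonormal_basis_Parseval assms)
    then show ?thesis by simp
  qed
  then have "((\<lambda>b. (1/v) * (\<Sum>j\<in>UNIV. (g j \<bullet> b)\<^sup>2)) has_sum ((1/v) * (\<Sum>j\<in>UNIV. (norm (g j))\<^sup>2))) B"
    by (rule has_sum_cmult_right)
  then show ?thesis by (simp add: information_inner_self assms(2))
qed

text \<open>In the application \<open>K\<close> is the forward operator composed with the square root of the prior
  covariance, \<open>K'\<close> its adjoint and \<open>v\<close> the noise variance, so that \<open>K \<circ> K'\<close> is the prior
  covariance in the observation space.\<close>

locale bayes_design =
  fixes K :: "'p::real_inner \<Rightarrow> 'o::{real_inner, complete_space}" and K' :: "'o \<Rightarrow> 'p" and v :: real
  assumes K: "bounded_linear K" and K': "bounded_linear K'"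
    and adj: "\<And>x y. K x \<bullet> y = x \<bullet> K' y"
    and v: "v > 0"
    and inj: "\<And>y. K (K' y) = 0 \<Longrightarrow> y = 0"
    and compact: "compact_operator (\<lambda>y. K (K' y))"
begin

abbreviation C :: "'o \<Rightarrow> 'o" where "C \<equiv> (\<lambda>y. K (K' y))"

sublocale K: bounded_linear K by (rule K)
sublocale K': bounded_linear K' by (rule K')

lemma C_inner: "C x \<bullet> y = K' x \<bullet> K' y"
  by (rule adj)

lemma C_psd: "positive_semidefinite C"
  using bounded_linear_compose[OF K K'] C_inner
  by (auto simp: positive_semidefinite_def self_adjoint_def inner_commute)

lemma C_pos: "y \<noteq> 0 \<Longrightarrow> C y \<bullet> y > 0"
  using inj[of y] psd_kernel[OF C_psd, of y] positive_semidefiniteD(3)[OF C_psd, of y]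
  by (metis less_eq_real_def)

lemma det_gram:
  fixes g :: "'m::finite \<Rightarrow> 'o"
  shows "det_one_plus (\<lambda>x. K' (information v g UNIV (K x))) = det (gram v C g)"
    and "det (gram v C g) \<ge> 1"
proof -
  define X where "X x = (\<chi> j. (1 / sqrt v) * (g j \<bullet> K x))" for x
  define Y where "Y y = (1 / sqrt v) *\<^sub>R K' (\<Sum>j\<in>UNIV. (y $ j) *\<^sub>R g j)" for y :: "real^'m"
  have X: "linear X"
    by (rule linearI) (simp_all add: X_def vec_eq_iff K.add K.scaleR inner_add_right distrib_left)
  have Y: "linear Y"
    by (rule linearI) (simp_all add: Y_def K'.add K'.sum K'.scaleR scaleR_left_distrib sum.distrib
       scaleR_right_distrib scaleR_sum_right mult_ac)
  have XY: "X x \<bullet> y = x \<bullet> Y y" for x y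
    by (simp add: X_def Y_def inner_vec_def adj[symmetric] inner_sum_right sum_distrib_left inner_commute mult_ac)
  have YX: "Y (X x) = K' (information v g UNIV (K x))" for x
  proof -
    have "Y (X x) = K' ((1 / sqrt v) *\<^sub>R (\<Sum>j\<in>UNIV. ((1 / sqrt v) * (g j \<bullet> K x)) *\<^sub>R g j))"
      by (simp add: X_def Y_def K'.scaleR)
    also have "(1 / sqrt v) *\<^sub>R (\<Sum>j\<in>UNIV. ((1 / sqrt v) * (g j \<bullet> K x)) *\<^sub>R g j) =
        information v g UNIV (K x)"
      using v by (simp add: information_def scaleR_sum_right)
    finally show ?thesis .
  qed
  have "matrix (\<lambda>y. y + X (Y y)) = gram v C g"
  proof -
    have "X (Y (axis b 1)) $ a = (1 / v) * (C (g a) \<bullet> g b)" for a b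
    proof -
      have "(\<Sum>j\<in>UNIV. (axis b 1 $ j) *\<^sub>R g j) = g b"
        by (subst sum.mono_neutral_right[of UNIV "{b}"]) (auto simp: axis_def)
      then show ?thesis using v
        by (simp add: X_def Y_def K.scaleR positive_semidefiniteD(2)[OF C_psd, of "g a" "g b"])
    qed
    then show ?thesis by (simp add: matrix_def gram_def vec_eq_iff axis_def)
  qed
  with det_one_plus_compose[OF X Y XY]
  show "det_one_plus (\<lambda>x. K' (information v g UNIV (K x))) = det (gram v C g)" "det (gram v C g) \<ge> 1"
    by (simp_all add: YX)
qed

text \<open>Applying \<open>K'\<close> to common eigenvectors of \<open>C\<close> and the information operator gives orthogonal
  eigenvectors of \<open>K' W K\<close>.\<close>

lemma det_gram_eigenbasis:
  fixes g :: "'m::finite \<Rightarrow> 'o"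
  assumes B: "orthonormal_basis B"
    and C: "\<And>b. b \<in> B \<Longrightarrow> C b = l b *\<^sub>R b"
    and W: "\<And>b. b \<in> B \<Longrightarrow> information v g UNIV b = w b *\<^sub>R b"
  shows "det (gram v C g) = (\<Prod>b\<in>{b\<in>B. w b \<noteq> 0}. 1 + l b * w b)"
proof -
  let ?I = "{b\<in>B. w b \<noteq> 0}" and ?W = "information v g UNIV"
  note I = information_eigenbasis[OF v B W]
  have oB: "orthonormal B" using B by (simp add: orthonormal_basis_iff)
  interpret W: bounded_linear ?W by (rule positive_semidefiniteD(1)[OF information_psd[OF v]])
  have KK: "K' b \<bullet> K' c = (if b = c then l b else 0)" if "b \<in> B" "c \<in> B" for b c
    using orthonormal_inner[OF oB that] C[OF that(1)] by (simp add: C_inner[symmetric])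
  have l0: "l b > 0" if "b \<in> B" for b
  proof -
    have "b \<bullet> b = 1" using orthonormal_inner[OF oB that that] by simp
    then have "b \<noteq> 0" by auto
    then show ?thesis using C_pos[of b] C[OF that] \<open>b \<bullet> b = 1\<close> by simp
  qed
  have "det_one_plus (\<lambda>x. K' (?W (K x))) = (\<Prod>b\<in>?I. 1 + l b * w b)"
  proof (rule det_one_plus_orthogonal_eigenvectors[where u=K'])
    show "linear (\<lambda>x. K' (?W (K x)))"
      by (rule linearI) (simp_all add: K.add K.scaleR K'.add K'.scaleR W.add W.scaleR)
    show "K' b \<noteq> 0" if "b \<in> ?I" for b using KK[of b b] l0[of b] that by auto
    show "K' (?W (K (K' b))) = (l b * w b) *\<^sub>R K' b" if "b \<in> ?I" for b
      using that C[of b] W[of b] by (simp add: W.scaleR K'.scaleR)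
    show "l b * w b \<noteq> 0" if "b \<in> ?I" for b using that l0[of b] by auto
    have "range (\<lambda>x. K' (?W (K x))) \<subseteq> K' ` span ?I" using I(3) by auto
    also have "\<dots> = span (K' ` ?I)" using linear_span_image[OF K'.linear] by blast
    finally show "range (\<lambda>x. K' (?W (K x))) \<subseteq> span (K' ` ?I)" .
  qed (use KK I(1) in auto)
  then show ?thesis using det_gram(1)[of g] by simp
qed

definition optimal_design :: "('m::finite \<Rightarrow> 'o) \<Rightarrow> bool" where
  "optimal_design g \<longleftrightarrow> (\<forall>j. norm (g j) = 1) \<and>
     (\<forall>h :: 'm \<Rightarrow> 'o. (\<forall>j. norm (h j) = 1) \<longrightarrow> det (gram v C h) \<le> det (gram v C g))"

text \<open>Varying only measurement \<open>j\<close>, optimality says that \<open>g j\<close> maximises the quadratic form of \<open>S\<close>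
  on the unit sphere.\<close>

lemma optimal_eigenvector_without:
  fixes g :: "'m::finite \<Rightarrow> 'o"
  assumes g: "optimal_design g" and S: "posterior_covariance C (information v g (UNIV - {j})) S"
  shows "S (g j) = (S (g j) \<bullet> g j) *\<^sub>R g j"
proof -
  have Spsd: "positive_semidefinite S" using S by (simp add: posterior_covariance_def)
  note DS = positive_semidefiniteD[OF Spsd]
  interpret S: bounded_linear S by (rule DS)
  define s where "s = S (g j) \<bullet> g j"
  have ng: "norm (g i) = 1" for i using g by (auto simp: optimal_design_def)
  have le: "S p \<bullet> p \<le> s" if p: "norm p = 1" for p
  proof -
    have "det (gram v C (g(j := p))) \<le> det (gram v C g)"
      using g p by (auto simp: optimal_design_def)
    also have "\<dots> = det (gram v C (g(j := g j)))" by simp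
    finally have "(1 + (1/v) * (S p \<bullet> p)) * det (gram v C (g(j := 0))) \<le> (1 + (1/v) * s) * det (gram v C (g(j := 0)))"
      using det_gram_update[OF C_psd v S, of p] det_gram_update[OF C_psd v S, of "g j"] by (simp only: s_def)
    moreover have "det (gram v C (g(j := 0))) > 0" using det_gram(2)[of "g(j := 0)"] by linarith
    ultimately have "1 + (1/v) * (S p \<bullet> p) \<le> 1 + (1/v) * s" by (rule mult_right_le_imp_le)
    then show ?thesis using v by (simp add: divide_le_cancel)
  qed
  let ?Q = "\<lambda>x. s *\<^sub>R x - S x"
  have "0 \<le> ?Q x \<bullet> x" for x
  proof (cases "x = 0")
    case False
    have "S ((1 / norm x) *\<^sub>R x) \<bullet> ((1 / norm x) *\<^sub>R x) \<le> s" by (rule le) (use False in simp)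
    then have "S x \<bullet> x \<le> s * (norm x)\<^sup>2" using False by (simp add: S.scaleR field_simps power2_eq_square)
    then show ?thesis by (simp add: inner_diff_left power2_norm_eq_inner)
  qed simp
  moreover have "bounded_linear ?Q" by (intro bounded_linear_sub bounded_linear_scaleR_right DS)
  moreover have "?Q x \<bullet> y = x \<bullet> ?Q y" for x y by (simp add: inner_diff DS(2))
  ultimately have Q: "positive_semidefinite ?Q" by (auto simp: positive_semidefinite_def self_adjoint_def)
  have "?Q (g j) \<bullet> g j = 0" using ng[of j] by (simp add: inner_diff_left s_def norm_eq_1)
  from psd_kernel[OF Q this] show ?thesis by (simp add: s_def)
qed

text \<open>The rank one update along an eigenvector keeps it an eigenvector.\<close>

lemma optimal_eigenvector:
  fixes g :: "'m::finite \<Rightarrow> 'o"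
  assumes g: "optimal_design g" and S: "posterior_covariance C (information v g UNIV) S"
  shows "\<exists>\<tau>. S (g j) = \<tau> *\<^sub>R g j"
proof -
  obtain S0 where S0: "posterior_covariance C (information v g (UNIV - {j})) S0"
    using posterior_covariance_exists[OF C_psd v, of "UNIV - {j}" g] by auto
  let ?S = "\<lambda>x. S0 x - ((S0 (g j) \<bullet> x) / (v + S0 (g j) \<bullet> g j)) *\<^sub>R S0 (g j)"
  have "posterior_covariance C (information v g UNIV) ?S"
    using posterior_covariance_update[OF C_psd S0 v information_insert[of "UNIV - {j}" j v g]]
    by (simp add: insert_absorb)
  then have "S = ?S" by (rule posterior_covariance_unique[OF C_psd information_psd[OF v] S])
  moreover have "S0 (g j) = (S0 (g j) \<bullet> g j) *\<^sub>R g j" by (rule optimal_eigenvector_without[OF g S0])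
  then obtain s where "S0 (g j) = s *\<^sub>R g j" by blast
  ultimately have "S (g j) = (s - (s *\<^sub>R g j \<bullet> g j) / (v + s *\<^sub>R g j \<bullet> g j) * s) *\<^sub>R g j"
    by (simp add: scaleR_left_diff_distrib)
  then show ?thesis by blast
qed

text \<open>Measurement vectors \<open>g i\<close>, \<open>g j\<close> with different eigenvalues of \<open>S\<close> would be orthogonal.
  Replacing them by the unit vectors \<open>(g i + g j) / sqrt 2\<close> and \<open>(g i - g j) / sqrt 2\<close> leaves the
  information operator and therefore the criterion and \<open>S\<close> unchanged.  The new design is thus
  optimal as well, and \<open>g i + g j\<close> would have to be an eigenvector of \<open>S\<close>, which it is not.\<close>

lemma optimal_scalar:
  fixes g :: "'m::finite \<Rightarrow> 'o"
  assumes g: "optimal_design g" and S: "posterior_covariance C (information v g UNIV) S"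
  shows "\<exists>\<tau>>0. \<forall>j. S (g j) = \<tau> *\<^sub>R g j"
proof -
  have Spsd: "positive_semidefinite S" and S2: "\<And>x. S x + C (information v g UNIV (S x)) = C x"
    using S by (auto simp: posterior_covariance_def)
  note DS = positive_semidefiniteD[OF Spsd]
  interpret S: bounded_linear S by (rule DS)
  have ng: "norm (g j) = 1" "g j \<bullet> g j = 1" for j using g by (auto simp: optimal_design_def norm_eq_1)
  obtain \<tau> where \<tau>: "\<And>j. S (g j) = \<tau> j *\<^sub>R g j" using optimal_eigenvector[OF g S] by metis
  have same: "\<tau> i = \<tau> j" for i j
  proof (rule ccontr)
    assume ne: "\<tau> i \<noteq> \<tau> j"
    then have ij: "i \<noteq> j" by auto
    have "\<tau> i * (g i \<bullet> g j) = \<tau> j * (g i \<bullet> g j)" using DS(2)[of "g i" "g j"] by (simp add: \<tau>)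
    then have orth: "g i \<bullet> g j = 0" "g j \<bullet> g i = 0" using ne by (auto simp: inner_commute)
    let ?r = "1 / sqrt 2 :: real"
    define h where "h = g(i := ?r *\<^sub>R (g i + g j), j := ?r *\<^sub>R (g i - g j))"
    have r: "?r * ?r = 1/2" by simp
    have hi: "h i = ?r *\<^sub>R (g i + g j)" "h j = ?r *\<^sub>R (g i - g j)" using ij by (auto simp: h_def)
    have "norm (h a) = 1" for a
    proof -
      have "h i \<bullet> h i = (?r * ?r) * ((g i + g j) \<bullet> (g i + g j))" unfolding hi by simp
      then have "h i \<bullet> h i = 1" unfolding r by (simp add: inner_add orth ng)
      moreover have "h j \<bullet> h j = (?r * ?r) * ((g i - g j) \<bullet> (g i - g j))" unfolding hi by simp
      then have "h j \<bullet> h j = 1" unfolding r by (simp add: inner_diff orth ng)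
      ultimately show ?thesis by (cases "a = i \<or> a = j") (auto simp: norm_eq_1 h_def ng)
    qed
    moreover have W: "information v h UNIV = information v g UNIV"
    proof
      fix x
      have sc: "((?r *\<^sub>R u) \<bullet> x) *\<^sub>R (?r *\<^sub>R u) = (?r * ?r) *\<^sub>R ((u \<bullet> x) *\<^sub>R u)" for u :: 'o
        by (simp only: inner_scaleR_left scaleR_scaleR mult_ac)
      have "(h i \<bullet> x) *\<^sub>R h i + (h j \<bullet> x) *\<^sub>R h j =
          (?r * ?r) *\<^sub>R (((g i + g j) \<bullet> x) *\<^sub>R (g i + g j) + ((g i - g j) \<bullet> x) *\<^sub>R (g i - g j))"
        unfolding hi sc scaleR_right_distrib[of "?r * ?r"] ..
      also have "\<dots> = (?r * ?r * 2) *\<^sub>R ((g i \<bullet> x) *\<^sub>R g i + (g j \<bullet> x) *\<^sub>R g j)"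
        unfolding scaleR_scaleR[symmetric] by (simp add: inner_add_left inner_diff_left algebra_simps scaleR_2[symmetric])
      also have "?r * ?r * 2 = 1" by simp
      finally have e: "(h i \<bullet> x) *\<^sub>R h i + (h j \<bullet> x) *\<^sub>R h j = (g i \<bullet> x) *\<^sub>R g i + (g j \<bullet> x) *\<^sub>R g j" by simp
      have "(\<Sum>a\<in>UNIV. (f a \<bullet> x) *\<^sub>R f a) =
          ((f i \<bullet> x) *\<^sub>R f i + (f j \<bullet> x) *\<^sub>R f j) + (\<Sum>a\<in>UNIV - {i, j}. (f a \<bullet> x) *\<^sub>R f a)" for f :: "'m \<Rightarrow> 'o"
        using ij by (subst sum.subset_diff[of "{i, j}" UNIV]) auto
      note sp = this
      have "(\<Sum>a\<in>UNIV - {i, j}. (h a \<bullet> x) *\<^sub>R h a) = (\<Sum>a\<in>UNIV - {i, j}. (g a \<bullet> x) *\<^sub>R g a)"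
        by (rule sum.cong) (auto simp: h_def)
      then have "(\<Sum>a\<in>UNIV. (h a \<bullet> x) *\<^sub>R h a) = (\<Sum>a\<in>UNIV. (g a \<bullet> x) *\<^sub>R g a)"
        unfolding sp[of h] sp[of g] e by simp
      then show "information v h UNIV x = information v g UNIV x" by (simp add: information_def)
    qed
    moreover have "det (gram v C h) = det (gram v C g)"
      using det_gram(1)[of h] det_gram(1)[of g] W by simp
    ultimately have "optimal_design h" using g by (simp add: optimal_design_def)
    from optimal_eigenvector[OF this, of S i] S W obtain t where "S (h i) = t *\<^sub>R h i" by auto
    then have "?r *\<^sub>R (\<tau> i *\<^sub>R g i + \<tau> j *\<^sub>R g j) = ?r *\<^sub>R (t *\<^sub>R (g i + g j))"
      unfolding hi by (simp only: S.scaleR S.add \<tau> scaleR_left_commute[of t])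
    then have e: "\<tau> i *\<^sub>R g i + \<tau> j *\<^sub>R g j = t *\<^sub>R (g i + g j)"
      by (rule real_vector.scale_left_imp_eq[rotated]) simp
    have "\<tau> i = t" using arg_cong[OF e, of "\<lambda>x. x \<bullet> g i"] by (simp add: inner_add_left orth ng)
    moreover have "\<tau> j = t" using arg_cong[OF e, of "\<lambda>x. x \<bullet> g j"] by (simp add: inner_add_left orth ng)
    ultimately show False using ne by simp
  qed
  fix j0 :: 'm
  have "\<tau> j0 \<ge> 0" using DS(3)[of "g j0"] by (simp add: \<tau> ng)
  moreover have "\<tau> j0 \<noteq> 0"
  proof
    assume "\<tau> j0 = 0"
    then have "S (g j0) = 0" by (simp add: \<tau>)
    then have "C (g j0) = 0" using S2[of "g j0"]
      by (simp add: information_def K'.zero K.zero)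
    then show False using inj ng(1)[of j0] by force
  qed
  ultimately show ?thesis using \<tau> same by (intro exI[of _ "\<tau> j0"]) (metis less_eq_real_def)
qed

lemma scalar_on_information:
  fixes g :: "'m::finite \<Rightarrow> 'o"
  assumes S: "posterior_covariance C (information v g UNIV) S" and \<tau>: "\<And>j. S (g j) = \<tau> *\<^sub>R g j"
  shows "S (information v g UNIV x) = \<tau> *\<^sub>R information v g UNIV x"
    "information v g UNIV (S x) = \<tau> *\<^sub>R information v g UNIV x"
proof -
  have Spsd: "positive_semidefinite S" using S by (simp add: posterior_covariance_def)
  note DS = positive_semidefiniteD[OF Spsd]
  interpret S: bounded_linear S by (rule DS)
  show "S (information v g UNIV x) = \<tau> *\<^sub>R information v g UNIV x"
    by (simp add: information_def S.scaleR S.sum \<tau> scaleR_sum_right mult_ac)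
  show "information v g UNIV (S x) = \<tau> *\<^sub>R information v g UNIV x"
    by (simp add: information_def DS(2)[symmetric] \<tau> scaleR_sum_right mult_ac)
qed

text \<open>As \<open>S\<close> is the scalar \<open>\<tau>\<close> on the range of the information operator \<open>W\<close>, the two equations that
  define \<open>S\<close> read \<open>\<tau> W C = C - S = \<tau> C W\<close>.\<close>

lemma optimal_commute:
  fixes g :: "'m::finite \<Rightarrow> 'o"
  assumes S: "posterior_covariance C (information v g UNIV) S"
    and \<tau>: "\<tau> > 0" "\<And>j. S (g j) = \<tau> *\<^sub>R g j"
  shows "C (information v g UNIV x) = information v g UNIV (C x)"
proof -
  note sc = scalar_on_information[OF S \<tau>(2)]
  have "S x + S (information v g UNIV (C x)) = C x" "S x + C (information v g UNIV (S x)) = C x"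
    using S by (auto simp: posterior_covariance_def)
  then have "\<tau> *\<^sub>R information v g UNIV (C x) = \<tau> *\<^sub>R C (information v g UNIV x)"
    unfolding sc by (metis K'.scaleR K.scaleR add_left_cancel)
  then show ?thesis using \<tau>(1) by simp
qed

text \<open>If a measured eigenvector \<open>b\<close> had a smaller prior eigenvalue than an unmeasured eigenvector \<open>c\<close>,
  exchanging the roles of \<open>b\<close> and \<open>c\<close> in all measurement vectors would keep them unit vectors and
  would increase one factor of the determinant.\<close>

lemma optimal_eigenvalues_dominate:
  fixes g :: "'m::finite \<Rightarrow> 'o"
  assumes g: "optimal_design g" and B: "orthonormal_basis B"
    and Cb: "\<And>b. b \<in> B \<Longrightarrow> C b = l b *\<^sub>R b"
    and Wb: "\<And>b. b \<in> B \<Longrightarrow> information v g UNIV b = w b *\<^sub>R b"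
    and b: "b \<in> B" "w b \<noteq> 0" and c: "c \<in> B" "w c = 0"
  shows "l c \<le> l b"
proof (rule ccontr)
  assume "\<not> l c \<le> l b"
  then have lt: "l b < l c" by simp
  let ?W = "information v g UNIV"
  note DW = positive_semidefiniteD[OF information_psd[OF v, of g UNIV]]
  have oB: "orthonormal B" using B by (simp add: orthonormal_basis_iff)
  note on = orthonormal_inner[OF oB]
  have bc: "b \<noteq> c" using b c by auto
  have gc: "g j \<bullet> c = 0" for j
  proof -
    have "?W c \<bullet> c = 0" using Wb[OF c(1)] c(2) by simp
    then have "(1/v) * (\<Sum>j\<in>UNIV. (g j \<bullet> c)\<^sup>2) = 0" by (simp only: information_inner_self)
    then have "(\<Sum>j\<in>UNIV. (g j \<bullet> c)\<^sup>2) = 0" using v by simp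
    then show ?thesis by (simp add: sum_nonneg_eq_0_iff)
  qed
  have lpos: "l e > 0" if "e \<in> B" for e
  proof -
    have "e \<bullet> e = 1" using on[OF that that] by simp
    then show ?thesis using C_pos[of e] Cb[OF that] by fastforce
  qed
  have wb: "w b > 0"
    using DW(3)[of b] Wb[OF b(1)] on[OF b(1) b(1)] b(2) by simp
  \<comment> \<open>As \<open>g j\<close> is orthogonal to \<open>c\<close>, this is the reflection that swaps \<open>b\<close> and \<open>c\<close>, applied to \<open>g j\<close>.\<close>
  define h where "h j = g j + (g j \<bullet> b) *\<^sub>R (c - b)" for j
  have "norm (h j) = 1" for j
  proof -
    have "g j \<bullet> g j = 1" using g by (simp add: optimal_design_def norm_eq_1)
    then have "h j \<bullet> h j = 1"
      using on[OF b(1) b(1)] on[OF c(1) c(1)] on[OF b(1) c(1)] bc gc[of j]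
      by (simp add: h_def inner_add inner_diff inner_commute algebra_simps)
    then show ?thesis by (simp add: norm_eq_1)
  qed
  then have le: "det (gram v C h) \<le> det (gram v C g)" using g by (simp add: optimal_design_def)
  have hW: "information v h UNIV e = (1/v) *\<^sub>R (\<Sum>j\<in>UNIV. (h j \<bullet> e) *\<^sub>R g j)
       + ((1/v) * (\<Sum>j\<in>UNIV. (h j \<bullet> e) * (g j \<bullet> b))) *\<^sub>R (c - b)" for e
    by (simp add: information_def h_def[of "_ :: 'm"] scaleR_right_distrib sum.distrib scaleR_sum_left[symmetric]
         del: scaleR_diff_right inner_diff_right)
  have Wi: "?W x \<bullet> y = (1/v) * (\<Sum>j\<in>UNIV. (g j \<bullet> x) * (g j \<bullet> y))" for x y
    by (simp add: information_def inner_sum_left)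
  define w' where "w' = w(b := 0, c := w b)"
  have W': "information v h UNIV e = w' e *\<^sub>R e" if e: "e \<in> B" for e
  proof -
    consider "e = b" | "e = c" | "e \<noteq> b" "e \<noteq> c" by blast
    then show ?thesis
    proof cases
      case 1
      have "h j \<bullet> e = 0" for j
        using on[OF b(1) b(1)] on[OF c(1) b(1)] bc by (simp add: 1 h_def inner_add_left inner_diff_left)
      then show ?thesis using bc 1 by (simp add: information_def w'_def)
    next
      case 2
      have he: "h j \<bullet> e = g j \<bullet> b" for j
        using on[OF c(1) c(1)] on[OF b(1) c(1)] bc gc[of j] by (simp add: 2 h_def inner_add_left inner_diff_left)
      have "information v h UNIV e = ?W b + (?W b \<bullet> b) *\<^sub>R (c - b)"
        unfolding hW he Wi by (simp add: information_def)
      also have "\<dots> = w b *\<^sub>R c"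
        using Wb[OF b(1)] on[OF b(1) b(1)] by (simp add: algebra_simps)
      finally show ?thesis using 2 by (simp add: w'_def)
    next
      case 3
      have he: "h j \<bullet> e = g j \<bullet> e" for j
        using on[OF c(1) e] on[OF b(1) e] 3 by (simp add: h_def inner_add_left inner_diff_left)
      have "information v h UNIV e = ?W e + (?W e \<bullet> b) *\<^sub>R (c - b)"
        unfolding hW he Wi by (simp add: information_def)
      also have "?W e \<bullet> b = 0" using Wb[OF e] on[OF e b(1)] 3 by simp
      finally show ?thesis using 3 Wb[OF e] by (simp add: w'_def)
    qed
  qed
  let ?I = "{e\<in>B. w e \<noteq> 0}"
  have fI: "finite ?I" by (rule information_eigenbasis(1)[OF v B Wb])
  have I': "{e\<in>B. w' e \<noteq> 0} = insert c (?I - {b})" using b c bc by (auto simp: w'_def)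
  define P where "P = (\<Prod>e\<in>?I - {b}. 1 + l e * w e)"
  have "1 + l e * w e > 0" if "e \<in> B" for e
  proof -
    have "w e \<ge> 0" using DW(3)[of e] Wb[OF that] on[OF that that] by simp
    then show ?thesis using lpos[OF that] by (simp add: add_pos_nonneg)
  qed
  then have P: "P > 0" unfolding P_def by (intro prod_pos) auto
  have "det (gram v C h) = (\<Prod>e\<in>insert c (?I - {b}). 1 + l e * w' e)"
    using det_gram_eigenbasis[OF B Cb W'] unfolding I' .
  also have "\<dots> = (1 + l c * w' c) * (\<Prod>e\<in>?I - {b}. 1 + l e * w' e)"
    using fI c by (intro prod.insert) auto
  also have "(\<Prod>e\<in>?I - {b}. 1 + l e * w' e) = P"
    unfolding P_def using c by (intro prod.cong) (auto simp: w'_def)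
  finally have dh: "det (gram v C h) = (1 + l c * w b) * P" by (simp add: w'_def)
  have "det (gram v C g) = (1 + l b * w b) * P"
    unfolding P_def using det_gram_eigenbasis[OF B Cb Wb] prod.remove[OF fI, of b "\<lambda>e. 1 + l e * w e"] b by simp
  with dh le P have "l c * w b \<le> l b * w b" by simp
  then show False using lt wb by simp
qed

text \<open>On a common eigenvector with \<open>W b = w b\<close>, \<open>w \<noteq> 0\<close>, the operator \<open>S\<close> takes the value \<open>\<tau>\<close>, and
  the defining equation of \<open>S\<close> gives \<open>1 / \<tau> = 1 / l + w\<close>: the posterior precision is levelled out
  over all measured directions.\<close>

theorem optimal_design_structure:
  fixes g :: "'m::finite \<Rightarrow> 'o"
  assumes g: "optimal_design g" and S: "posterior_covariance C (information v g UNIV) S"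
  shows "\<exists>B l w \<tau>. orthonormal_basis B \<and> \<tau> > 0 \<and>
    (\<forall>b\<in>B. C b = l b *\<^sub>R b \<and> l b > 0) \<and>
    (\<forall>b\<in>B. information v g UNIV b = w b *\<^sub>R b \<and> (w b \<noteq> 0 \<longrightarrow> w b = 1 / \<tau> - 1 / l b)) \<and>
    (\<forall>b\<in>B. S b = (if w b = 0 then l b else \<tau>) *\<^sub>R b) \<and>
    (\<forall>b\<in>B. \<forall>c\<in>B. w b \<noteq> 0 \<longrightarrow> w c = 0 \<longrightarrow> l c \<le> l b) \<and>
    (\<Sum>b\<in>{b\<in>B. w b \<noteq> 0}. w b) = CARD('m) / v"
proof -
  let ?W = "information v g UNIV"
  note Wpsd = information_psd[OF v, of g UNIV]
  interpret W: bounded_linear ?W by (rule positive_semidefiniteD(1)[OF Wpsd])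
  have Spsd: "positive_semidefinite S" and S1: "\<And>x. S x + S (?W (C x)) = C x"
    using S by (auto simp: posterior_covariance_def)
  interpret S: bounded_linear S by (rule positive_semidefiniteD(1)[OF Spsd])
  obtain \<tau> where \<tau>: "\<tau> > 0" "\<And>j. S (g j) = \<tau> *\<^sub>R g j" using optimal_scalar[OF g S] by blast
  note sc = scalar_on_information[OF S \<tau>(2)]
  have "C (?W x) = ?W (C x)" for x by (rule optimal_commute[OF S \<tau>])
  then obtain B where B: "orthonormal_basis B"
    and Cb: "\<And>b. b \<in> B \<Longrightarrow> C b = (C b \<bullet> b) *\<^sub>R b" and Wb: "\<And>b. b \<in> B \<Longrightarrow> ?W b = (?W b \<bullet> b) *\<^sub>R b"
    using commuting_compact_psd_eigenbasis[OF C_psd compact Wpsd information_compact] by (metis finite_class.finite_UNIV)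
  define l where "l b = C b \<bullet> b" for b
  define w where "w b = ?W b \<bullet> b" for b
  have Cb': "C b = l b *\<^sub>R b" and Wb': "?W b = w b *\<^sub>R b" if "b \<in> B" for b
    using Cb[OF that] Wb[OF that] by (simp_all add: l_def w_def)
  have nb: "b \<bullet> b = 1" "b \<noteq> 0" if "b \<in> B" for b
    using B orthonormal_inner[of B b b] that by (auto simp: orthonormal_basis_iff)
  have lp: "l b > 0" if "b \<in> B" for b using C_pos[OF nb(2)[OF that]] by (simp add: l_def)
  have Sb: "S b = \<tau> *\<^sub>R b" if b: "b \<in> B" "w b \<noteq> 0" for b
  proof -
    have "w b *\<^sub>R S b = w b *\<^sub>R (\<tau> *\<^sub>R b)"
      using sc(1)[of b] Wb'[OF b(1)] by (simp add: S.scaleR)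
    then show ?thesis by (rule real_vector.scale_left_imp_eq[OF b(2)])
  qed
  have S1b: "S b + (l b * w b * \<tau>) *\<^sub>R b = l b *\<^sub>R b" if "b \<in> B" for b
    using S1[of b] unfolding sc(1) unfolding Cb'[OF that] W.scaleR Wb'[OF that] by (simp add: mult_ac)
  have S0: "S b = l b *\<^sub>R b" if "b \<in> B" "w b = 0" for b using S1b[OF that(1)] that(2) by simp
  have wt: "w b = 1 / \<tau> - 1 / l b" if b: "b \<in> B" "w b \<noteq> 0" for b
  proof -
    have "(\<tau> + l b * w b * \<tau>) *\<^sub>R b = l b *\<^sub>R b"
      using S1b[OF b(1)] Sb[OF b] by (simp add: scaleR_left_distrib)
    then have "\<tau> + l b * w b * \<tau> = l b" using nb(2)[OF b(1)] by simp
    then show ?thesis using lp[OF b(1)] \<tau>(1) by (simp add: field_simps)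
  qed
  have dom: "l c \<le> l b" if "b \<in> B" "w b \<noteq> 0" "c \<in> B" "w c = 0" for b c
    by (rule optimal_eigenvalues_dominate[OF g B Cb' Wb' that])
  have tr: "(\<Sum>b\<in>{b\<in>B. w b \<noteq> 0}. w b) = CARD('m) / v"
  proof -
    have "((\<lambda>b. w b) has_sum (CARD('m) / v)) B"
      unfolding w_def by (rule information_trace[OF B]) (use g in \<open>simp add: optimal_design_def\<close>)
    moreover have "((\<lambda>b. w b) has_sum (\<Sum>b\<in>{b\<in>B. w b \<noteq> 0}. w b)) B"
      by (rule has_sum_finite_neutralI[OF information_eigenbasis(1)[OF v B Wb']]) auto
    ultimately show ?thesis using has_sum_unique by blast
  qed
  show ?thesis
    using B \<tau>(1) Cb' Wb' lp Sb S0 wt dom tr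
    by (intro exI[of _ B] exI[of _ l] exI[of _ w] exI[of _ \<tau>] conjI ballI impI) (simp_all split: if_split)
qed

end

section \<open>Enumerating the eigenbasis\<close>

lemma initial_segment:
  fixes I :: "nat set"
  assumes "finite I" "n \<le> card I"
  shows "\<exists>A\<subseteq>I. card A = n \<and> (\<forall>i\<in>A. \<forall>j\<in>I - A. i < j)"
  using assms(2)
proof (induction n)
  case 0 show ?case by (intro exI[of _ "{}"]) auto
next
  case (Suc n)
  then obtain A where A: "A \<subseteq> I" "card A = n" "\<forall>i\<in>A. \<forall>j\<in>I - A. i < j" by auto
  have fA: "finite A" using A(1) assms(1) by (rule finite_subset)
  have "I - A \<noteq> {}"
  proof
    assume "I - A = {}"
    then have "I = A" using A(1) by auto
    then show False using A(2) Suc.prems by simp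
  qed
  define m where "m = Min (I - A)"
  have m: "m \<in> I - A" unfolding m_def by (rule Min_in) (use assms(1) \<open>I - A \<noteq> {}\<close> in auto)
  have "m < j" if "j \<in> I - insert m A" for j
  proof -
    have "m \<le> j" unfolding m_def by (rule Min_le) (use assms(1) that in auto)
    then show ?thesis using that by auto
  qed
  then show ?case using A m fA by (intro exI[of _ "insert m A"]) auto
qed

text \<open>Among indices that share an eigenvalue, the measured eigenvectors are listed first.\<close>

lemma bij_with_initial_part:
  fixes I :: "nat set" and A P :: "'b set"
  assumes I: "finite I" and A: "finite A" and card: "card I = card A"
  shows "\<exists>f. bij_betw f I A \<and> (\<forall>i\<in>I. \<forall>j\<in>I. f i \<in> P \<longrightarrow> f j \<notin> P \<longrightarrow> i < j)"
proof -
  have "card (A \<inter> P) \<le> card I" unfolding card by (rule card_mono) (use A in auto)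
  then obtain J where J: "J \<subseteq> I" "card J = card (A \<inter> P)" "\<forall>i\<in>J. \<forall>j\<in>I - J. i < j"
    using initial_segment[OF I] by blast
  have fJ: "finite J" using J(1) I by (rule finite_subset)
  have "card (I - J) = card I - card J" using J(1) fJ by (simp add: card_Diff_subset)
  moreover have "card (A - P) = card A - card (A \<inter> P)" using A by (simp add: card_Diff_subset_Int)
  ultimately have c2: "card (I - J) = card (A - P)" using J(2) card by simp
  obtain f1 where f1: "bij_betw f1 J (A \<inter> P)"
    using finite_same_card_bij[OF fJ _ J(2)] A by auto
  obtain f2 where f2: "bij_betw f2 (I - J) (A - P)"
    using finite_same_card_bij[OF _ _ c2] A I by auto
  define f where "f i = (if i \<in> J then f1 i else f2 i)" for i
  have b1: "bij_betw f J (A \<inter> P)" using f1 by (subst bij_betw_cong[of J f f1]) (auto simp: f_def)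
  have b2: "bij_betw f (I - J) (A - P)" using f2 by (subst bij_betw_cong[of "I - J" f f2]) (auto simp: f_def)
  have "bij_betw f (J \<union> (I - J)) ((A \<inter> P) \<union> (A - P))"
    by (rule bij_betw_combine[OF b1 b2]) auto
  moreover have "J \<union> (I - J) = I" "(A \<inter> P) \<union> (A - P) = A" using J(1) by auto
  ultimately have "bij_betw f I A" by simp
  moreover have "i < j" if "i \<in> I" "j \<in> I" "f i \<in> P" "f j \<notin> P" for i j
  proof -
    have "i \<in> J"
    proof (rule ccontr)
      assume "i \<notin> J"
      then have "f i \<in> A - P" using b2 that(1) by (auto simp: bij_betw_def)
      then show False using that(3) by simp
    qed
    moreover have "j \<notin> J"
    proof
      assume "j \<in> J"
      then have "f j \<in> A \<inter> P" using b1 by (auto simp: bij_betw_def)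
      then show False using that(4) by simp
    qed
    ultimately show ?thesis using J(3) that(2) by auto
  qed
  ultimately show ?thesis by blast
qed

lemma eigenspace_basis:
  fixes T :: "'a::real_inner \<Rightarrow> 'a"
  assumes B: "orthonormal_basis B" and T: "positive_semidefinite T"
    and eig: "\<And>b. b \<in> B \<Longrightarrow> T b = l b *\<^sub>R b" and fin: "finite {b\<in>B. l b = \<mu>}"
  shows "span {b\<in>B. l b = \<mu>} = eigenspace T \<mu>"
proof
  note D = positive_semidefiniteD[OF T]
  interpret bounded_linear T by (rule D)
  let ?A = "{b\<in>B. l b = \<mu>}"
  have oB: "orthonormal B" using B by (simp add: orthonormal_basis_iff)
  have oA: "orthonormal ?A" using oB by (rule orthonormal_subset) auto
  have "subspace (eigenspace T \<mu>)"
    by (auto simp: eigenspace_def subspace_def zero add scaleR scaleR_right_distrib)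
  then show "span ?A \<subseteq> eigenspace T \<mu>"
    by (intro span_minimal) (auto simp: eigenspace_def eig)
  show "eigenspace T \<mu> \<subseteq> span ?A"
  proof
    fix x assume "x \<in> eigenspace T \<mu>"
    then have x: "T x = \<mu> *\<^sub>R x" by (simp add: eigenspace_def)
    let ?s = "\<Sum>b\<in>?A. (x \<bullet> b) *\<^sub>R b"
    have "(x - ?s) \<bullet> b = 0" if b: "b \<in> B" for b
    proof (cases "l b = \<mu>")
      case True
      then show ?thesis using b by (intro residual_orthogonal_span[OF oA fin] span_base) auto
    next
      case False
      have "\<mu> * (x \<bullet> b) = l b * (x \<bullet> b)" using D(2)[of x b] x eig[OF b] by simp
      then have "x \<bullet> b = 0" using False by simp
      moreover have "?s \<bullet> b = 0" unfolding inner_sum_left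
      proof (rule sum.neutral, rule ballI)
        fix c assume c: "c \<in> ?A"
        then have "c \<noteq> b" using False by auto
        then show "(x \<bullet> c) *\<^sub>R c \<bullet> b = 0" using c b orthonormal_inner[OF oB, of c b] by simp
      qed
      ultimately show ?thesis by (simp add: inner_diff_left)
    qed
    then have "x - ?s = 0" by (rule orthonormal_basis_zero[OF B])
    then have "x = ?s" by simp
    also have "?s \<in> span ?A" by (intro span_sum span_scale span_base)
    finally show "x \<in> span ?A" .
  qed
qed

text \<open>For each eigenvalue, the number of indices equals the dimension of the eigenspace, which is the
  number of basis vectors in it; so basis vectors can be matched with indices eigenvalue by eigenvalue.
  By \<open>dom\<close>, and with the members of \<open>P\<close> listed first in each eigenspace, the indices of \<open>P\<close>
  precede all others and hence are exactly those below \<open>card P\<close>.\<close>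

theorem eigenbasis_enumeration:
  fixes T :: "'a::real_inner \<Rightarrow> 'a"
  assumes B: "orthonormal_basis B" and T: "positive_semidefinite T" "compact_operator T"
    and eig: "\<And>b. b \<in> B \<Longrightarrow> T b = l b *\<^sub>R b" and pos: "\<And>b. b \<in> B \<Longrightarrow> l b > 0"
    and lam: "decreasing_eigenvalues N T lam"
    and P: "P \<subseteq> B" "finite P"
    and dom: "\<And>b c. b \<in> P \<Longrightarrow> c \<in> B - P \<Longrightarrow> l c \<le> l b"
  shows "\<exists>e. bij_betw e N B \<and> (\<forall>i\<in>N. l (e i) = lam i) \<and> bij_betw e {..<card P} P \<and>
    {..<card P} \<subseteq> N \<and> (\<forall>i\<in>N. e i \<in> P \<longleftrightarrow> i < card P)"
proof -
  have oB: "orthonormal B" using B by (simp add: orthonormal_basis_iff)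
  have N: "N = UNIV \<or> (\<exists>n. N = {..<n})" "antimono_on N lam"
    and lam': "\<And>\<mu>. \<exists>A f. independent A \<and> span A = eigenspace T \<mu> \<and> bij_betw f {i\<in>N. lam i = \<mu>} A"
    using lam by (auto simp: decreasing_eigenvalues_def)
  define Q where "Q \<mu> f \<longleftrightarrow> bij_betw f {i\<in>N. lam i = \<mu>} {b\<in>B. l b = \<mu>} \<and>
      (\<forall>i\<in>{i\<in>N. lam i = \<mu>}. \<forall>j\<in>{i\<in>N. lam i = \<mu>}. f i \<in> P \<longrightarrow> f j \<notin> P \<longrightarrow> i < j)"
    for \<mu> and f :: "nat \<Rightarrow> 'a"
  have "\<exists>f. Q \<mu> f" for \<mu>
    unfolding Q_def
  proof (rule bij_with_initial_part)
    let ?A = "{b\<in>B. l b = \<mu>}"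
    have oA: "orthonormal ?A" using oB by (rule orthonormal_subset) auto
    show fA: "finite ?A"
    proof (cases "\<mu> = 0")
      case True
      then have "?A = {}" using pos by force
      then show ?thesis by (simp only: finite.emptyI)
    next
      case False
      show ?thesis
        by (rule compact_operator_finite_eigenspace[OF T(2) oA _ False]) (use eig in auto)
    qed
    have sA: "span ?A = eigenspace T \<mu>" by (rule eigenspace_basis[OF B T(1) eig fA])
    obtain A f where A: "independent A" "span A = eigenspace T \<mu>" and f: "bij_betw f {i\<in>N. lam i = \<mu>} A"
      using lam'[of \<mu>] by blast
    have "A \<subseteq> span ?A" using A(2) sA span_superset[of A] by simp
    from independent_span_bound[OF fA A(1) this] have fin: "finite A" by simp
    then show "finite {i\<in>N. lam i = \<mu>}" using bij_betw_finite[OF f] by simp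
    have "card {i\<in>N. lam i = \<mu>} = card A" by (rule bij_betw_same_card[OF f])
    also have "\<dots> = dim (eigenspace T \<mu>)"
      using dim_eq_card_independent[OF A(1)] A(2) dim_span[of A] by simp
    also have "\<dots> = card ?A"
      using dim_eq_card_independent[OF orthonormal_independent[OF oA]] sA dim_span[of ?A] by simp
    finally show "card {i\<in>N. lam i = \<mu>} = card ?A" .
  qed
  then obtain f where fQ: "\<And>\<mu>. Q \<mu> (f \<mu>)" by metis
  have f: "bij_betw (f \<mu>) {i\<in>N. lam i = \<mu>} {b\<in>B. l b = \<mu>}" for \<mu>
    using fQ[of \<mu>] by (simp add: Q_def)
  have ford: "i < j" if "i \<in> N" "j \<in> N" "lam j = lam i" "f (lam i) i \<in> P" "f (lam i) j \<notin> P" for i j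
    using fQ[of "lam i"] that by (simp add: Q_def)
  define e where "e i = f (lam i) i" for i
  have eB: "e i \<in> B" "l (e i) = lam i" if "i \<in> N" for i
    using bij_betwE[OF f[of "lam i"]] that by (auto simp: e_def)
  have bij: "bij_betw e N B"
  proof (rule bij_betw_imageI)
    show "inj_on e N"
    proof (rule inj_onI)
      fix i j assume ij: "i \<in> N" "j \<in> N" "e i = e j"
      then have "lam i = lam j" using eB(2) by metis
      then show "i = j" using ij bij_betw_imp_inj_on[OF f[of "lam i"]]
        by (auto simp: e_def inj_on_def)
    qed
    show "e ` N = B"
    proof
      show "e ` N \<subseteq> B" using eB by auto
      show "B \<subseteq> e ` N"
      proof
        fix b assume "b \<in> B"
        then have "b \<in> f (l b) ` {i\<in>N. lam i = l b}" using bij_betw_imp_surj_on[OF f[of "l b"]] by simp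
        then obtain i where "i \<in> N" "lam i = l b" "b = f (l b) i" by blast
        then have "b = e i" by (simp add: e_def)
        then show "b \<in> e ` N" using \<open>i \<in> N\<close> by (rule image_eqI)
      qed
    qed
  qed
  have ord: "i < j" if "i \<in> N" "j \<in> N" "e i \<in> P" "e j \<notin> P" for i j
  proof (cases "lam i = lam j")
    case True
    then show ?thesis using ford[of i j] that by (simp add: e_def)
  next
    case False
    have "lam j \<le> lam i" using dom[OF that(3), of "e j"] that eB by simp
    then have "lam j < lam i" using False by simp
    then show ?thesis using N(2) that(1,2) unfolding monotone_on_def
      by (meson leD not_le_imp_less)
  qed
  define J where "J = {i\<in>N. e i \<in> P}"
  have bJ: "bij_betw e J P"
  proof (rule bij_betw_imageI)
    show "inj_on e J" using bij_betw_imp_inj_on[OF bij] by (rule inj_on_subset) (auto simp: J_def)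
    show "e ` J = P" using bij_betw_imp_surj_on[OF bij] P(1) by (auto simp: J_def)
  qed
  have cJ: "card J = card P" by (rule bij_betw_same_card[OF bJ])
  have fJ: "finite J" using bij_betw_finite[OF bJ] P(2) by simp
  \<comment> \<open>The set \<open>J\<close> is closed downwards, because \<open>N\<close> is and because members of \<open>P\<close> come before all others.\<close>
  have "J \<subseteq> {..<card P}"
  proof
    fix i assume i: "i \<in> J"
    have "{..i} \<subseteq> J"
    proof
      fix j assume "j \<in> {..i}"
      then have ji: "j \<le> i" by simp
      then have jN: "j \<in> N" using N(1) i by (auto simp: J_def)
      show "j \<in> J"
      proof (rule ccontr)
        assume "j \<notin> J"
        then have "i < j" using ord[of i j] i jN by (auto simp: J_def)
        then show False using ji by simp
      qed
    qed
    then have "card {..i} \<le> card J" by (rule card_mono[OF fJ])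
    then show "i \<in> {..<card P}" using cJ by simp
  qed
  then have J: "J = {..<card P}" by (intro card_subset_eq) (use cJ in auto)
  show ?thesis
  proof (intro exI[of _ e] conjI ballI bij)
    show "bij_betw e {..<card P} P" using bJ J by simp
    show "{..<card P} \<subseteq> N" unfolding J[symmetric] by (auto simp: J_def)
    show "e i \<in> P \<longleftrightarrow> i < card P" if "i \<in> N" for i
    proof -
      have "i \<in> J \<longleftrightarrow> i < card P" unfolding J by simp
      then show ?thesis using that by (simp add: J_def)
    qed
  qed (use eB in auto)
qed

section \<open>The measurement and posterior in the observation space\<close>

lemma riesz_vectors:
  fixes obs :: "('o::{real_inner, complete_space} \<Rightarrow>\<^sub>L real) ^ 'm::finite"
  shows "\<exists>g. \<forall>j x. blinfun_apply (obs $ j) x = g j \<bullet> x"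
proof -
  have "\<exists>g. \<forall>x. blinfun_apply (obs $ j) x = g \<bullet> x" for j
    by (rule riesz_representation[OF blinfun.bounded_linear_right])
  then show ?thesis by metis
qed

lemma norm_riesz_vector:
  fixes f :: "'o::real_inner \<Rightarrow>\<^sub>L real"
  assumes "\<And>x. blinfun_apply f x = g \<bullet> x"
  shows "norm f = norm g"
proof (rule antisym)
  show "norm f \<le> norm g"
    by (rule norm_blinfun_bound) (simp_all add: assms Cauchy_Schwarz_ineq2)
  show "norm g \<le> norm f"
  proof (cases "g = 0")
    case False
    have "norm g * norm g \<le> norm f * norm g"
      using norm_blinfun[of f g] by (simp add: assms norm_eq_sqrt_inner[symmetric] power2_norm_eq_inner[symmetric] power2_eq_square)
    then show ?thesis using False by simp
  qed simp
qed

lemma design_op_information: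
  fixes obs :: "('o::real_inner \<Rightarrow>\<^sub>L real) ^ 'm::finite"
  assumes g: "\<And>j x. blinfun_apply (obs $ j) x = g j \<bullet> x" and v: "v > 0"
  shows "design_op obs x = v *\<^sub>R information v g UNIV x"
proof -
  have "adjoint (measure_op obs) = (\<lambda>y. \<Sum>j\<in>UNIV. (y $ j) *\<^sub>R g j)"
    by (rule adjoint_unique) (simp add: measure_op_def g inner_vec_def inner_sum_right mult.commute inner_commute)
  then show ?thesis using v by (simp add: design_op_def measure_op_def information_def g)
qed

text \<open>The likelihood depends on the parameter only through its image under \<open>F\<close>, so that the
  pushforward of the posterior is the Bayes update of the pushforward of the prior.  The normalising
  constant of the normal densities cancels against the evidence.\<close>

lemma posterior_pushforward:
  fixes F :: "'p::{real_inner, polish_space} \<Rightarrow> 'o::{real_inner, polish_space}"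
    and obs :: "('o \<Rightarrow>\<^sub>L real) ^ 'm::finite"
  assumes F: "bounded_linear F" and \<sigma>: "\<sigma> > 0"
    and prior: "sets prior = sets borel"
    and g: "\<And>j x. blinfun_apply (obs $ j) x = g j \<bullet> x"
    and G: "gaussian_cf (density (distr prior borel F)
        (\<lambda>x. ennreal (\<Prod>j\<in>UNIV. exp (- ((d $ j - g j \<bullet> x)\<^sup>2 / (2 * \<sigma>\<^sup>2)))))) c a S"
  shows "gaussian_cf (distr (posterior prior \<sigma> F obs d) borel F) 1 a S"
proof -
  let ?M = "distr prior borel F"
  let ?E = "\<lambda>x. \<Prod>j\<in>UNIV. exp (- ((d $ j - g j \<bullet> x)\<^sup>2 / (2 * \<sigma>\<^sup>2)))"
  let ?D = "density ?M (\<lambda>x. ennreal (?E x))"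
  define \<kappa> where "\<kappa> = (1 / sqrt (2 * pi * \<sigma>\<^sup>2)) ^ CARD('m)"
  have \<kappa>: "\<kappa> > 0" using \<sigma> by (simp add: \<kappa>_def)
  have c: "c > 0" and cf: "\<And>h. (CLINT x|?D. iexp (h \<bullet> x)) = of_real c * iexp (h \<bullet> a) * of_real (exp (- (h \<bullet> S h) / 2))"
    and fD: "finite_measure ?D" using G by (auto simp: gaussian_cf_def)
  interpret D: finite_measure ?D by (rule fD)
  have [measurable_cong]: "sets prior = sets borel" by (rule prior)
  have [measurable]: "F \<in> borel_measurable borel"
    by (intro borel_measurable_continuous_onI bounded_linear.continuous_on[OF F] continuous_on_id)
  have lik: "likelihood \<sigma> F obs d x = \<kappa> * ?E (F x)" for x
    unfolding likelihood_def \<kappa>_def normal_density_def measure_op_def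
    by (simp add: g prod_dividef power_one_over)
  have E0: "?E x \<ge> 0" for x by (simp add: prod_nonneg)
  have Z: "(LINT y|prior. likelihood \<sigma> F obs d y) = \<kappa> * c"
  proof -
    have "of_real (measure ?D (space ?D)) = complex_of_real c"
      using cf[of 0] by (simp add: scaleR_conv_of_real)
    then have m: "measure ?D (space ?D) = c" by (simp only: of_real_eq_iff)
    have "(LINT x|?M. ?E x) = (LINT x|?D. 1)"
      by (subst integral_density) (auto intro!: prod_nonneg)
    also have "\<dots> = c" using m by simp
    finally have "(LINT x|?M. ?E x) = c" .
    moreover have "(LINT x|?M. ?E x) = (LINT y|prior. ?E (F y))"
      by (rule integral_distr) auto
    ultimately show ?thesis unfolding lik by simp
  qed
  have "distr (posterior prior \<sigma> F obs d) borel F = distr (density prior (\<lambda>x. ennreal (?E (F x) / c))) borel F"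
    unfolding posterior_def Z lik using \<kappa> by simp
  also have "\<dots> = density ?M (\<lambda>x. ennreal (?E x / c))"
    by (rule density_distr[symmetric]) auto
  also have "\<dots> = density ?D (\<lambda>_. ennreal (1 / c))"
    using c E0 by (subst density_density_eq) (auto simp: ennreal_mult[symmetric])
  finally have eq: "distr (posterior prior \<sigma> F obs d) borel F = density ?D (\<lambda>_. ennreal (1 / c))" .
  have "(CLINT x|density ?D (\<lambda>_. ennreal (1 / c)). iexp (h \<bullet> x)) = (CLINT x|?D. (1 / c) *\<^sub>R iexp (h \<bullet> x))" for h
    by (rule integral_density) (use c in auto)
  then have "(CLINT x|density ?D (\<lambda>_. ennreal (1 / c)). iexp (h \<bullet> x)) = of_real 1 * iexp (h \<bullet> a) * of_real (exp (- (h \<bullet> S h) / 2))" for h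
    using c by (simp add: cf scaleR_conv_of_real)
  moreover have "finite_measure (density ?D (\<lambda>_. ennreal (1 / c)))"
  proof (rule finite_measureI)
    have "emeasure (density ?D (\<lambda>_. ennreal (1 / c))) (space ?D) = ennreal (1 / c) * emeasure ?D (space ?D)"
      by (subst emeasure_density) (auto simp: nn_integral_cmult_indicator)
    then show "emeasure (density ?D (\<lambda>_. ennreal (1 / c))) (space (density ?D (\<lambda>_. ennreal (1 / c)))) \<noteq> \<infinity>"
      by (simp add: ennreal_mult_eq_top_iff D.emeasure_finite)
  qed
  ultimately show ?thesis unfolding eq by (simp add: gaussian_cf_def)
qed

lemma posterior_covariance_graph:
  fixes C W :: "'a::real_inner \<Rightarrow> 'a"
  assumes C: "bounded_linear C" and W: "bounded_linear W" and S: "posterior_covariance C W S"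
  shows "graph_of S = (graph_add ((graph_of C)\<inverse>) (graph_of W))\<inverse>"
proof -
  interpret C: bounded_linear C by (rule C)
  interpret W: bounded_linear W by (rule W)
  have Spsd: "positive_semidefinite S" and S1: "\<And>x. S x + S (W (C x)) = C x"
    and S2: "\<And>x. S x + C (W (S x)) = C x" using S by (auto simp: posterior_covariance_def)
  interpret S: bounded_linear S by (rule positive_semidefiniteD(1)[OF Spsd])
  have R: "(graph_add ((graph_of C)\<inverse>) (graph_of W))\<inverse> = {(y + W (C y), C y) | y. True}"
    by (auto simp: graph_add_def graph_of_def)
  show ?thesis unfolding R
  proof (intro equalityI subsetI)
    fix q assume "q \<in> graph_of S"
    then obtain z where q: "q = (z, S z)" by (auto simp: graph_of_def)
    have "C (z - W (S z)) = S z" using S2[of z] by (simp add: C.diff algebra_simps)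
    then have "q = ((z - W (S z)) + W (C (z - W (S z))), C (z - W (S z)))" by (simp add: q)
    then show "q \<in> {(y + W (C y), C y) | y. True}" by blast
  next
    fix q assume "q \<in> {(y + W (C y), C y) | y. True}"
    then obtain y where q: "q = (y + W (C y), C y)" by blast
    have "S (y + W (C y)) = C y" using S1[of y] by (simp add: S.add)
    then show "q \<in> graph_of S" by (auto simp: q graph_of_def)
  qed
qed

lemma gaussian_pushforward:
  fixes F :: "'p::{real_inner, polish_space} \<Rightarrow> 'o::{real_inner, polish_space}"
  assumes F: "bounded_linear F" and G: "gaussian_measure prior a \<Gamma>"
  shows "gaussian_cf (distr prior borel F) 1 (F a) (\<lambda>y. F (\<Gamma> (adjoint F y)))"
proof -
  interpret prob_space prior using G by (simp add: gaussian_measure_def)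
  have [measurable_cong]: "sets prior = sets borel"
    and cf: "\<And>h. (CLINT x|prior. iexp (h \<bullet> x)) = iexp (h \<bullet> a) * of_real (exp (- (h \<bullet> \<Gamma> h) / 2))"
    using G by (auto simp: gaussian_measure_def)
  have [measurable]: "F \<in> borel_measurable borel"
    by (intro borel_measurable_continuous_onI bounded_linear.continuous_on[OF F] continuous_on_id)
  have adj: "h \<bullet> F x = adjoint F h \<bullet> x" for h x
    using adjoint_inner[OF F, of x h] by (simp add: inner_commute)
  have "(CLINT x|distr prior borel F. iexp (h \<bullet> x)) = (CLINT x|prior. iexp (h \<bullet> F x))" for h
    by (rule integral_distr) auto
  moreover have "finite_measure (distr prior borel F)"
    by (intro prob_space.finite_measure prob_space_distr) auto
  ultimately show ?thesis by (simp add: gaussian_cf_def adj cf)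
qed

section \<open>Structure of D-optimal designs\<close>

theorem theorem5p7:
  fixes F :: "'p::{real_inner, polish_space} \<Rightarrow> 'o::{real_inner, polish_space}"
    and \<Gamma> :: "'p \<Rightarrow> 'p" and m_pr :: 'p and prior :: "'p measure"
    and \<sigma> :: real
    and D :: "('o \<Rightarrow>\<^sub>L real) ^ 'm::finite"
    and N :: "nat set" and lam :: "nat \<Rightarrow> real" and k :: nat
  assumes "bounded_linear F"
    and "\<sigma> > 0"
    and "positive_definite \<Gamma>"
    and "gaussian_measure prior m_pr \<Gamma>"
    and "densely_invertible (obs_prior_cov F \<Gamma>)"
    and "D_optimal \<sigma> F \<Gamma> D"
    and "decreasing_eigenvalues N (obs_prior_cov F \<Gamma>) lam"
    and "k = op_rank (design_op D)"
  shows "has_trace (design_op D) (real CARD('m)) \<and>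
    simultaneously_diagonalizable (design_op D) (obs_prior_cov F \<Gamma>) \<and>
    k \<le> CARD('m) \<and>
    (\<exists>e \<eta> \<theta> S.
       orthonormal_basis_on N e \<and>
       (\<forall>i\<in>N. obs_prior_cov F \<Gamma> (e i) = lam i *\<^sub>R e i) \<and>
       (\<forall>i\<in>N. design_op D (e i) = \<eta> i *\<^sub>R e i) \<and>
       design_criterion \<sigma> F \<Gamma> D = 1/2 * (\<Sum>i<k. ln (1 + lam i * \<eta> i / \<sigma>\<^sup>2)) \<and>
       (\<forall>i\<in>N. \<eta> i =
          (if i < k then real CARD('m) / real k - \<sigma>\<^sup>2 / lam i + \<sigma>\<^sup>2 / real k * (\<Sum>j<k. 1 / lam j)
           else 0)) \<and>
       (\<forall>d. has_covariance (distr (posterior prior \<sigma> F D d) borel F) S) \<and>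
       graph_of S =
         (graph_add ((graph_of (obs_prior_cov F \<Gamma>))\<inverse>)
            (graph_of (\<lambda>x. (1 / \<sigma>\<^sup>2) *\<^sub>R design_op D x)))\<inverse> \<and>
       (\<forall>i\<in>N. S (e i) = \<theta> i *\<^sub>R e i) \<and>
       (\<forall>i\<in>N. \<theta> i =
          (if i < k then inverse (((\<Sum>j<k. 1 / lam j) + real CARD('m) / \<sigma>\<^sup>2) / real k)
           else lam i)))"
proof -
  note F = assms(1) and \<sigma> = assms(2) and prior = assms(4)
  define v where "v = \<sigma>\<^sup>2"
  have v: "v > 0" using \<sigma> by (simp add: v_def)
  let ?C0 = "obs_prior_cov F \<Gamma>"
  obtain t where \<Gamma>: "positive_semidefinite \<Gamma>" "has_trace \<Gamma> t" and sp: "sets prior = sets borel"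
    using prior by (auto simp: gaussian_measure_def)
  define R where "R = op_sqrt \<Gamma>"
  have R: "positive_semidefinite R" "\<And>x. R (R x) = \<Gamma> x"
    using op_sqrt_trace_class[OF assms(3) \<Gamma>(2)] by (auto simp: R_def fun_eq_iff)
  note DR = positive_semidefiniteD[OF R(1)]
  \<comment> \<open>The criterion is the determinant of \<open>I + K' W K\<close>, and \<open>K K'\<close> is the prior covariance in the observation space.\<close>
  define K where "K x = F (R x)" for x
  define K' where "K' y = R (adjoint F y)" for y
  have K: "bounded_linear K" unfolding K_def by (rule bounded_linear_compose[OF F DR(1)])
  have K': "bounded_linear K'" unfolding K'_def
    by (rule bounded_linear_compose[OF DR(1) bounded_linear_adjoint[OF F]])
  have C0: "?C0 = (\<lambda>y. K (K' y))" by (simp add: fun_eq_iff obs_prior_cov_def K_def K'_def R(2))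
  interpret bayes_design K K' v
  proof (rule bayes_design.intro)
    show "K x \<bullet> y = x \<bullet> K' y" for x y
      by (simp add: K_def K'_def adjoint_inner[OF F] DR(2))
    show "y = 0" if "K (K' y) = 0" for y
    proof -
      have "inj (\<lambda>y. K (K' y))" using assms(5) by (simp add: densely_invertible_def C0)
      moreover have "K (K' 0) = 0"
        using K K' by (simp add: linear_0 bounded_linear.linear)
      ultimately show ?thesis using that by (metis injD)
    qed
    have "compact_operator (\<lambda>y. F (\<Gamma> (adjoint F y)))"
      by (rule compact_operator_compose[OF psd_trace_class_compact[OF \<Gamma>] _ F bounded_linear_adjoint[OF F]])
        (use positive_semidefiniteD(1)[OF \<Gamma>(1)] in \<open>rule bounded_linear.linear\<close>)
    then show "compact_operator (\<lambda>y. K (K' y))" by (simp add: K_def K'_def R(2))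
  qed (fact K K' v)+
  have crit: "design_criterion \<sigma> F \<Gamma> obs = 1/2 * ln (det (gram v C g))"
    if g: "\<And>j x. blinfun_apply (obs $ j) x = g j \<bullet> x" for obs :: "('o \<Rightarrow>\<^sub>L real) ^ 'm" and g
  proof -
    have "(1 / \<sigma>\<^sup>2) *\<^sub>R op_sqrt \<Gamma> (adjoint F (design_op obs (F (op_sqrt \<Gamma> x)))) =
        K' (information v g UNIV (K x))" for x
      using v unfolding design_op_information[OF g v] R_def[symmetric] K_def[symmetric] K'_def[symmetric] v_def[symmetric]
      by (simp add: K'.scaleR)
    then show ?thesis using det_gram(1)[of g] by (simp add: design_criterion_def)
  qed
  obtain g where "\<forall>j x. blinfun_apply (D $ j) x = g j \<bullet> x" using riesz_vectors[of D] by (rule exE)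
  then have g: "blinfun_apply (D $ j) x = g j \<bullet> x" for j x by blast
  let ?W = "information v g UNIV"
  have WD: "design_op D x = v *\<^sub>R ?W x" for x by (rule design_op_information[OF g v])
  have WD': "(\<lambda>x. (1 / \<sigma>\<^sup>2) *\<^sub>R design_op D x) = ?W" using v by (simp add: WD v_def fun_eq_iff)
  have ng: "norm (g j) = 1" for j
    using assms(6) norm_riesz_vector[of "D $ j" "g j"] g by (simp add: D_optimal_def is_arg_max_def)
  have opt: "optimal_design g" unfolding optimal_design_def
  proof (intro conjI allI impI ng)
    fix h :: "'m \<Rightarrow> 'o" assume h: "\<forall>j. norm (h j) = 1"
    define obs :: "('o \<Rightarrow>\<^sub>L real) ^ 'm" where "obs = (\<chi> j. blinfun_inner_right (h j))"
    have obs: "\<And>j x. blinfun_apply (obs $ j) x = h j \<bullet> x" by (simp add: obs_def)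
    then have "\<forall>j. norm (obs $ j) = 1" using norm_riesz_vector h by metis
    then have "design_criterion \<sigma> F \<Gamma> obs \<le> design_criterion \<sigma> F \<Gamma> D"
      using assms(6) by (auto simp: D_optimal_def is_arg_max_def not_less)
    then have "ln (det (gram v C h)) \<le> ln (det (gram v C g))" by (simp add: crit[OF obs] crit[OF g])
    moreover have "det (gram v C h) > 0" "det (gram v C g) > 0" using det_gram(2)[of h] det_gram(2)[of g] by linarith+
    ultimately show "det (gram v C h) \<le> det (gram v C g)" by (simp add: ln_le_cancel_iff)
  qed
  obtain S where S: "posterior_covariance C ?W S" using posterior_covariance_exists[OF C_psd v, of UNIV g] by auto
  obtain B l w \<tau> where B: "orthonormal_basis B" and \<tau>: "\<tau> > 0"
    and CB: "\<forall>b\<in>B. C b = l b *\<^sub>R b \<and> l b > 0"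
    and WB: "\<forall>b\<in>B. ?W b = w b *\<^sub>R b \<and> (w b \<noteq> 0 \<longrightarrow> w b = 1 / \<tau> - 1 / l b)"
    and SB: "\<forall>b\<in>B. S b = (if w b = 0 then l b else \<tau>) *\<^sub>R b"
    and dom: "\<forall>b\<in>B. \<forall>c\<in>B. w b \<noteq> 0 \<longrightarrow> w c = 0 \<longrightarrow> l c \<le> l b"
    and tr: "(\<Sum>b\<in>{b\<in>B. w b \<noteq> 0}. w b) = CARD('m) / v"
    using optimal_design_structure[OF opt S] by (elim exE conjE)
  have Cb: "C b = l b *\<^sub>R b" and lpos: "l b > 0" and Wb: "?W b = w b *\<^sub>R b"
    and Sb: "S b = (if w b = 0 then l b else \<tau>) *\<^sub>R b" if "b \<in> B" for b
    using CB WB SB that by blast+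
  have w\<tau>: "w b = 1 / \<tau> - 1 / l b" if "b \<in> B" "w b \<noteq> 0" for b using WB that by blast
  let ?I = "{b\<in>B. w b \<noteq> 0}"
  note I = information_eigenbasis[OF v B Wb]
  have oI: "orthonormal ?I" using B by (auto simp: orthonormal_basis_iff intro: orthonormal_subset)
  have k: "k = card ?I"
  proof -
    have "range (design_op D) = range ?W"
    proof (intro equalityI subsetI)
      fix y assume "y \<in> range (design_op D)"
      then obtain x where "y = v *\<^sub>R ?W x" by (auto simp: WD)
      then have "y = ?W (v *\<^sub>R x)" by (simp add: information_def scaleR_sum_right mult_ac)
      then show "y \<in> range ?W" by blast
    next
      fix y assume "y \<in> range ?W"
      then obtain x where "y = ?W x" by blast
      then have "y = design_op D ((1/v) *\<^sub>R x)" using v by (simp add: WD information_def scaleR_sum_right mult_ac)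
      then show "y \<in> range (design_op D)" by blast
    qed
    then have "k = dim (span ?I)" using assms(8) I(3) by (simp add: op_rank_def)
    then show ?thesis using dim_eq_card_independent[OF orthonormal_independent[OF oI]] by simp
  qed
  have "\<exists>e. bij_betw e N B \<and> (\<forall>i\<in>N. l (e i) = lam i) \<and> bij_betw e {..<card ?I} ?I \<and>
      {..<card ?I} \<subseteq> N \<and> (\<forall>i\<in>N. e i \<in> ?I \<longleftrightarrow> i < card ?I)"
    by (rule eigenbasis_enumeration[OF B C_psd compact Cb lpos assms(7)[unfolded C0] _ I(1)])
      (use dom in auto)
  then obtain e where e0: "bij_betw e N B" "\<forall>i\<in>N. l (e i) = lam i" "bij_betw e {..<card ?I} ?I"
      "{..<card ?I} \<subseteq> N" "\<forall>i\<in>N. e i \<in> ?I \<longleftrightarrow> i < card ?I"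
    by (elim exE conjE)
  have le: "l (e i) = lam i" if "i \<in> N" for i using e0(2) that by blast
  note e = e0(1) le and ek = e0(3,4)[folded k]
  have eB: "e i \<in> B" if "i \<in> N" for i using e(1) that by (auto simp: bij_betw_def)
  have we: "w (e i) \<noteq> 0 \<longleftrightarrow> i < k" if "i \<in> N" for i using e0(5) eB[OF that] that unfolding k by blast
  define \<eta> where "\<eta> i = v * w (e i)" for i
  define \<theta> where "\<theta> i = (if i < k then \<tau> else lam i)" for i
  let ?L = "\<Sum>j<k. 1 / lam j"
  have wi: "w (e i) = 1 / \<tau> - 1 / lam i" if "i < k" for i
  proof -
    have "i \<in> N" using ek(2) that by auto
    then show ?thesis using w\<tau>[OF eB] we e(2) that by metis
  qed
  \<comment> \<open>Summing \<open>w (e i) = 1 / \<tau> - 1 / lam i\<close> over the measured directions, the trace condition determines \<open>\<tau>\<close>.\<close>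
  have "(\<Sum>i<k. w (e i)) = CARD('m) / v"
    using sum.reindex_bij_betw[OF ek(1), of w] tr by simp
  moreover have "(\<Sum>i<k. w (e i)) = real k / \<tau> - ?L"
    by (simp add: wi sum_subtractf)
  ultimately have kt: "real k / \<tau> = ?L + CARD('m) / v" by linarith
  have k0: "k > 0"
  proof (rule ccontr)
    assume "\<not> k > 0"
    then show False using kt v by simp
  qed
  have \<tau>1: "1 / \<tau> = (?L + CARD('m) / v) / real k" using kt k0 \<tau> by (simp add: field_simps)
  have "has_trace (design_op D) (real CARD('m))"
    unfolding has_trace_def
  proof (intro allI impI)
    fix B' :: "'o set" assume "orthonormal_basis B'"
    from has_sum_cmult_right[OF information_trace[OF this ng, of v], of v]
    show "((\<lambda>b. design_op D b \<bullet> b) has_sum real CARD('m)) B'" using v by (simp add: WD)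
  qed
  moreover have "simultaneously_diagonalizable (design_op D) ?C0"
    unfolding simultaneously_diagonalizable_def
    using B Cb Wb by (intro exI[of _ B]) (auto simp: WD C0 intro: exI[of _ "v * w _"])
  moreover have "k \<le> CARD('m)" using I(2) k by simp
  moreover have "orthonormal_basis_on N e"
    using e(1) B by (auto simp: orthonormal_basis_on_def bij_betw_def)
  moreover have "\<forall>i\<in>N. ?C0 (e i) = lam i *\<^sub>R e i" using Cb[OF eB] e(2) by (simp add: C0)
  moreover have "\<forall>i\<in>N. design_op D (e i) = \<eta> i *\<^sub>R e i" using Wb[OF eB] by (simp add: WD \<eta>_def)
  moreover have "design_criterion \<sigma> F \<Gamma> D = 1/2 * (\<Sum>i<k. ln (1 + lam i * \<eta> i / \<sigma>\<^sup>2))"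
  proof -
    have pos: "1 + l b * w b > 0" if "b \<in> B" for b
    proof -
      have "b \<bullet> b = 1" using B orthonormal_inner[of B b b] that by (auto simp: orthonormal_basis_iff)
      then have "w b \<ge> 0" using positive_semidefiniteD(3)[OF information_psd[OF v, of g UNIV], of b] Wb[OF that] by simp
      then show ?thesis using lpos[OF that] by (simp add: add_pos_nonneg)
    qed
    have "ln (det (gram v C g)) = ln (\<Prod>b\<in>?I. 1 + l b * w b)"
      by (rule arg_cong[OF det_gram_eigenbasis[OF B Cb Wb]])
    also have "\<dots> = (\<Sum>b\<in>?I. ln (1 + l b * w b))"
    proof (rule ln_prod[OF I(1)])
      show "1 + l b * w b \<noteq> 0" if "b \<in> ?I" for b using pos[of b] that by simp
    qed
    also have "\<dots> = (\<Sum>i<k. ln (1 + l (e i) * w (e i)))"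
      by (rule sum.reindex_bij_betw[OF ek(1), symmetric])
    also have "\<dots> = (\<Sum>i<k. ln (1 + lam i * \<eta> i / \<sigma>\<^sup>2))"
      using ek(2) e(2) v by (intro sum.cong) (auto simp: \<eta>_def v_def)
    finally show ?thesis by (simp add: crit[OF g])
  qed
  moreover have "\<forall>i\<in>N. \<eta> i = (if i < k then real CARD('m) / real k - \<sigma>\<^sup>2 / lam i + \<sigma>\<^sup>2 / real k * ?L else 0)"
  proof
    fix i assume i: "i \<in> N"
    show "\<eta> i = (if i < k then real CARD('m) / real k - \<sigma>\<^sup>2 / lam i + \<sigma>\<^sup>2 / real k * ?L else 0)"
    proof (cases "i < k")
      case True
      have "\<eta> i = v * ((?L + CARD('m) / v) / real k) - v / lam i"
        unfolding \<eta>_def wi[OF True] \<tau>1 by (simp add: right_diff_distrib)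
      also have "v * ((?L + CARD('m) / v) / real k) = v / real k * ?L + CARD('m) / real k"
        using v by (simp add: add_divide_distrib distrib_left)
      finally show ?thesis using True by (simp add: v_def)
    next
      case False
      then show ?thesis using we[OF i] by (simp add: \<eta>_def)
    qed
  qed
  moreover have "\<forall>d. has_covariance (distr (posterior prior \<sigma> F D d) borel F) S"
  proof
    fix d :: "real^'m"
    have push: "gaussian_cf (distr prior borel F) 1 (F m_pr) C"
      using gaussian_pushforward[OF F prior] by (simp add: K_def K'_def R(2))
    from gaussian_cf_measurements[OF push C_psd v, of UNIV g "\<lambda>j. d $ j"]
    obtain c a S' where S': "posterior_covariance C ?W S'"
      and G: "gaussian_cf (density (distr prior borel F)
        (\<lambda>x. ennreal (\<Prod>j\<in>UNIV. exp (- ((d $ j - g j \<bullet> x)\<^sup>2 / (2 * v)))))) c a S'" by auto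
    have "S' = S" by (rule posterior_covariance_unique[OF C_psd information_psd[OF v] S' S])
    moreover have "gaussian_cf (distr (posterior prior \<sigma> F D d) borel F) 1 a S'"
      by (rule posterior_pushforward[OF F \<sigma> sp g G[unfolded v_def]])
    ultimately show "has_covariance (distr (posterior prior \<sigma> F D d) borel F) S"
      using S by (auto simp: posterior_covariance_def intro: gaussian_cf_has_covariance)
  qed
  moreover have "graph_of S = (graph_add ((graph_of ?C0)\<inverse>)
      (graph_of (\<lambda>x. (1 / \<sigma>\<^sup>2) *\<^sub>R design_op D x)))\<inverse>"
    unfolding WD' C0
    by (rule posterior_covariance_graph[OF positive_semidefiniteD(1)[OF C_psd]
        positive_semidefiniteD(1)[OF information_psd[OF v]] S])
  moreover have "\<forall>i\<in>N. S (e i) = \<theta> i *\<^sub>R e i"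
  proof
    fix i assume "i \<in> N"
    then show "S (e i) = \<theta> i *\<^sub>R e i"
      using Sb[OF eB, of i] we[of i] e(2)[of i] by (cases "w (e i) = 0") (simp_all add: \<theta>_def)
  qed
  moreover have "\<forall>i\<in>N. \<theta> i = (if i < k then inverse ((?L + real CARD('m) / \<sigma>\<^sup>2) / real k) else lam i)"
    using \<tau>1 unfolding \<theta>_def v_def by (metis inverse_eq_divide inverse_inverse_eq)
  ultimately show ?thesis by blast
qed

end
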